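(* Let $u_0\in H^2_0(\Omega)$, $u_1\in L^2(\Omega)$, and $f\in C([0,t_1];L^2(\Omega))$ with $t_1=k$. Set $$\check M_2:=\|J\|^2|||u_0|||^2\Big(1+\tfrac14 C_{\rm dS}^2\|J\|^2|||u_0|||^2\Big)+4\|u_1\|^2+k^2\|f\|^2_{C([0,t_1];L^2(\Omega))},\qquad M_2:=C_{\rm dS}^2\big(\|J\|^2|||u_0|||^2+\check M_2\big).$$ Consider problem (I0): find $(u_{\rm M}^0,v_{\rm M}^0)\in {\rm M}(\mathcal T)\times {\rm M}(\mathcal T)$ such that for all $\varphi_{\rm M},\psi_{\rm M}\in {\rm M}(\mathcal T)$ $$a_{\rm pw}(u_{\rm M}^0,\varphi_{\rm M})=a(u_0,J\varphi_{\rm M}),\qquad a_{\rm pw}(v_{\rm M}^0,\psi_{\rm M})=\tfrac12 b_{\rm pw}(u_{\rm M}^0,u_{\rm M}^0,\psi_{\rm M}),$$ and problem (I1): given the solution of (I0), find $(u_{\rm M}^1,v_{\rm M}^1)\in {\rm M}(\mathcal T)\times {\rm M}(\mathcal T)$ such that for all $\varphi_{\rm M},\psi_{\rm M}\in {\rm M}(\mathcal T)$ $$2k^{-1}(\bar\partial_t u_{\rm M}^{1/2}-u_1,\varphi_{\rm M})_{L^2(\Omega)}+a_{\rm pw}(u_{\rm M}^{1/2},\varphi_{\rm M})+b_{\rm pw}(u_{\rm M}^{1/2},\varphi_{\rm M},v_{\rm M}^{1/2})=(f^{1/2},\varphi_{\rm M})_{L^2(\Omega)},$$ $$a_{\rm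 pw}(v_{\rm M}^1,\psi_{\rm M})-\tfrac12 b_{\rm pw}(u_{\rm M}^1,u_{\rm M}^1,\psi_{\rm M})=0.$$ Then: (a) (I0) is well-posed (it has a unique solution), and $|||u_{\rm M}^0|||_{\rm pw}\le\|J\|\,|||u_0|||$ and $|||v_{\rm M}^0|||_{\rm pw}\le\frac12 C_{\rm dS}\|J\|^2|||u_0|||^2$; (b) there exists a solution $(u_{\rm M}^1,v_{\rm M}^1)$ to (I1); (c) (any solution) $(u_{\rm M}^1,v_{\rm M}^1)$ to (I1) satisfies $|||u_{\rm M}^1|||_{\rm pw}+|||v_{\rm M}^1|||_{\rm pw}\le\sqrt2\,\check M_2^{1/2}$; (d) if $M_2\le 1$, then the solution $(u_{\rm M}^1,v_{\rm M}^1)$ to (I1) is unique.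
   Context: $\Omega\subset\mathbb R^2$ is a bounded polygonal Lipschitz domain, $\mathcal T$ a shape-regular triangulation of $\Omega$ into triangles, $k=T/N>0$ ($N\in\mathbb N$) a time step, $t_n=nk$. $\|\cdot\|$ is the $L^2(\Omega)$ norm. $D^2_{\rm pw}$ is the $\mathcal T$-piecewise Hessian. Bracket: $[\varphi,\chi]:=\varphi_{xx}\chi_{yy}+\varphi_{yy}\chi_{xx}-2\varphi_{xy}\chi_{xy}$. Morley space: ${\rm M}(\mathcal T)$ is the space of $\mathcal T$-piecewise polynomials of degree at most 2 that are continuous at interior vertices, whose normal derivatives are continuous at midpoints of interior edges, and that vanish at the vertices on $\partial\Omega$ with normal derivatives vanishing at midpoints of boundary edges. Forms: $a(\varphi,\psi):=\int_\Omega D^2\varphi:D^2\psi\,dx$ on $H^2_0(\Omega)$; on $H^2_0(\Omega)+{\rm M}(\mathcal T)$, $a_{\rm pw}(\varphi,\psi):=\int_\Omega D^2_{\rm pw}\varphi:D^2_{\rm pw}\psi\,dx$ and $b_{\rm pw}(\varphi,\chi,\psi):=-\sum_{K\in\mathcal T}\int_K[\varphi,\chi]\psi\,dx$. Norms: $|||\varphi|||:=|\varphi|_{H^2(\Omega)}$, $|||\varphi|||_{\rm pw}:=a_{\rm pw}(\varphi,\varphi)^{1/2}$ (a norm on $H^2_0(\Omega)+{\rm M}(\mathcal T)$, which with $a_{\rm pw}$ is a Hilbert space). $C_{\rm dS}>0$ is a constant (discrete Sobolev embedding) with $\|\psi\|_{L^\infty(\Omega)}\le C_{\rm dS}|||\psi|||_{\rm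 pw}$ for all $\psi\in H^2_0(\Omega)+{\rm M}(\mathcal T)$; consequently $|b_{\rm pw}(\varphi,\chi,\psi)|\le C_{\rm dS}|||\varphi|||_{\rm pw}|||\chi|||_{\rm pw}|||\psi|||_{\rm pw}$. $J:{\rm M}(\mathcal T)\to H^2_0(\Omega)$ is a fixed bounded linear (companion) operator, and $\|J\|$ is its operator norm from $({\rm M}(\mathcal T),|||\cdot|||_{\rm pw})$ to $(H^2_0(\Omega),|||\cdot|||)$. Time notation: $\varphi^n=\varphi(t_n)$ for functions of time, $\varphi^{1/2}:=\frac12(\varphi^1+\varphi^0)$ and $\bar\partial_t\varphi^{1/2}:=k^{-1}(\varphi^1-\varphi^0)$. *)

theory Defs
  imports "HOL-Analysis.Analysis" "HOL-Probability.Essential_Supremum"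
begin

section \<open>Bounded polygonal Lipschitz domains and triangulations\<close>

text \<open>Near each boundary point the set is, in suitable Cartesian coordinates, the strict epigraph
  of a Lipschitz function.\<close>

definition lipschitz_domain :: "(real^2) set \<Rightarrow> bool" where
  "lipschitz_domain \<Omega> \<longleftrightarrow> open \<Omega> \<and> connected \<Omega> \<and> \<Omega> \<noteq> {} \<and>
    (\<forall>p\<in>frontier \<Omega>. \<exists>r>0. \<exists>(Q :: real^2 \<Rightarrow> real^2) (\<gamma> :: real \<Rightarrow> real) L. orthogonal_transformation Q \<and> L-lipschitz_on UNIV \<gamma> \<and>
       (\<forall>x\<in>ball p r. x \<in> \<Omega> \<longleftrightarrow> \<gamma> (Q x $ 1) < Q x $ 2))"

definition polygonal_boundary :: "(real^2) set \<Rightarrow> bool" where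
  "polygonal_boundary \<Omega> \<longleftrightarrow>
    (\<exists>S. finite S \<and> frontier \<Omega> = (\<Union>(a,b)\<in>S. closed_segment a b))"

definition polygonal_lipschitz_domain :: "(real^2) set \<Rightarrow> bool" where
  "polygonal_lipschitz_domain \<Omega> \<longleftrightarrow> bounded \<Omega> \<and> lipschitz_domain \<Omega> \<and> polygonal_boundary \<Omega>"

text \<open>The elements of a triangulation are closed triangles. The library's notion
  \<^const>\<open>triangulation\<close> (any two elements meet in a common face) is what excludes hanging nodes.\<close>

definition triangulation_of :: "(real^2) set \<Rightarrow> (real^2) set set \<Rightarrow> bool" where
  "triangulation_of \<Omega> \<T> \<longleftrightarrow> triangulation \<T> \<and> (\<forall>K\<in>\<T>. 2 simplex K) \<and> \<Union>\<T> = closure \<Omega>"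

definition shape_regular :: "real \<Rightarrow> (real^2) set set \<Rightarrow> bool" where
  "shape_regular \<kappa> \<T> \<longleftrightarrow> \<kappa> > 0 \<and> (\<forall>K\<in>\<T>. \<exists>c. cball c (\<kappa> * diameter K) \<subseteq> K)"


section \<open>Square integrable functions\<close>

text \<open>Elements of function spaces over a set \<open>S\<close> are represented by functions on the plane; their
  values outside \<open>S\<close> are irrelevant, and two representatives are identified iff they agree almost
  everywhere on \<open>S\<close>.\<close>

definition ae_eq :: "(real^2) set \<Rightarrow> (real^2 \<Rightarrow> real) \<Rightarrow> (real^2 \<Rightarrow> real) \<Rightarrow> bool" where
  "ae_eq S f g \<longleftrightarrow> (AE x in lebesgue_on S. f x = g x)"

definition L2 :: "(real^2) set \<Rightarrow> (real^2 \<Rightarrow> real) set" where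
  "L2 S = {f \<in> borel_measurable (lebesgue_on S). integrable (lebesgue_on S) (\<lambda>x. (f x)\<^sup>2)}"

definition l2_inner :: "(real^2) set \<Rightarrow> (real^2 \<Rightarrow> real) \<Rightarrow> (real^2 \<Rightarrow> real) \<Rightarrow> real" where
  "l2_inner S f g = (\<integral>x. f x * g x \<partial>lebesgue_on S)"

definition l2_norm :: "(real^2) set \<Rightarrow> (real^2 \<Rightarrow> real) \<Rightarrow> real" where
  "l2_norm S f = sqrt (l2_inner S f f)"

definition linf_norm :: "(real^2) set \<Rightarrow> (real^2 \<Rightarrow> real) \<Rightarrow> ereal" where
  "linf_norm S f = esssup (lebesgue_on S) (\<lambda>x. ereal \<bar>f x\<bar>)"

definition C_L2 :: "(real^2) set \<Rightarrow> real \<Rightarrow> (real \<Rightarrow> real^2 \<Rightarrow> real) set" where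
  "C_L2 \<Omega> \<tau> = {f. (\<forall>t\<in>{0..\<tau>}. f t \<in> L2 \<Omega>) \<and>
     (\<forall>t\<in>{0..\<tau>}. ((\<lambda>s. l2_norm \<Omega> (\<lambda>x. f s x - f t x)) \<longlongrightarrow> 0) (at t within {0..\<tau>}))}"

definition C_L2_norm :: "(real^2) set \<Rightarrow> real \<Rightarrow> (real \<Rightarrow> real^2 \<Rightarrow> real) \<Rightarrow> real" where
  "C_L2_norm \<Omega> \<tau> f = (SUP t\<in>{0..\<tau>}. l2_norm \<Omega> (f t))"


section \<open>Weak derivatives and Sobolev spaces\<close>

text \<open>Multi-indices are lists of coordinate directions, so that \<open>[i, j]\<close> stands for the second order
  partial derivative in the directions \<open>i\<close> and \<open>j\<close>.\<close>

definition partial :: "2 \<Rightarrow> (real^2 \<Rightarrow> real) \<Rightarrow> real^2 \<Rightarrow> real" where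
  "partial i f = (\<lambda>x. frechet_derivative f (at x) (axis i 1))"

definition partials :: "2 list \<Rightarrow> (real^2 \<Rightarrow> real) \<Rightarrow> real^2 \<Rightarrow> real" where
  "partials is f = foldr partial is f"

definition smooth :: "(real^2 \<Rightarrow> real) \<Rightarrow> bool" where
  "smooth f \<longleftrightarrow> (\<forall>is x. partials is f differentiable (at x))"

definition test_functions :: "(real^2) set \<Rightarrow> (real^2 \<Rightarrow> real) set" where
  "test_functions S = {\<eta>. smooth \<eta> \<and> compact (closure {x. \<eta> x \<noteq> 0}) \<and> closure {x. \<eta> x \<noteq> 0} \<subseteq> S}"

definition has_weak_deriv ::
  "(real^2) set \<Rightarrow> 2 list \<Rightarrow> (real^2 \<Rightarrow> real) \<Rightarrow> (real^2 \<Rightarrow> real) \<Rightarrow> bool" where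
  "has_weak_deriv S is f g \<longleftrightarrow> g \<in> L2 S \<and>
    (\<forall>\<eta>\<in>test_functions S. l2_inner S f (partials is \<eta>) = (-1) ^ length is * l2_inner S g \<eta>)"

text \<open>Weak derivatives are unique up to null sets; the choice below only picks a representative.\<close>

definition weak_deriv :: "(real^2) set \<Rightarrow> 2 list \<Rightarrow> (real^2 \<Rightarrow> real) \<Rightarrow> real^2 \<Rightarrow> real" where
  "weak_deriv S is f = (SOME g. has_weak_deriv S is f g)"

definition H2 :: "(real^2) set \<Rightarrow> (real^2 \<Rightarrow> real) set" where
  "H2 \<Omega> = {f \<in> L2 \<Omega>. \<forall>is. length is \<le> 2 \<longrightarrow> (\<exists>g. has_weak_deriv \<Omega> is f g)}"

definition H2_norm :: "(real^2) set \<Rightarrow> (real^2 \<Rightarrow> real) \<Rightarrow> real" where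
  "H2_norm \<Omega> f = sqrt ((l2_norm \<Omega> f)\<^sup>2 + (\<Sum>i\<in>UNIV. (l2_norm \<Omega> (weak_deriv \<Omega> [i] f))\<^sup>2)
     + (\<Sum>i\<in>UNIV. \<Sum>j\<in>UNIV. (l2_norm \<Omega> (weak_deriv \<Omega> [i, j] f))\<^sup>2))"

text \<open>\<open>H\<^sup>2\<^sub>0\<close> is the closure of the test functions in \<open>H\<^sup>2\<close>.\<close>

definition H20 :: "(real^2) set \<Rightarrow> (real^2 \<Rightarrow> real) set" where
  "H20 \<Omega> = {f \<in> H2 \<Omega>. \<forall>\<epsilon>>0. \<exists>\<eta>\<in>test_functions \<Omega>. H2_norm \<Omega> (\<lambda>x. f x - \<eta> x) < \<epsilon>}"

definition a_form :: "(real^2) set \<Rightarrow> (real^2 \<Rightarrow> real) \<Rightarrow> (real^2 \<Rightarrow> real) \<Rightarrow> real" where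
  "a_form \<Omega> \<phi> \<psi> =
    (\<integral>x. (\<Sum>i\<in>UNIV. \<Sum>j\<in>UNIV. weak_deriv \<Omega> [i, j] \<phi> x * weak_deriv \<Omega> [i, j] \<psi> x) \<partial>lebesgue_on \<Omega>)"

definition H2_seminorm :: "(real^2) set \<Rightarrow> (real^2 \<Rightarrow> real) \<Rightarrow> real" where
  "H2_seminorm \<Omega> \<phi> = sqrt (\<Sum>i\<in>UNIV. \<Sum>j\<in>UNIV. (l2_norm \<Omega> (weak_deriv \<Omega> [i, j] \<phi>))\<^sup>2)"


section \<open>The Morley space\<close>

definition quadratic_polynomial :: "(real^2 \<Rightarrow> real) \<Rightarrow> bool" where
  "quadratic_polynomial p \<longleftrightarrow> (\<exists>c0 c1 c2 c3 c4 c5. \<forall>x.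
     p x = c0 + c1 * x$1 + c2 * x$2 + c3 * (x$1)\<^sup>2 + c4 * (x$1 * x$2) + c5 * (x$2)\<^sup>2)"

text \<open>Piecewise functions are only determined in the interiors of the triangles; the one-sided traces
  at vertices and edge midpoints are those of the polynomials \<open>p K\<close>. In the edge conditions the case
  of two distinct triangles \<open>K\<close>, \<open>K'\<close> sharing an edge covers exactly the interior edges.\<close>

definition morley :: "(real^2) set \<Rightarrow> (real^2) set set \<Rightarrow> (real^2 \<Rightarrow> real) set" where
  "morley \<Omega> \<T> = {\<phi>. \<exists>p.
     (\<forall>K\<in>\<T>. quadratic_polynomial (p K) \<and> (\<forall>x\<in>interior K. \<phi> x = p K x)) \<and>
     (\<forall>K\<in>\<T>. \<forall>K'\<in>\<T>. \<forall>z\<in>\<Omega>. z extreme_point_of K \<and> z extreme_point_of K' \<longrightarrow> p K z = p K' z) \<and>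
     (\<forall>K\<in>\<T>. \<forall>z\<in>frontier \<Omega>. z extreme_point_of K \<longrightarrow> p K z = 0) \<and>
     (\<forall>K\<in>\<T>. \<forall>K'\<in>\<T>. \<forall>a b \<nu>.
        closed_segment a b edge_of K \<and> closed_segment a b edge_of K' \<and>
        norm \<nu> = 1 \<and> orthogonal \<nu> (b - a) \<longrightarrow>
        frechet_derivative (p K) (at (midpoint a b)) \<nu> =
        frechet_derivative (p K') (at (midpoint a b)) \<nu>) \<and>
     (\<forall>K\<in>\<T>. \<forall>a b \<nu>.
        closed_segment a b edge_of K \<and> closed_segment a b \<subseteq> frontier \<Omega> \<and>
        norm \<nu> = 1 \<and> orthogonal \<nu> (b - a) \<longrightarrow>
        frechet_derivative (p K) (at (midpoint a b)) \<nu> = 0)}"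

definition H20_plus_morley :: "(real^2) set \<Rightarrow> (real^2) set set \<Rightarrow> (real^2 \<Rightarrow> real) set" where
  "H20_plus_morley \<Omega> \<T> = {\<lambda>x. v x + w x | v w. v \<in> H20 \<Omega> \<and> w \<in> morley \<Omega> \<T>}"


section \<open>Piecewise forms\<close>

text \<open>The sum has at most one nonzero term, as the interiors of the triangles are disjoint.\<close>

definition D2pw :: "(real^2) set set \<Rightarrow> (real^2 \<Rightarrow> real) \<Rightarrow> 2 \<Rightarrow> 2 \<Rightarrow> real^2 \<Rightarrow> real" where
  "D2pw \<T> \<phi> i j x = (\<Sum>K\<in>\<T>. if x \<in> interior K then weak_deriv (interior K) [i, j] \<phi> x else 0)"

definition a_pw ::
  "(real^2) set \<Rightarrow> (real^2) set set \<Rightarrow> (real^2 \<Rightarrow> real) \<Rightarrow> (real^2 \<Rightarrow> real) \<Rightarrow> real" where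
  "a_pw \<Omega> \<T> \<phi> \<psi> =
    (\<integral>x. (\<Sum>i\<in>UNIV. \<Sum>j\<in>UNIV. D2pw \<T> \<phi> i j x * D2pw \<T> \<psi> i j x) \<partial>lebesgue_on \<Omega>)"

definition norm_pw :: "(real^2) set \<Rightarrow> (real^2) set set \<Rightarrow> (real^2 \<Rightarrow> real) \<Rightarrow> real" where
  "norm_pw \<Omega> \<T> \<phi> = sqrt (a_pw \<Omega> \<T> \<phi> \<phi>)"

definition bracket_pw ::
  "(real^2) set set \<Rightarrow> (real^2 \<Rightarrow> real) \<Rightarrow> (real^2 \<Rightarrow> real) \<Rightarrow> real^2 \<Rightarrow> real" where
  "bracket_pw \<T> \<phi> \<xi> x = D2pw \<T> \<phi> 1 1 x * D2pw \<T> \<xi> 2 2 x + D2pw \<T> \<phi> 2 2 x * D2pw \<T> \<xi> 1 1 x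
     - 2 * (D2pw \<T> \<phi> 1 2 x * D2pw \<T> \<xi> 1 2 x)"

definition b_pw ::
  "(real^2) set set \<Rightarrow> (real^2 \<Rightarrow> real) \<Rightarrow> (real^2 \<Rightarrow> real) \<Rightarrow> (real^2 \<Rightarrow> real) \<Rightarrow> real" where
  "b_pw \<T> \<phi> \<xi> \<psi> = - (\<Sum>K\<in>\<T>. (\<integral>x. bracket_pw \<T> \<phi> \<xi> x * \<psi> x \<partial>lebesgue_on K))"

definition discrete_sobolev_constant :: "(real^2) set \<Rightarrow> (real^2) set set \<Rightarrow> real \<Rightarrow> bool" where
  "discrete_sobolev_constant \<Omega> \<T> C \<longleftrightarrow> C > 0 \<and>
    (\<forall>\<psi>\<in>H20_plus_morley \<Omega> \<T>. linf_norm \<Omega> \<psi> \<le> ereal (C * norm_pw \<Omega> \<T> \<psi>))"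


section \<open>The operator \<open>J\<close>\<close>

definition bounded_linear_J ::
  "(real^2) set \<Rightarrow> (real^2) set set \<Rightarrow> ((real^2 \<Rightarrow> real) \<Rightarrow> real^2 \<Rightarrow> real) \<Rightarrow> bool" where
  "bounded_linear_J \<Omega> \<T> J \<longleftrightarrow>
    (\<forall>\<phi>\<in>morley \<Omega> \<T>. J \<phi> \<in> H20 \<Omega>) \<and>
    (\<forall>\<phi>\<in>morley \<Omega> \<T>. \<forall>\<psi>\<in>morley \<Omega> \<T>. \<forall>\<alpha> \<beta>.
       ae_eq \<Omega> (J (\<lambda>x. \<alpha> * \<phi> x + \<beta> * \<psi> x)) (\<lambda>x. \<alpha> * J \<phi> x + \<beta> * J \<psi> x)) \<and>
    (\<exists>B. \<forall>\<phi>\<in>morley \<Omega> \<T>. H2_seminorm \<Omega> (J \<phi>) \<le> B * norm_pw \<Omega> \<T> \<phi>)"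

definition opnorm_J ::
  "(real^2) set \<Rightarrow> (real^2) set set \<Rightarrow> ((real^2 \<Rightarrow> real) \<Rightarrow> real^2 \<Rightarrow> real) \<Rightarrow> real" where
  "opnorm_J \<Omega> \<T> J = (SUP \<phi>\<in>morley \<Omega> \<T>. H2_seminorm \<Omega> (J \<phi>) / norm_pw \<Omega> \<T> \<phi>)"


section \<open>The discrete problems for the first two time levels\<close>

definition solves_I0 ::
  "(real^2) set \<Rightarrow> (real^2) set set \<Rightarrow> ((real^2 \<Rightarrow> real) \<Rightarrow> real^2 \<Rightarrow> real) \<Rightarrow>
   (real^2 \<Rightarrow> real) \<Rightarrow> (real^2 \<Rightarrow> real) \<Rightarrow> (real^2 \<Rightarrow> real) \<Rightarrow> bool" where
  "solves_I0 \<Omega> \<T> J u0 uM0 vM0 \<longleftrightarrow> uM0 \<in> morley \<Omega> \<T> \<and> vM0 \<in> morley \<Omega> \<T> \<and>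
    (\<forall>\<phi>\<in>morley \<Omega> \<T>. a_pw \<Omega> \<T> uM0 \<phi> = a_form \<Omega> u0 (J \<phi>)) \<and>
    (\<forall>\<psi>\<in>morley \<Omega> \<T>. a_pw \<Omega> \<T> vM0 \<psi> = 1/2 * b_pw \<T> uM0 uM0 \<psi>)"

definition half :: "(real^2 \<Rightarrow> real) \<Rightarrow> (real^2 \<Rightarrow> real) \<Rightarrow> real^2 \<Rightarrow> real" where
  "half \<phi>0 \<phi>1 = (\<lambda>x. (\<phi>1 x + \<phi>0 x) / 2)"

definition dt_half :: "real \<Rightarrow> (real^2 \<Rightarrow> real) \<Rightarrow> (real^2 \<Rightarrow> real) \<Rightarrow> real^2 \<Rightarrow> real" where
  "dt_half k \<phi>0 \<phi>1 = (\<lambda>x. (\<phi>1 x - \<phi>0 x) / k)"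

definition solves_I1 ::
  "(real^2) set \<Rightarrow> (real^2) set set \<Rightarrow> real \<Rightarrow> (real^2 \<Rightarrow> real) \<Rightarrow> (real \<Rightarrow> real^2 \<Rightarrow> real) \<Rightarrow>
   (real^2 \<Rightarrow> real) \<Rightarrow> (real^2 \<Rightarrow> real) \<Rightarrow> (real^2 \<Rightarrow> real) \<Rightarrow> (real^2 \<Rightarrow> real) \<Rightarrow> bool" where
  "solves_I1 \<Omega> \<T> k u1 f uM0 vM0 uM1 vM1 \<longleftrightarrow> uM1 \<in> morley \<Omega> \<T> \<and> vM1 \<in> morley \<Omega> \<T> \<and>
    (\<forall>\<phi>\<in>morley \<Omega> \<T>.
       2 / k * l2_inner \<Omega> (\<lambda>x. dt_half k uM0 uM1 x - u1 x) \<phi>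
       + a_pw \<Omega> \<T> (half uM0 uM1) \<phi> + b_pw \<T> (half uM0 uM1) \<phi> (half vM0 vM1)
       = l2_inner \<Omega> (half (f 0) (f k)) \<phi>) \<and>
    (\<forall>\<psi>\<in>morley \<Omega> \<T>. a_pw \<Omega> \<T> vM1 \<psi> - 1/2 * b_pw \<T> uM1 uM1 \<psi> = 0)"

definition M2_check ::
  "(real^2) set \<Rightarrow> (real^2) set set \<Rightarrow> ((real^2 \<Rightarrow> real) \<Rightarrow> real^2 \<Rightarrow> real) \<Rightarrow> real \<Rightarrow> real \<Rightarrow>
   (real^2 \<Rightarrow> real) \<Rightarrow> (real^2 \<Rightarrow> real) \<Rightarrow> (real \<Rightarrow> real^2 \<Rightarrow> real) \<Rightarrow> real" where
  "M2_check \<Omega> \<T> J C k u0 u1 f =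
    (opnorm_J \<Omega> \<T> J)\<^sup>2 * (H2_seminorm \<Omega> u0)\<^sup>2
      * (1 + 1/4 * C\<^sup>2 * (opnorm_J \<Omega> \<T> J)\<^sup>2 * (H2_seminorm \<Omega> u0)\<^sup>2)
    + 4 * (l2_norm \<Omega> u1)\<^sup>2 + k\<^sup>2 * (C_L2_norm \<Omega> k f)\<^sup>2"

definition M2 ::
  "(real^2) set \<Rightarrow> (real^2) set set \<Rightarrow> ((real^2 \<Rightarrow> real) \<Rightarrow> real^2 \<Rightarrow> real) \<Rightarrow> real \<Rightarrow> real \<Rightarrow>
   (real^2 \<Rightarrow> real) \<Rightarrow> (real^2 \<Rightarrow> real) \<Rightarrow> (real \<Rightarrow> real^2 \<Rightarrow> real) \<Rightarrow> real" where
  "M2 \<Omega> \<T> J C k u0 u1 f =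
    C\<^sup>2 * ((opnorm_J \<Omega> \<T> J)\<^sup>2 * (H2_seminorm \<Omega> u0)\<^sup>2 + M2_check \<Omega> \<T> J C k u0 u1 f)"

end

theory Submission
  imports "HOL-Homology.Homology" "HOL-Computational_Algebra.Polynomial" Defs
begin

text \<open>On the Morley space the piecewise Hessian is piecewise constant, so \<open>a_pw\<close> has finite rank, and by
  the discrete Sobolev inequality its null space consists of null functions; (I0) is therefore two
  applications of the Riesz representation. Testing (I1) with \<open>u\<^sup>1 - u\<^sup>0\<close> and the second equation,
  at both time levels, with \<open>v\<^sup>1 + v\<^sup>0\<close> turns the trilinear term into the increment of \<open>\<bar>v\<bar>\<^sup>2/2\<close>; this gives
  the a priori bound, and also shows that the finite-dimensional map defining (I1) points outwards on
  a large sphere, so that it has a zero by Brouwer's theorem. For two solutions with differences \<open>E\<close> of the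
  \<open>u\<close> and \<open>D\<close> of the \<open>v\<close>, testing with \<open>E\<close> bounds \<open>2 \<bar>E\<bar>\<^sup>2 + \<bar>D\<bar>\<^sup>2\<close> by trilinear terms that are absorbed
  if \<open>M2 \<le> 1\<close>. Bilinearity of the forms rests on the uniqueness of weak derivatives almost everywhere,
  i.e. on the fundamental lemma of the calculus of variations.\<close>

section \<open>Zeros of coercive maps\<close>

text \<open>A member of \<open>morley\<close> is a function on the plane whose values off the
  interiors of the triangles are arbitrary, so the space has infinite dimension and
  \<open>a_pw\<close> is only semidefinite on it. No quotient is formed. Finite dimension is
  replaced by a bound on the length of orthonormal families, continuity of a functional by its
  vanishing on functions of norm zero, and uniqueness by equality almost everywhere. The second
  obstacle is that weak derivatives are chosen representatives: \<open>D2pw\<close> is linear and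
  symmetric only up to null sets, so the algebra of the forms holds after integration and not
  pointwise. The discrete trilinear form is symmetric only in its first two arguments, and the
  scheme is arranged so that this suffices. In the uniqueness proof the term \<bar>D\<bar>^2 comes
  out of the nonlinearity itself, through the difference of the two equations for \<open>v\<close>;
  it absorbs all terms in \<open>D\<close>, and what is left has to be beaten by 2
  \<bar>E\<bar>^2.\<close>

lemma continuous_map_normalise_nsphere:
  assumes cont: "\<And>i. i \<le> m \<Longrightarrow> continuous_map X euclideanreal (\<lambda>z. g z i)"
    and nz: "\<And>z. z \<in> topspace X \<Longrightarrow> (\<Sum>i\<le>m. (g z i)\<^sup>2) \<noteq> (0::real)"
  shows "continuous_map X (nsphere m)
    (\<lambda>z i. if i \<le> m then g z i / sqrt (\<Sum>j\<le>m. (g z j)\<^sup>2) else 0)"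
proof -
  have "continuous_map X (powertop_real UNIV)
      (\<lambda>z i. if i \<le> m then g z i / sqrt (\<Sum>j\<le>m. (g z j)\<^sup>2) else 0)"
    unfolding continuous_map_componentwise_UNIV
  proof
    fix i
    show "continuous_map X euclideanreal
        (\<lambda>z. if i \<le> m then g z i / sqrt (\<Sum>j\<le>m. (g z j)\<^sup>2) else 0)"
      using nz by (cases "i \<le> m") (auto intro!: continuous_intros cont simp: cont)
  qed
  moreover have "(\<Sum>i\<le>m. (g z i / sqrt (\<Sum>j\<le>m. (g z j)\<^sup>2))\<^sup>2) = 1"
    if "z \<in> topspace X" for z
    using nz[OF that] by (simp add: power_divide sum_nonneg flip: sum_divide_distrib)
  ultimately show ?thesis
    by (auto simp: nsphere continuous_map_in_subtopology)
qed

text \<open>Otherwise \<open>F\<close>, normalised, would be homotopic to the identity of the sphere along straight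
  lines and to a constant along radii, but spheres are not contractible.\<close>

theorem coercive_map_has_zero:
  fixes F :: "(nat \<Rightarrow> real) \<Rightarrow> nat \<Rightarrow> real"
  assumes cont: "\<And>i. i < n \<Longrightarrow> continuous_map (powertop_real UNIV) euclideanreal (\<lambda>x. F x i)"
    and "R > 0"
    and coercive: "\<And>x. \<lbrakk>\<forall>i\<ge>n. x i = 0; (\<Sum>i<n. (x i)\<^sup>2) = R\<^sup>2\<rbrakk> \<Longrightarrow> (\<Sum>i<n. F x i * x i) \<ge> 0"
  shows "\<exists>x. (\<forall>i\<ge>n. x i = 0) \<and> (\<forall>i<n. F x i = 0)"
proof (cases n)
  case 0
  then show ?thesis by auto
next
  case (Suc m)
  show ?thesis
  proof (rule ccontr)
    assume neg: "\<not> ?thesis"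
    \<comment> \<open>All points of the closed ball are covered, not only the sphere; the second
      homotopy passes through its interior.\<close>
    then have nz: "(\<Sum>i\<le>m. (F x i)\<^sup>2) \<noteq> 0" if "\<forall>i>m. x i = 0" for x
    proof -
      from neg that obtain i where "i < n" "F x i \<noteq> 0"
        by (metis Suc Suc_le_eq)
      then show ?thesis
        using Suc by (auto simp: sum_nonneg_eq_0_iff less_Suc_eq_le)
    qed
    let ?I = "top_of_set {0..1::real}" and ?S = "nsphere m"
    let ?norm = "\<lambda>y i. if i \<le> m then y i / sqrt (\<Sum>j\<le>m. (y j)\<^sup>2) else (0::real)"
    have S: "topspace ?S = {x. (\<Sum>i\<le>m. (x i)\<^sup>2) = 1 \<and> (\<forall>i>m. x i = 0)}"
      by (simp add: nsphere)
    have cF: "continuous_map X euclideanreal (\<lambda>z. F (g z) i)"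
      if "\<And>j. continuous_map X euclideanreal (\<lambda>z. g z j)" "i \<le> m" for X :: "(real \<times> (nat \<Rightarrow> real)) topology" and g i
      using continuous_map_compose[of X "powertop_real UNIV" g euclideanreal "\<lambda>x. F x i"] that cont Suc
      by (auto simp: continuous_map_componentwise_UNIV o_def)
    have cfst: "continuous_map (prod_topology ?I ?S) euclideanreal fst"
      using continuous_map_fst continuous_map_into_fulltopology by blast
    have csnd: "continuous_map (prod_topology ?I ?S) euclideanreal (\<lambda>z. snd z i)" for i
    proof -
      have "continuous_map ?S euclideanreal (\<lambda>x. x i)"
        unfolding nsphere by (intro continuous_map_from_subtopology continuous_map_product_projection) auto
      from continuous_map_compose[OF continuous_map_snd this] show ?thesis by (simp add: o_def)
    qed
    have 1: "homotopic_with (\<lambda>x. True) ?S ?S id (\<lambda>x. ?norm (F (\<lambda>i. R * x i)))"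
    proof -
      \<comment> \<open>The segment from x to F(R x) avoids the origin: pairing a zero of it with x
        gives 0 = (1 - t) + t <F(R x), x>, where coercivity makes the second term nonnegative. Hence
        t = 1, which \<open>nz\<close> excludes.\<close>
      let ?g = "\<lambda>z i. (1 - fst z) * snd z i + fst z * F (\<lambda>i. R * snd z i) i"
      have "continuous_map (prod_topology ?I ?S) ?S (\<lambda>z. ?norm (?g z))"
      proof (rule continuous_map_normalise_nsphere)
        show "continuous_map (prod_topology ?I ?S) euclideanreal (\<lambda>z. ?g z i)" if "i \<le> m" for i
          by (intro continuous_intros cfst csnd cF that)
      next
        fix z assume "z \<in> topspace (prod_topology ?I ?S)"
        then obtain t x where z: "z = (t, x)" and t: "0 \<le> t" "t \<le> 1" and x: "(\<Sum>i\<le>m. (x i)\<^sup>2) = 1" "\<forall>i>m. x i = 0"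
          by (auto simp: S)
        show "(\<Sum>i\<le>m. (?g z i)\<^sup>2) \<noteq> 0"
        proof
          assume "(\<Sum>i\<le>m. (?g z i)\<^sup>2) = 0"
          then have 0: "(1 - t) * x i + t * F (\<lambda>i. R * x i) i = 0" if "i \<le> m" for i
            using that by (simp add: sum_nonneg_eq_0_iff z)
          have "0 = (\<Sum>i\<le>m. ((1 - t) * x i + t * F (\<lambda>i. R * x i) i) * x i)"
            using 0 by simp
          also have "\<dots> = (1 - t) * (\<Sum>i\<le>m. (x i)\<^sup>2) + t * (\<Sum>i\<le>m. F (\<lambda>i. R * x i) i * x i)"
            by (simp add: algebra_simps power2_eq_square sum.distrib sum_subtractf sum_distrib_left)
          finally have eq: "0 = (1 - t) + t * (\<Sum>i\<le>m. F (\<lambda>i. R * x i) i * x i)"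
            by (simp add: x)
          have "(\<Sum>i<n. (R * x i)\<^sup>2) = R\<^sup>2"
            using x by (simp add: power_mult_distrib Suc lessThan_Suc_atMost flip: sum_distrib_left)
          then have "0 \<le> (\<Sum>i\<le>m. F (\<lambda>i. R * x i) i * (R * x i))"
            using coercive[of "\<lambda>i. R * x i"] x Suc by (simp add: lessThan_Suc_atMost Suc_le_eq)
          also have "\<dots> = R * (\<Sum>i\<le>m. F (\<lambda>i. R * x i) i * x i)"
            by (simp add: sum_distrib_left algebra_simps)
          finally have nonneg: "0 \<le> (\<Sum>i\<le>m. F (\<lambda>i. R * x i) i * x i)"
            using \<open>R > 0\<close> by (simp add: zero_le_mult_iff)
          with eq t mult_nonneg_nonneg[OF t(1) nonneg] have "t = 1"
            by linarith
          with 0 nz[of "\<lambda>i. R * x i"] x show False by simp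
        qed
      qed
      then show ?thesis
        unfolding homotopic_with[OF refl]
        by (intro exI[of _ "\<lambda>z. ?norm (?g z)"]) (auto simp: S fun_eq_iff)
    qed
    have 2: "homotopic_with (\<lambda>x. True) ?S ?S (\<lambda>x. ?norm (F (\<lambda>i. R * x i))) (\<lambda>x. ?norm (F (\<lambda>i. 0)))"
    proof -
      \<comment> \<open>Shrinking the radius from \<open>R\<close> to 0 stays in the ball, where
        \<open>F\<close> has no zero, and ends in a constant map.\<close>
      let ?g = "\<lambda>z i. F (\<lambda>i. R * ((1 - fst z) * snd z i)) i"
      have "continuous_map (prod_topology ?I ?S) ?S (\<lambda>z. ?norm (?g z))"
      proof (rule continuous_map_normalise_nsphere)
        show "continuous_map (prod_topology ?I ?S) euclideanreal (\<lambda>z. ?g z i)" if "i \<le> m" for i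
          by (intro cF that continuous_intros cfst csnd)
      next
        show "(\<Sum>i\<le>m. (?g z i)\<^sup>2) \<noteq> 0" if "z \<in> topspace (prod_topology ?I ?S)" for z
          using nz that by (auto simp: S)
      qed
      then show ?thesis
        unfolding homotopic_with[OF refl]
        by (intro exI[of _ "\<lambda>z. ?norm (?g z)"]) auto
    qed
    from homotopic_with_trans[OF 1 2] have "contractible_space ?S"
      by (auto simp: contractible_space_def)
    then show False using non_contractible_space_nsphere by blast
  qed
qed

section \<open>Semi-inner product spaces of functions\<close>

definition linear_on :: "('x \<Rightarrow> real) set \<Rightarrow> (('x \<Rightarrow> real) \<Rightarrow> real) \<Rightarrow> bool" where
  "linear_on V L \<longleftrightarrow> (\<forall>\<phi>\<in>V. \<forall>\<psi>\<in>V. \<forall>\<alpha> \<beta>. L (\<lambda>x. \<alpha> * \<phi> x + \<beta> * \<psi> x) = \<alpha> * L \<phi> + \<beta> * L \<psi>)"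

locale function_space =
  fixes V :: "('x \<Rightarrow> real) set"
  assumes zero_mem: "(\<lambda>x. 0) \<in> V"
    and lin_mem: "\<And>\<phi> \<psi> \<alpha> \<beta>. \<lbrakk>\<phi> \<in> V; \<psi> \<in> V\<rbrakk> \<Longrightarrow> (\<lambda>x. \<alpha> * \<phi> x + \<beta> * \<psi> x) \<in> V"
begin

lemma mem [simp]:
  assumes "\<phi> \<in> V"
  shows "(\<lambda>x. c * \<phi> x) \<in> V" "(\<lambda>x. \<phi> x / c) \<in> V"
    and "\<psi> \<in> V \<Longrightarrow> (\<lambda>x. \<phi> x + \<psi> x) \<in> V" "\<psi> \<in> V \<Longrightarrow> (\<lambda>x. \<phi> x - \<psi> x) \<in> V"
  using lin_mem[OF assms assms, of c 0] lin_mem[OF assms assms, of "1 / c" 0]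
    lin_mem[OF assms, of \<psi> 1 1] lin_mem[OF assms, of \<psi> 1 "-1"] by simp_all

lemma linear_onD:
  assumes "linear_on V L" "\<phi> \<in> V"
  shows "L (\<lambda>x. c * \<phi> x) = c * L \<phi>" "L (\<lambda>x. \<phi> x / c) = L \<phi> / c"
    and "\<psi> \<in> V \<Longrightarrow> L (\<lambda>x. \<phi> x + \<psi> x) = L \<phi> + L \<psi>"
    and "\<psi> \<in> V \<Longrightarrow> L (\<lambda>x. \<phi> x - \<psi> x) = L \<phi> - L \<psi>"
proof -
  have lin: "L (\<lambda>x. \<alpha> * \<phi> x + \<beta> * \<psi> x) = \<alpha> * L \<phi> + \<beta> * L \<psi>" if "\<psi> \<in> V" for \<psi> \<alpha> \<beta>
    using assms that by (simp add: linear_on_def)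
  show "L (\<lambda>x. c * \<phi> x) = c * L \<phi>" "L (\<lambda>x. \<phi> x / c) = L \<phi> / c"
    using lin[of \<phi> c 0] lin[of \<phi> "1 / c" 0] assms by simp_all
  show "L (\<lambda>x. \<phi> x + \<psi> x) = L \<phi> + L \<psi>" "L (\<lambda>x. \<phi> x - \<psi> x) = L \<phi> - L \<psi>" if "\<psi> \<in> V"
    using lin[of \<psi> 1 1] lin[of \<psi> 1 "-1"] that by simp_all
qed

lemma linear_on_zero:
  assumes "linear_on V L" shows "L (\<lambda>x. 0) = 0"
  using linear_onD(1)[OF assms zero_mem, of 0] by simp

section \<open>Finite linear combinations and functionals on them\<close>

definition comb :: "nat \<Rightarrow> (nat \<Rightarrow> 'x \<Rightarrow> real) \<Rightarrow> (nat \<Rightarrow> real) \<Rightarrow> 'x \<Rightarrow> real" where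
  "comb n e c = (\<lambda>x. \<Sum>i<n. c i * e i x)"

lemma comb_mem:
  assumes "\<And>i. i < n \<Longrightarrow> e i \<in> V" shows "comb n e c \<in> V"
  using assms unfolding comb_def
  by (induction n) (simp_all add: zero_mem)

lemma linear_on_comb:
  assumes "linear_on V L" "\<And>i. i < n \<Longrightarrow> e i \<in> V"
  shows "L (comb n e c) = (\<Sum>i<n. c i * L (e i))"
  using assms(2)
proof (induction n)
  case 0
  then show ?case by (simp add: comb_def linear_on_zero[OF assms(1)])
next
  case (Suc n)
  then have "comb n e c \<in> V" "e n \<in> V" by (simp_all add: comb_mem)
  moreover have "comb (Suc n) e c = (\<lambda>x. comb n e c x + c n * e n x)"
    by (simp add: comb_def)
  ultimately show ?case
    using Suc by (simp add: linear_onD[OF assms(1)])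
qed

text \<open>The functional \<open>L c\<close> may itself depend on the coefficients, so the lemma
  can be applied to one argument of a multilinear form after another. Continuity of a form is
  thereby reduced to that of its values at finitely many functions.\<close>

lemma continuous_map_linear_on_comb:
  assumes L: "\<And>c. linear_on V (L c)" and e: "\<And>i. i < n \<Longrightarrow> e i \<in> V" and "p \<in> V"
    and "\<And>i. i < n \<Longrightarrow> continuous_map X euclideanreal (\<lambda>c. \<gamma> c i)"
    and "continuous_map X euclideanreal (\<lambda>c. L c p)"
    and "\<And>i. i < n \<Longrightarrow> continuous_map X euclideanreal (\<lambda>c. L c (e i))"
  shows "continuous_map X euclideanreal (\<lambda>c. L c (\<lambda>x. p x + comb n e (\<gamma> c) x))"
proof -
  have "(\<lambda>c. L c (\<lambda>x. p x + comb n e (\<gamma> c) x)) = (\<lambda>c. L c p + (\<Sum>i<n. \<gamma> c i * L c (e i)))"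
    using comb_mem[OF e] \<open>p \<in> V\<close> by (simp add: linear_onD[OF L] linear_on_comb[OF L e])
  then show ?thesis
    using assms(4-) by (auto intro!: continuous_intros)
qed

end

text \<open>Semidefinite only: Morley functions that differ off the interiors of the triangles have
  the same energy.\<close>

locale semi_inner_space = function_space V for V :: "('x \<Rightarrow> real) set" +
  fixes a :: "('x \<Rightarrow> real) \<Rightarrow> ('x \<Rightarrow> real) \<Rightarrow> real"
  assumes lin_left: "\<And>\<xi>. \<xi> \<in> V \<Longrightarrow> linear_on V (\<lambda>\<phi>. a \<phi> \<xi>)"
    and sym: "\<And>\<phi> \<psi>. \<lbrakk>\<phi> \<in> V; \<psi> \<in> V\<rbrakk> \<Longrightarrow> a \<phi> \<psi> = a \<psi> \<phi>"
    and nonneg: "\<And>\<phi>. \<phi> \<in> V \<Longrightarrow> 0 \<le> a \<phi> \<phi>"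
begin

lemma lin_right: "\<xi> \<in> V \<Longrightarrow> linear_on V (a \<xi>)"
  using lin_left[of \<xi>] by (simp add: linear_on_def sym lin_mem)

lemmas left_simps = linear_onD[OF lin_left]
lemmas right_simps = linear_onD[OF lin_right]

definition nrm :: "('x \<Rightarrow> real) \<Rightarrow> real" where
  "nrm \<phi> = sqrt (a \<phi> \<phi>)"

lemma nrm_nonneg [simp]: "\<phi> \<in> V \<Longrightarrow> 0 \<le> nrm \<phi>"
  by (simp add: nrm_def nonneg)

lemma nrm_power2: "\<phi> \<in> V \<Longrightarrow> (nrm \<phi>)\<^sup>2 = a \<phi> \<phi>"
  by (simp add: nrm_def nonneg)

text \<open>Expanding the form at \<open>a q q * p - a p q * q\<close> yields the inequality
  multiplied by \<open>a q q\<close>, so one diagonal value must be positive for the division. If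
  both are zero, the sum and the difference of the two functions force the mixed value to
  vanish.\<close>

lemma Cauchy_Schwarz2:
  assumes \<phi>: "\<phi> \<in> V" and \<psi>: "\<psi> \<in> V"
  shows "(a \<phi> \<psi>)\<^sup>2 \<le> a \<phi> \<phi> * a \<psi> \<psi>"
proof -
  have *: "0 \<le> a q q * (a q q * a p p - (a p q)\<^sup>2)" if "p \<in> V" "q \<in> V" for p q
  proof -
    have "0 \<le> a (\<lambda>x. a q q * p x - a p q * q x) (\<lambda>x. a q q * p x - a p q * q x)"
      using that by (intro nonneg) simp
    also have "\<dots> = a q q * (a q q * a p p - (a p q)\<^sup>2)"
      using that sym[of p q]
      by (simp add: left_simps right_simps) (simp add: algebra_simps power2_eq_square)
    finally show ?thesis .
  qed
  consider "a \<psi> \<psi> > 0" | "a \<phi> \<phi> > 0" | "a \<phi> \<phi> = 0" "a \<psi> \<psi> = 0"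
    using nonneg[OF \<phi>] nonneg[OF \<psi>] by force
  then show ?thesis
  proof cases
    case 1
    with *[OF \<phi> \<psi>] show ?thesis by (simp add: zero_le_mult_iff mult.commute)
  next
    case 2
    with *[OF \<psi> \<phi>] sym[OF \<phi> \<psi>] show ?thesis by (simp add: zero_le_mult_iff mult.commute)
  next
    case 3
    have "0 \<le> a (\<lambda>x. \<phi> x + \<psi> x) (\<lambda>x. \<phi> x + \<psi> x)" "0 \<le> a (\<lambda>x. \<phi> x - \<psi> x) (\<lambda>x. \<phi> x - \<psi> x)"
      using \<phi> \<psi> by (auto intro!: nonneg)
    with 3 sym[OF \<phi> \<psi>] show ?thesis
      using \<phi> \<psi> by (simp add: left_simps right_simps)
  qed
qed

lemma Cauchy_Schwarz:
  assumes "\<phi> \<in> V" "\<psi> \<in> V" shows "\<bar>a \<phi> \<psi>\<bar> \<le> nrm \<phi> * nrm \<psi>"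
  using Cauchy_Schwarz2[OF assms] unfolding nrm_def
  by (metis real_sqrt_abs real_sqrt_le_iff real_sqrt_mult)

lemma null_right: "\<lbrakk>\<phi> \<in> V; \<psi> \<in> V; nrm \<psi> = 0\<rbrakk> \<Longrightarrow> a \<phi> \<psi> = 0"
  using Cauchy_Schwarz[of \<phi> \<psi>] by auto

lemma nrm_scale: "\<phi> \<in> V \<Longrightarrow> nrm (\<lambda>x. c * \<phi> x) = \<bar>c\<bar> * nrm \<phi>"
  by (simp add: nrm_def left_simps right_simps real_sqrt_mult flip: mult.assoc)

lemma nrm_triangle:
  assumes "\<phi> \<in> V" "\<psi> \<in> V" shows "nrm (\<lambda>x. \<phi> x + \<psi> x) \<le> nrm \<phi> + nrm \<psi>"
proof (rule power2_le_imp_le)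
  have "(nrm (\<lambda>x. \<phi> x + \<psi> x))\<^sup>2 = (nrm \<phi>)\<^sup>2 + (nrm \<psi>)\<^sup>2 + 2 * a \<phi> \<psi>"
    using assms sym[of \<phi> \<psi>] by (simp add: nrm_power2 left_simps right_simps)
  also have "\<dots> \<le> (nrm \<phi> + nrm \<psi>)\<^sup>2"
    using Cauchy_Schwarz[OF assms] by (simp add: power2_sum)
  finally show "(nrm (\<lambda>x. \<phi> x + \<psi> x))\<^sup>2 \<le> (nrm \<phi> + nrm \<psi>)\<^sup>2" .
qed (use assms in simp)

lemma nrm_diff_ge:
  assumes "\<phi> \<in> V" "\<psi> \<in> V" shows "nrm \<phi> - nrm \<psi> \<le> nrm (\<lambda>x. \<phi> x - \<psi> x)"
  using nrm_triangle[of "\<lambda>x. \<phi> x - \<psi> x" \<psi>] assms by simp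

section \<open>Orthonormal families\<close>

definition orthonormal :: "nat \<Rightarrow> (nat \<Rightarrow> 'x \<Rightarrow> real) \<Rightarrow> bool" where
  "orthonormal n e \<longleftrightarrow> (\<forall>i<n. e i \<in> V) \<and> (\<forall>i<n. \<forall>j<n. a (e i) (e j) = (if i = j then 1 else 0))"

lemma a_comb_left:
  assumes "orthonormal n e" "\<psi> \<in> V" shows "a (comb n e c) \<psi> = (\<Sum>i<n. c i * a (e i) \<psi>)"
  using assms linear_on_comb[OF lin_left] by (simp add: orthonormal_def)

lemma a_comb_basis:
  assumes "orthonormal n e" "j < n" shows "a (comb n e c) (e j) = c j"
proof -
  have "a (comb n e c) (e j) = (\<Sum>i<n. c i * (if i = j then 1 else 0))"
    using assms by (subst a_comb_left) (auto simp: orthonormal_def)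
  then show ?thesis using assms by (simp add: if_distrib cong: if_cong)
qed

lemma a_comb_comb:
  assumes "orthonormal n e" shows "a (comb n e c) (comb n e c) = (\<Sum>i<n. (c i)\<^sup>2)"
proof -
  have "comb n e c \<in> V" using assms by (auto simp: orthonormal_def intro: comb_mem)
  moreover from this have "a (e i) (comb n e c) = c i" if "i < n" for i
    using a_comb_basis[OF assms that] sym[of "e i" "comb n e c"] that assms by (simp add: orthonormal_def)
  ultimately show ?thesis
    using assms by (simp add: a_comb_left power2_eq_square)
qed

text \<open>The functional is evaluated at its own candidate representer, the combination with
  coefficients \<open>L (e i)\<close>: there both \<open>L\<close> and the form take the value s,
  the sum in question, so s^2 \<le> s. No completeness of the family enters, which is why this can
  be used to bound its length.\<close>

lemma Bessel_functional:
  assumes "orthonormal n e" and L: "linear_on V L" and bd: "\<And>\<phi>. \<phi> \<in> V \<Longrightarrow> (L \<phi>)\<^sup>2 \<le> a \<phi> \<phi>"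
  shows "(\<Sum>i<n. (L (e i))\<^sup>2) \<le> 1"
proof -
  let ?s = "\<Sum>i<n. (L (e i))\<^sup>2" and ?p = "comb n e (\<lambda>i. L (e i))"
  have e: "\<And>i. i < n \<Longrightarrow> e i \<in> V" using assms by (simp add: orthonormal_def)
  have "L ?p = ?s"
    using linear_on_comb[OF L e, of n] by (simp add: power2_eq_square)
  moreover have "(L ?p)\<^sup>2 \<le> a ?p ?p" by (rule bd) (simp add: comb_mem e)
  ultimately have "?s * ?s \<le> ?s * 1" by (simp add: a_comb_comb[OF assms(1)] power2_eq_square)
  moreover have "0 \<le> ?s" by (simp add: sum_nonneg)
  moreover have "s \<le> 1" if "s * s \<le> s * 1" "0 \<le> s" for s :: real
    using that by (cases "s = 0") (simp_all add: mult_le_cancel_left)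
  ultimately show ?thesis by blast
qed

end

text \<open>Stands for finite dimension modulo functions of norm zero, a property that can be stated
  without forming the quotient.\<close>

locale finite_rank_space = semi_inner_space +
  assumes finite_rank: "\<exists>D. \<forall>n e. orthonormal n e \<longrightarrow> n \<le> D"
begin

text \<open>A family of maximal length spans up to null functions: a residual of nonzero norm is
  orthogonal to the family, so normalised it could be appended.\<close>

lemma orthonormal_basis_exists:
  obtains n e where "orthonormal n e"
    "\<And>\<phi>. \<phi> \<in> V \<Longrightarrow> nrm (\<lambda>x. \<phi> x - comb n e (\<lambda>i. a \<phi> (e i)) x) = 0"
proof -
  obtain D where D: "\<And>n e. orthonormal n e \<Longrightarrow> n \<le> D" using finite_rank by auto
  have "orthonormal 0 e" for e by (simp add: orthonormal_def)
  then have "\<exists>n. (\<exists>e. orthonormal n e) \<and> (\<forall>n'. (\<exists>e. orthonormal n' e) \<longrightarrow> n' \<le> n)"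
    using D by (intro ex_has_greatest_nat[where k = 0 and b = "Suc D"]) (auto simp: less_Suc_eq_le)
  then obtain n where n: "\<exists>e. orthonormal n e" and max: "\<And>n' e. orthonormal n' e \<Longrightarrow> n' \<le> n"
    by blast
  then obtain e where e: "orthonormal n e" by blast
  have "nrm (\<lambda>x. \<phi> x - comb n e (\<lambda>i. a \<phi> (e i)) x) = 0" if \<phi>: "\<phi> \<in> V" for \<phi>
  proof (rule ccontr)
    define r where "r = (\<lambda>x. \<phi> x - comb n e (\<lambda>i. a \<phi> (e i)) x)"
    assume "nrm (\<lambda>x. \<phi> x - comb n e (\<lambda>i. a \<phi> (e i)) x) \<noteq> 0"
    then have nz: "nrm r \<noteq> 0" by (simp add: r_def)
    have eV: "\<And>i. i < n \<Longrightarrow> e i \<in> V" using e by (simp add: orthonormal_def)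
    have c: "comb n e (\<lambda>i. a \<phi> (e i)) \<in> V" by (simp add: comb_mem eV)
    then have r: "r \<in> V" using \<phi> by (simp add: r_def)
    have orth: "a r (e i) = 0" if "i < n" for i
      using \<phi> c eV[OF that] a_comb_basis[OF e that] by (simp add: r_def left_simps)
    let ?f = "\<lambda>x. r x / nrm r"
    have f: "?f \<in> V" by (rule mem(2)[OF r])
    have "a ?f ?f = a r r / (nrm r)\<^sup>2"
      using linear_onD(2)[OF lin_left r, of ?f] linear_onD(2)[OF lin_right r, of r] r f
      by (simp add: power2_eq_square)
    then have ff: "a ?f ?f = 1"
      using nz by (simp add: nrm_power2[OF r, symmetric])
    have fe: "a ?f (e i) = 0" "a (e i) ?f = 0" if "i < n" for i
      using linear_onD(2)[OF lin_left r, of "e i"] orth eV f sym[of ?f "e i"] that by simp_all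
    have "orthonormal (Suc n) (e(n := ?f))"
      using e ff fe f eV unfolding orthonormal_def by (auto simp: less_Suc_eq)
    from max[OF this] show False by simp
  qed
  with e that show thesis by blast
qed

text \<open>The expansion of \<psi> is off by a null function, which \<open>L\<close> does not see.
  Besides the Riesz representation this serves to conclude that a functional vanishing on the family
  vanishes on all of \<open>V\<close>.\<close>

lemma Riesz_comb:
  assumes e: "orthonormal n e"
    and res: "\<And>\<phi>. \<phi> \<in> V \<Longrightarrow> nrm (\<lambda>x. \<phi> x - comb n e (\<lambda>i. a \<phi> (e i)) x) = 0"
    and L: "linear_on V L" and null: "\<And>\<phi>. \<lbrakk>\<phi> \<in> V; nrm \<phi> = 0\<rbrakk> \<Longrightarrow> L \<phi> = 0" and \<psi>: "\<psi> \<in> V"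
  shows "L \<psi> = (\<Sum>i<n. a \<psi> (e i) * L (e i))"
proof -
  have eV: "\<And>i. i < n \<Longrightarrow> e i \<in> V" using e by (simp add: orthonormal_def)
  let ?c = "comb n e (\<lambda>i. a \<psi> (e i))"
  have c: "?c \<in> V" by (simp add: comb_mem eV)
  have "L (\<lambda>x. \<psi> x - ?c x) = 0" using res[OF \<psi>] null c \<psi> by simp
  then have "L \<psi> = L ?c" using c \<psi> by (simp add: linear_onD[OF L])
  then show ?thesis by (simp add: linear_on_comb[OF L eV])
qed

text \<open>Vanishing on null functions takes the place of continuity: it says that the functional
  descends to the finite-dimensional quotient.\<close>

lemma Riesz:
  assumes L: "linear_on V L" and null: "\<And>\<phi>. \<lbrakk>\<phi> \<in> V; nrm \<phi> = 0\<rbrakk> \<Longrightarrow> L \<phi> = 0"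
  obtains v where "v \<in> V" "\<And>\<psi>. \<psi> \<in> V \<Longrightarrow> a v \<psi> = L \<psi>"
proof -
  obtain n e where e: "orthonormal n e"
    and res: "\<And>\<phi>. \<phi> \<in> V \<Longrightarrow> nrm (\<lambda>x. \<phi> x - comb n e (\<lambda>i. a \<phi> (e i)) x) = 0"
    using orthonormal_basis_exists by blast
  have eV: "\<And>i. i < n \<Longrightarrow> e i \<in> V" using e by (simp add: orthonormal_def)
  show thesis
  proof
    show "comb n e (\<lambda>i. L (e i)) \<in> V" by (simp add: comb_mem eV)
    show "a (comb n e (\<lambda>i. L (e i))) \<psi> = L \<psi>" if \<psi>: "\<psi> \<in> V" for \<psi>
    proof -
      have "a (comb n e (\<lambda>i. L (e i))) \<psi> = (\<Sum>i<n. L (e i) * a (e i) \<psi>)"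
        by (rule a_comb_left[OF e \<psi>])
      also have "\<dots> = (\<Sum>i<n. a \<psi> (e i) * L (e i))"
        by (intro sum.cong refl) (use sym[OF \<psi> eV] in \<open>simp add: mult.commute\<close>)
      also have "\<dots> = L \<psi>"
        by (rule Riesz_comb[symmetric]) (use e res L null \<psi> in auto)
      finally show ?thesis .
    qed
  qed
qed

end

text \<open>\<open>m\<close> is the mass form, to be instantiated by the inner product of L2;
  \<open>m_null\<close> ensures that loads bounded in its norm vanish on functions without energy.
  Symmetry of \<open>b\<close> is confined to the first two slots because piecewise integration by
  parts, which would exchange the third, leaves edge terms for nonconforming functions.\<close>

locale von_Karman_step = finite_rank_space V a for V :: "('x \<Rightarrow> real) set" and a +
  fixes b :: "('x \<Rightarrow> real) \<Rightarrow> ('x \<Rightarrow> real) \<Rightarrow> ('x \<Rightarrow> real) \<Rightarrow> real" and C :: real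
    and m :: "('x \<Rightarrow> real) \<Rightarrow> ('x \<Rightarrow> real) \<Rightarrow> real"
  assumes b_lin: "\<And>\<xi> \<psi>. \<lbrakk>\<xi> \<in> V; \<psi> \<in> V\<rbrakk> \<Longrightarrow> linear_on V (\<lambda>\<phi>. b \<phi> \<xi> \<psi>)"
    and b_sym: "\<And>\<phi> \<xi> \<psi>. \<lbrakk>\<phi> \<in> V; \<xi> \<in> V; \<psi> \<in> V\<rbrakk> \<Longrightarrow> b \<phi> \<xi> \<psi> = b \<xi> \<phi> \<psi>"
    and b_lin3: "\<And>\<phi> \<xi>. \<lbrakk>\<phi> \<in> V; \<xi> \<in> V\<rbrakk> \<Longrightarrow> linear_on V (b \<phi> \<xi>)"
    and b_bound: "\<And>\<phi> \<xi> \<psi>. \<lbrakk>\<phi> \<in> V; \<xi> \<in> V; \<psi> \<in> V\<rbrakk> \<Longrightarrow> \<bar>b \<phi> \<xi> \<psi>\<bar> \<le> C * nrm \<phi> * nrm \<xi> * nrm \<psi>"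
    and m_semi_inner: "semi_inner_space V m"
    and m_null: "\<And>\<phi>. \<lbrakk>\<phi> \<in> V; nrm \<phi> = 0\<rbrakk> \<Longrightarrow> m \<phi> \<phi> = 0"
begin

sublocale mass: semi_inner_space V m by (rule m_semi_inner)

lemma b_lin2: "\<lbrakk>\<phi> \<in> V; \<psi> \<in> V\<rbrakk> \<Longrightarrow> linear_on V (\<lambda>\<xi>. b \<phi> \<xi> \<psi>)"
  using b_lin[of \<phi> \<psi>] by (simp add: linear_on_def b_sym[of \<phi>] lin_mem)

lemmas b_simps = linear_onD[OF b_lin] linear_onD[OF b_lin2] linear_onD[OF b_lin3]

lemma b_null:
  assumes "\<phi> \<in> V" "\<xi> \<in> V" "\<psi> \<in> V" "nrm \<phi> = 0 \<or> nrm \<xi> = 0 \<or> nrm \<psi> = 0"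
  shows "b \<phi> \<xi> \<psi> = 0"
  using b_bound[OF assms(1-3)] assms(4) by auto

lemma quadratic_form_Riesz:
  assumes "u \<in> V" obtains v where "v \<in> V" "\<And>\<psi>. \<psi> \<in> V \<Longrightarrow> a v \<psi> = 1/2 * b u u \<psi>"
proof -
  have "linear_on V (\<lambda>\<psi>. 1/2 * b u u \<psi>)"
    using b_lin3[OF assms assms] by (simp add: linear_on_def algebra_simps)
  then obtain v where "v \<in> V" "\<And>\<psi>. \<psi> \<in> V \<Longrightarrow> a v \<psi> = 1/2 * b u u \<psi>"
    by (rule Riesz, use assms b_null in simp, blast)
  then show thesis by (rule that)
qed

lemma quadratic_form_bound:
  assumes "u \<in> V" "v \<in> V" "\<And>\<psi>. \<psi> \<in> V \<Longrightarrow> a v \<psi> = 1/2 * b u u \<psi>"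
  shows "nrm v \<le> 1/2 * C * (nrm u)\<^sup>2"
proof (cases "nrm v = 0")
  case True
  \<comment> \<open>The sign of \<open>C\<close> is read off from \<open>b_bound\<close> at
    \<open>u, u, u\<close>, which decides it only if \<open>nrm u\<close> is positive.\<close>
  have "0 \<le> C * (nrm u)\<^sup>2"
  proof (cases "nrm u = 0")
    case False
    then have "0 < nrm u" using nrm_nonneg[of u] assms(1) by linarith
    moreover have "0 \<le> C * nrm u * nrm u * nrm u" using b_bound[of u u u] assms by linarith
    ultimately have "0 \<le> C" by (auto simp: zero_le_mult_iff)
    then show ?thesis by simp
  qed simp
  with True show ?thesis by simp
next
  case False
  have "nrm v * nrm v = 1/2 * b u u v"
    using assms nrm_power2[of v] by (simp add: power2_eq_square)
  also have "\<dots> \<le> (1/2 * C * (nrm u)\<^sup>2) * nrm v"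
    using b_bound[of u u v] assms by (simp add: power2_eq_square)
  finally show ?thesis
    using False nrm_nonneg[OF assms(2)] by (simp add: mult_le_cancel_right)
qed

text \<open>By symmetry the difference of the two quadratic forms factors as \<open>b\<close> at the
  difference and the sum of \<open>u\<close> and \<open>u'\<close>, and the first factor is
  null.\<close>

lemma quadratic_form_unique:
  assumes u: "u \<in> V" "u' \<in> V" "nrm (\<lambda>x. u x - u' x) = 0"
    and v: "v \<in> V" "v' \<in> V"
    and eq: "\<And>\<psi>. \<psi> \<in> V \<Longrightarrow> a v \<psi> = 1/2 * b u u \<psi>" "\<And>\<psi>. \<psi> \<in> V \<Longrightarrow> a v' \<psi> = 1/2 * b u' u' \<psi>"
  shows "nrm (\<lambda>x. v x - v' x) = 0"
proof -
  define d where "d = (\<lambda>x. v x - v' x)"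
  have d: "d \<in> V" using v by (simp add: d_def)
  have "b (\<lambda>x. u x - u' x) (\<lambda>x. u x + u' x) d = b u u d - b u' u' d"
    using u d b_sym[of u u' d] by (simp add: b_simps)
  moreover have "b (\<lambda>x. u x - u' x) (\<lambda>x. u x + u' x) d = 0"
    using u d by (intro b_null) auto
  moreover have "a d d = a v d - a v' d"
    using linear_onD(4)[OF lin_left[OF d] v] by (simp add: d_def)
  ultimately have "a d d = 0" by (simp add: eq[OF d])
  then show ?thesis by (simp add: nrm_def d_def)
qed

end

section \<open>One step of a von Karman time discretisation\<close>

context von_Karman_step
begin

text \<open>\<open>g1\<close> is the pairing with the initial velocity and \<open>g\<close> that
  with the averaged load. Keeping them as functionals means that the data need not lie in
  \<open>V\<close>.\<close>

definition residual ::
  "real \<Rightarrow> (('x \<Rightarrow> real) \<Rightarrow> real) \<Rightarrow> (('x \<Rightarrow> real) \<Rightarrow> real) \<Rightarrow> ('x \<Rightarrow> real) \<Rightarrow> ('x \<Rightarrow> real) \<Rightarrow>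
   ('x \<Rightarrow> real) \<Rightarrow> ('x \<Rightarrow> real) \<Rightarrow> ('x \<Rightarrow> real) \<Rightarrow> real" where
  "residual k g1 g u0 v0 u v \<phi> =
    2 / k * (m (\<lambda>x. (u x - u0 x) / k) \<phi> - g1 \<phi>) + a (\<lambda>x. (u x + u0 x) / 2) \<phi>
    + b (\<lambda>x. (u x + u0 x) / 2) \<phi> (\<lambda>x. (v x + v0 x) / 2) - g \<phi>"

lemma residual_linear:
  assumes "linear_on V g1" "linear_on V g" "u0 \<in> V" "v0 \<in> V" "u \<in> V" "v \<in> V"
  shows "linear_on V (residual k g1 g u0 v0 u v)"
proof -
  define d s t where "d = (\<lambda>x. (u x - u0 x) / k)" and "s = (\<lambda>x. (u x + u0 x) / 2)"
    and "t = (\<lambda>x. (v x + v0 x) / 2)"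
  have "d \<in> V" "s \<in> V" "t \<in> V" using assms by (simp_all add: d_def s_def t_def)
  then have "linear_on V (m d)" "linear_on V (a s)" "linear_on V (\<lambda>\<phi>. b s \<phi> t)"
    by (simp_all add: mass.lin_right lin_right b_lin2)
  with assms(1,2) show ?thesis
    unfolding residual_def d_def[symmetric] s_def[symmetric] t_def[symmetric]
    by (simp add: linear_on_def algebra_simps add_divide_distrib diff_divide_distrib)
qed

text \<open>Tests the equation with \<open>u - u0\<close>: by polarisation of the quadratic form, the nonlinear term
  becomes half the increment of the squared norm of \<open>v\<close>.\<close>

lemma residual_energy:
  assumes "k > 0" and g1: "linear_on V g1" and g: "linear_on V g"
    and U: "\<And>\<phi>. \<phi> \<in> V \<Longrightarrow> \<bar>g1 \<phi>\<bar> \<le> U * mass.nrm \<phi>" and G: "\<And>\<phi>. \<phi> \<in> V \<Longrightarrow> \<bar>g \<phi>\<bar> \<le> G * mass.nrm \<phi>"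
    and mem: "u0 \<in> V" "v0 \<in> V" "u \<in> V" "v \<in> V"
    and v0: "\<And>\<psi>. \<psi> \<in> V \<Longrightarrow> a v0 \<psi> = 1/2 * b u0 u0 \<psi>"
    and v: "\<And>\<psi>. \<psi> \<in> V \<Longrightarrow> a v \<psi> = 1/2 * b u u \<psi>"
  shows "1/2 * (a u u + a v v) - 1/2 * (a u0 u0 + a v0 v0) - U\<^sup>2 - k\<^sup>2 * G\<^sup>2 / 4
    \<le> residual k g1 g u0 v0 u v (\<lambda>x. u x - u0 x)"
proof -
  define d t where "d = (\<lambda>x. (u x - u0 x) / k)" and "t = (\<lambda>x. (v x + v0 x) / 2)"
  have dt: "d \<in> V" "t \<in> V" using mem by (simp_all add: d_def t_def)
  \<comment> \<open>Writing the test function as \<open>k * d\<close> cancels the powers of 1/k in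
    front of the mass term and leaves \<open>2 * m d d\<close>.\<close>
  have w: "(\<lambda>x. u x - u0 x) = (\<lambda>x. k * d x)" using \<open>k > 0\<close> by (simp add: d_def)
  have "2 / k * (m d (\<lambda>x. u x - u0 x) - g1 (\<lambda>x. u x - u0 x)) = 2 * m d d - 2 * g1 d"
    "g (\<lambda>x. u x - u0 x) = k * g d"
    using dt \<open>k > 0\<close> unfolding w
    by (simp_all add: mass.right_simps linear_onD[OF g1] linear_onD[OF g] right_diff_distrib)
  moreover have "a (\<lambda>x. (u x + u0 x) / 2) (\<lambda>x. u x - u0 x) = 1/2 * (a u u - a u0 u0)"
    using mem sym[of u u0] by (simp add: left_simps right_simps)
  moreover have "b (\<lambda>x. (u x + u0 x) / 2) (\<lambda>x. u x - u0 x) t = 1/2 * (a v v - a v0 v0)"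
  proof -
    have "b (\<lambda>x. (u x + u0 x) / 2) (\<lambda>x. u x - u0 x) t = 1/2 * b u u t - 1/2 * b u0 u0 t"
      using mem dt b_sym[of u u0 t] by (simp add: b_simps)
    also have "\<dots> = a v t - a v0 t" by (simp add: v[OF dt(2)] v0[OF dt(2)])
    also have "\<dots> = 1/2 * (a v v - a v0 v0)"
      using mem sym[of v v0] by (simp add: t_def right_simps field_simps)
    finally show ?thesis .
  qed
  ultimately have "residual k g1 g u0 v0 u v (\<lambda>x. u x - u0 x)
      = 2 * m d d - 2 * g1 d - k * g d + 1/2 * (a u u + a v v) - 1/2 * (a u0 u0 + a v0 v0)"
    unfolding residual_def d_def[symmetric] t_def[symmetric] by argo
  moreover have "2 * m d d - 2 * g1 d - k * g d \<ge> - U\<^sup>2 - k\<^sup>2 * G\<^sup>2 / 4"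
  proof -
    let ?s = "mass.nrm d"
    have "g1 d \<le> U * ?s" "k * g d \<le> k * (G * ?s)"
      using U[OF dt(1)] G[OF dt(1)] \<open>k > 0\<close> by (auto intro: mult_left_mono)
    \<comment> \<open>The mass term provides two copies of ?s^2. One absorbs the velocity and the
      other the load, and completing the squares leaves exactly U^2 and k^2 G^2 / 4.\<close>
    moreover have "0 \<le> (?s - U)\<^sup>2" "0 \<le> (?s - k * G / 2)\<^sup>2" by simp_all
    ultimately show ?thesis
      using mass.nrm_power2[OF dt(1)] by (simp add: power2_eq_square algebra_simps)
  qed
  ultimately show ?thesis by linarith
qed

lemma step_bound:
  assumes "k > 0" "linear_on V g1" "linear_on V g"
    and "\<And>\<phi>. \<phi> \<in> V \<Longrightarrow> \<bar>g1 \<phi>\<bar> \<le> U * mass.nrm \<phi>" "\<And>\<phi>. \<phi> \<in> V \<Longrightarrow> \<bar>g \<phi>\<bar> \<le> G * mass.nrm \<phi>"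
    and mem: "u0 \<in> V" "v0 \<in> V" "u \<in> V" "v \<in> V"
    and "\<And>\<psi>. \<psi> \<in> V \<Longrightarrow> a v0 \<psi> = 1/2 * b u0 u0 \<psi>" "\<And>\<psi>. \<psi> \<in> V \<Longrightarrow> a v \<psi> = 1/2 * b u u \<psi>"
    and eq: "\<And>\<phi>. \<phi> \<in> V \<Longrightarrow> residual k g1 g u0 v0 u v \<phi> = 0"
  shows "(nrm u)\<^sup>2 + (nrm v)\<^sup>2 \<le> (nrm u0)\<^sup>2 + (nrm v0)\<^sup>2 + 2 * U\<^sup>2 + k\<^sup>2 * G\<^sup>2 / 2"
proof -
  have "residual k g1 g u0 v0 u v (\<lambda>x. u x - u0 x) = 0" using mem by (intro eq) simp
  moreover have "1/2 * (a u u + a v v) - 1/2 * (a u0 u0 + a v0 v0) - U\<^sup>2 - k\<^sup>2 * G\<^sup>2 / 4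
      \<le> residual k g1 g u0 v0 u v (\<lambda>x. u x - u0 x)"
    by (rule residual_energy) (use assms in auto)
  ultimately show ?thesis
    unfolding nrm_power2[OF mem(1)] nrm_power2[OF mem(2)] nrm_power2[OF mem(3)] nrm_power2[OF mem(4)]
    by argo
qed

text \<open>The second unknown is eliminated as the Riesz representative of the quadratic form, so
  the problem becomes a zero of a polynomial map in the coefficients of the increment. Coercivity of
  that map is the energy estimate.\<close>

lemma step_exists:
  assumes "k > 0" and g1: "linear_on V g1" and g: "linear_on V g"
    and U: "\<And>\<phi>. \<phi> \<in> V \<Longrightarrow> \<bar>g1 \<phi>\<bar> \<le> U * mass.nrm \<phi>" and G: "\<And>\<phi>. \<phi> \<in> V \<Longrightarrow> \<bar>g \<phi>\<bar> \<le> G * mass.nrm \<phi>"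
    and u0: "u0 \<in> V" and v0: "v0 \<in> V" and eq0: "\<And>\<psi>. \<psi> \<in> V \<Longrightarrow> a v0 \<psi> = 1/2 * b u0 u0 \<psi>"
  shows "\<exists>u\<in>V. \<exists>v\<in>V. (\<forall>\<psi>\<in>V. a v \<psi> = 1/2 * b u u \<psi>) \<and> (\<forall>\<phi>\<in>V. residual k g1 g u0 v0 u v \<phi> = 0)"
proof -
  obtain n e where e: "orthonormal n e"
    and res: "\<And>\<phi>. \<phi> \<in> V \<Longrightarrow> nrm (\<lambda>x. \<phi> x - comb n e (\<lambda>i. a \<phi> (e i)) x) = 0"
    using orthonormal_basis_exists by blast
  have eV: "\<And>i. i < n \<Longrightarrow> e i \<in> V" using e by (simp add: orthonormal_def)
  have cV: "comb n e c \<in> V" for c by (simp add: comb_mem eV)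
  \<comment> \<open>Expanding around \<open>u0\<close> makes \<open>c\<close> the coefficients of
    the increment. Pairing the residuals at the basis with \<open>c\<close> then amounts to testing
    with \<open>u - u0\<close>, as \<open>residual_energy\<close> requires.\<close>
  define u where "u c = (\<lambda>x. u0 x + comb n e c x)" for c
  define w where "w c = comb n e (\<lambda>i. 1/2 * b (u c) (u c) (e i))" for c
  have uV: "u c \<in> V" and wV: "w c \<in> V" for c
    unfolding u_def w_def using cV u0 by simp_all
  have w: "a (w c) \<psi> = 1/2 * b (u c) (u c) \<psi>" if \<psi>: "\<psi> \<in> V" for c \<psi>
  proof -
    have "a (w c) \<psi> = (\<Sum>i<n. a \<psi> (e i) * (1/2 * b (u c) (u c) (e i)))"
      unfolding w_def using sym[OF \<psi> eV] by (subst a_comb_left[OF e \<psi>]) (simp add: mult.commute)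
    also have "\<dots> = 1/2 * (\<Sum>i<n. a \<psi> (e i) * b (u c) (u c) (e i))"
      by (simp add: sum_distrib_left)
    also have "(\<Sum>i<n. a \<psi> (e i) * b (u c) (u c) (e i)) = b (u c) (u c) \<psi>"
      using Riesz_comb[OF e _ b_lin3[OF uV uV] _ \<psi>] res b_null uV by auto
    finally show ?thesis .
  qed
  let ?X = "powertop_real (UNIV :: nat set)"
  let ?F = "\<lambda>c j. residual k g1 g u0 v0 (u c) (w c) (e j)"
  have proj: "continuous_map ?X euclideanreal (\<lambda>c. c i)" for i
    by (rule continuous_map_product_projection) simp
  have cont: "continuous_map ?X euclideanreal (\<lambda>c. ?F c j)" if j: "j < n" for j
  proof -
    have d: "(\<lambda>x. (u c x - u0 x) / k) = (\<lambda>x. 0 + comb n e (\<lambda>i. c i / k) x)" for c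
      by (simp add: u_def comb_def sum_divide_distrib)
    have s: "(\<lambda>x. (u c x + u0 x) / 2) = (\<lambda>x. u0 x + comb n e (\<lambda>i. c i / 2) x)" for c
      by (simp add: u_def comb_def sum_divide_distrib add_divide_distrib)
    have t: "(\<lambda>x. (w c x + v0 x) / 2)
        = (\<lambda>x. v0 x / 2 + comb n e (\<lambda>i. 1/4 * b (u c) (u c) (e i)) x)" for c
      by (simp add: w_def comb_def sum_divide_distrib add_divide_distrib add.commute)
    have sV: "(\<lambda>x. u0 x + comb n e (\<lambda>i. c i / 2) x) \<in> V" for c
      using u0 cV by simp
    have bu: "continuous_map ?X euclideanreal (\<lambda>c. b (\<lambda>x. u0 x + comb n e (\<gamma> c) x) \<xi> \<psi>)"
      if "\<xi> \<in> V" "\<psi> \<in> V" "\<And>i. continuous_map ?X euclideanreal (\<lambda>c. \<gamma> c i)" for \<xi> \<psi> \<gamma>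
      using that u0 eV
      by (intro continuous_map_linear_on_comb[where L = "\<lambda>c \<phi>. b \<phi> \<xi> \<psi>"]) (auto intro!: b_lin)
    have buu: "continuous_map ?X euclideanreal (\<lambda>c. b (u c) (u c) \<psi>)" if \<psi>: "\<psi> \<in> V" for \<psi>
    proof -
      have "continuous_map ?X euclideanreal (\<lambda>c. b \<xi> (u c) \<psi>)" if "\<xi> \<in> V" for \<xi>
        using bu[OF that \<psi> proj] that \<psi> uV unfolding u_def by (simp add: b_sym[of \<xi>])
      then have "continuous_map ?X euclideanreal (\<lambda>c. b (\<lambda>x. u0 x + comb n e c x) (u c) \<psi>)"
        using u0 eV proj uV \<psi>
        by (intro continuous_map_linear_on_comb[where L = "\<lambda>c \<phi>. b \<phi> (u c) \<psi>"]) (auto intro!: b_lin)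
      then show ?thesis by (simp add: u_def)
    qed
    show ?thesis
      unfolding residual_def d s t
    proof (intro continuous_intros)
      show "continuous_map ?X euclideanreal (\<lambda>c. m (\<lambda>x. 0 + comb n e (\<lambda>i. c i / k) x) (e j))"
        using eV[OF j] zero_mem eV proj \<open>k > 0\<close>
        by (intro continuous_map_linear_on_comb[where L = "\<lambda>c \<phi>. m \<phi> (e j)"])
          (auto intro!: mass.lin_left continuous_intros)
      show "continuous_map ?X euclideanreal (\<lambda>c. a (\<lambda>x. u0 x + comb n e (\<lambda>i. c i / 2) x) (e j))"
        using eV[OF j] u0 eV proj
        by (intro continuous_map_linear_on_comb[where L = "\<lambda>c \<phi>. a \<phi> (e j)"])
          (auto intro!: lin_left continuous_intros)
      \<comment> \<open>The cubic term. The functional depends on \<open>c\<close> through the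
        average of \<open>u\<close>, while the coefficients of the average of \<open>w\<close> are
        themselves quadratic in \<open>c\<close>; their factor 1/4 is the 1/2 of the second
        equation, halved by averaging.\<close>
      show "continuous_map ?X euclideanreal (\<lambda>c. b (\<lambda>x. u0 x + comb n e (\<lambda>i. c i / 2) x) (e j)
          (\<lambda>x. v0 x / 2 + comb n e (\<lambda>i. 1/4 * b (u c) (u c) (e i)) x))"
        using sV eV[OF j] eV v0 buu proj
        by (intro continuous_map_linear_on_comb
            [where L = "\<lambda>c. b (\<lambda>x. u0 x + comb n e (\<lambda>i. c i / 2) x) (e j)"])
          (auto intro!: b_lin3 bu continuous_intros)
    qed auto
  qed
  \<comment> \<open>Everything that \<open>residual_energy\<close> subtracts from the energy of the
    new level.\<close>
  define K where "K = 1/2 * (a u0 u0 + a v0 v0) + U\<^sup>2 + k\<^sup>2 * G\<^sup>2 / 4"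
  have K: "0 \<le> K" using nonneg[OF u0] nonneg[OF v0] by (simp add: K_def)
  \<comment> \<open>If the increment has norm \<open>R\<close>, then \<open>u\<close> has norm at
    least \<open>sqrt (2 * K) + 1\<close>, so half its squared norm already exceeds
    \<open>K\<close>. The summand 1 keeps the radius positive when all data vanish.\<close>
  define R where "R = nrm u0 + sqrt (2 * K) + 1"
  have R: "R > 0" using K u0 by (simp add: R_def add_nonneg_pos)
  have "(\<Sum>i<n. ?F c i * c i) \<ge> 0" if "(\<Sum>i<n. (c i)\<^sup>2) = R\<^sup>2" for c
  proof -
    have L: "linear_on V (residual k g1 g u0 v0 (u c) (w c))"
      by (rule residual_linear) (use g1 g u0 v0 uV wV in auto)
    have uc: "(\<lambda>x. u c x - u0 x) = comb n e c" by (simp add: u_def)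
    have "nrm (comb n e c) = R"
      using R by (simp add: nrm_def a_comb_comb[OF e] that)
    then have "sqrt (2 * K) + 1 \<le> nrm (u c)"
      using nrm_triangle[of "u c" "\<lambda>x. -1 * u0 x"] uV[of c] u0 uc nrm_scale[of u0 "-1"] mem(1)[OF u0, of "-1"]
      by (simp add: R_def)
    then have "sqrt (2 * K) \<le> nrm (u c)" by simp
    then have "2 * K \<le> a (u c) (u c)"
      by (simp add: nrm_def)
    then have "K \<le> 1/2 * (a (u c) (u c) + a (w c) (w c))"
      using nonneg[OF wV[of c]] by simp
    also have "\<dots> \<le> residual k g1 g u0 v0 (u c) (w c) (comb n e c) + K"
    proof -
      have "1/2 * (a (u c) (u c) + a (w c) (w c)) - 1/2 * (a u0 u0 + a v0 v0) - U\<^sup>2 - k\<^sup>2 * G\<^sup>2 / 4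
          \<le> residual k g1 g u0 v0 (u c) (w c) (\<lambda>x. u c x - u0 x)"
        by (rule residual_energy) (use \<open>k > 0\<close> g1 g U G u0 v0 uV wV eq0 w in auto)
      then show ?thesis unfolding K_def uc by argo
    qed
    also have "residual k g1 g u0 v0 (u c) (w c) (comb n e c) = (\<Sum>i<n. ?F c i * c i)"
      by (simp add: linear_on_comb[OF L eV] mult.commute)
    finally show ?thesis by simp
  qed
  then obtain c where c: "\<And>i. i < n \<Longrightarrow> ?F c i = 0"
    using coercive_map_has_zero[of n ?F R] cont R by blast
  \<comment> \<open>The residual vanishes on null functions, for the loads because of
    \<open>m_null\<close>, so its values at the basis determine it.\<close>
  have "residual k g1 g u0 v0 (u c) (w c) \<phi> = 0" if \<phi>: "\<phi> \<in> V" for \<phi>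
  proof -
    have L: "linear_on V (residual k g1 g u0 v0 (u c) (w c))"
      by (rule residual_linear) (use g1 g u0 v0 uV wV in auto)
    have "residual k g1 g u0 v0 (u c) (w c) \<phi> = (\<Sum>i<n. a \<phi> (e i) * ?F c i)"
    proof (rule Riesz_comb[OF e _ L _ \<phi>])
      fix \<psi> assume \<psi>: "\<psi> \<in> V" "nrm \<psi> = 0"
      then have "mass.nrm \<psi> = 0" using m_null by (simp add: mass.nrm_def)
      then show "residual k g1 g u0 v0 (u c) (w c) \<psi> = 0"
        using U[OF \<psi>(1)] G[OF \<psi>(1)] \<psi> uV wV u0 v0
        by (simp add: residual_def mass.null_right null_right b_null)
    qed (rule res)
    then show ?thesis using c by simp
  qed
  then show ?thesis using uV wV w by blast
qed

text \<open>The product difference is symmetrised as b u E v - b u' E v' = (b E E (v + v') + b (u +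
  u') E D) / 2. Its second part is controlled by the equations for \<open>v\<close> and equals
  \<bar>D\<bar>^2; the first is quadratic in \<open>E\<close> with a coefficient bounded by
  \<open>Q\<close>. The bound 2 in \<open>small\<close> is the coefficient of \<open>a E E\<close>
  after multiplication by 4.\<close>

lemma step_unique:
  assumes "k > 0" and C: "0 \<le> C" and mem: "u0 \<in> V" "v0 \<in> V" "u \<in> V" "v \<in> V" "u' \<in> V" "v' \<in> V"
    and eq: "\<And>\<phi>. \<phi> \<in> V \<Longrightarrow> residual k g1 g u0 v0 u v \<phi> = 0" "\<And>\<phi>. \<phi> \<in> V \<Longrightarrow> residual k g1 g u0 v0 u' v' \<phi> = 0"
    and v: "\<And>\<psi>. \<psi> \<in> V \<Longrightarrow> a v \<psi> = 1/2 * b u u \<psi>" "\<And>\<psi>. \<psi> \<in> V \<Longrightarrow> a v' \<psi> = 1/2 * b u' u' \<psi>"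
    and Q: "nrm v \<le> Q" "nrm v' \<le> Q"
    and small: "C * (Q + nrm v0) + C\<^sup>2 * (nrm u0)\<^sup>2 / 4 < 2"
  shows "nrm (\<lambda>x. u x - u' x) = 0" "nrm (\<lambda>x. v x - v' x) = 0"
proof -
  define E D where "E = (\<lambda>x. u x - u' x)" and "D = (\<lambda>x. v x - v' x)"
  have ED: "E \<in> V" "D \<in> V" using mem by (simp_all add: E_def D_def)
  have bE: "b E E y = b u E y - b u' E y" if "y \<in> V" for y
    using linear_onD(4)[OF b_lin[OF ED(1) that] mem(3) mem(5)] by (simp add: E_def)
  have bD: "b x E D = b x E v - b x E v'" if "x \<in> V" for x
    using linear_onD(4)[OF b_lin3[OF that ED(1)] mem(4) mem(6)] by (simp add: D_def)
  have aE: "a E E = a u E - a u' E" and aD: "a D D = a v D - a v' D" and mE: "m E E = m u E - m u' E"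
    using linear_onD(4)[OF lin_left[OF ED(1)] mem(3) mem(5)]
      linear_onD(4)[OF lin_left[OF ED(2)] mem(4) mem(6)]
      linear_onD(4)[OF mass.lin_left[OF ED(1)] mem(3) mem(5)] by (simp_all add: E_def D_def)
  \<comment> \<open>As \<open>E\<close> is \<open>u - u'\<close>, the mixed terms cancel by symmetry
    and the difference of the two quadratic forms remains, to which the second equation applies at
    both solutions.\<close>
  have sum: "b u E D + b u' E D = 2 * a D D"
  proof -
    have "b u E D + b u' E D = b u u D - b u' u' D"
      using mem ED b_sym[of u u' D] by (simp add: E_def b_simps)
    then show ?thesis using v[OF ED(2)] aD by simp
  qed
  have "0 = 4 * (residual k g1 g u0 v0 u v E - residual k g1 g u0 v0 u' v' E)"
    using eq[OF ED(1)] by simp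
  also have "\<dots> = 8 / k\<^sup>2 * m E E + 2 * a E E + a D D + 1/2 * (b E E v + b E E v') + b E E v0 + b u0 E D"
  proof -
    \<comment> \<open>Full expansion of the residual, so that in the difference all terms depending
      on the data alone drop out.\<close>
    have r: "residual k g1 g u0 v0 x y E = 2 / k\<^sup>2 * m x E - 2 / k\<^sup>2 * m u0 E - 2 / k * g1 E
        + (a x E + a u0 E) / 2 + (b x E y + b x E v0 + b u0 E y + b u0 E v0) / 4 - g E"
      if "x \<in> V" "y \<in> V" for x y
      using that mem ED unfolding residual_def
      by (simp add: b_simps left_simps mass.left_simps add_divide_distrib diff_divide_distrib
          right_diff_distrib power2_eq_square)
    have "8 / k\<^sup>2 * m E E = 4 * (2 / k\<^sup>2 * m u E) - 4 * (2 / k\<^sup>2 * m u' E)"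
      by (simp add: mE diff_divide_distrib right_diff_distrib)
    then show ?thesis
      using r[OF mem(3,4)] r[OF mem(5,6)] bE[OF mem(4)] bE[OF mem(6)] bE[OF mem(2)]
        bD[OF mem(3)] bD[OF mem(5)] bD[OF mem(1)] sum aE by argo
  qed
  finally have id: "8 / k\<^sup>2 * m E E + 2 * a E E + a D D = - 1/2 * (b E E v + b E E v') - b E E v0 - b u0 E D"
    by simp
  have "- 1/2 * (b E E v + b E E v') - b E E v0 \<le> C * (Q + nrm v0) * a E E"
  proof -
    have bd: "\<bar>b E E y\<bar> \<le> C * P * a E E" if "y \<in> V" "nrm y \<le> P" for y P
    proof -
      have "\<bar>b E E y\<bar> \<le> C * a E E * nrm y"
        using b_bound[OF ED(1) ED(1) that(1)] ED by (simp add: power2_eq_square mult.assoc flip: nrm_power2)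
      also have "\<dots> \<le> C * a E E * P"
        using that C nonneg[OF ED(1)] by (intro mult_left_mono) auto
      finally show ?thesis by (simp add: mult_ac)
    qed
    have "C * (Q + nrm v0) * a E E = C * Q * a E E + C * nrm v0 * a E E" by (simp add: algebra_simps)
    then show ?thesis
      using bd[OF mem(4) Q(1), THEN abs_le_D2] bd[OF mem(6) Q(2), THEN abs_le_D2]
        bd[OF mem(2) order_refl, THEN abs_le_D2] by argo
  qed
  \<comment> \<open>Young's inequality with the weight chosen so that it uses up the whole of
    \<open>a D D\<close>; this is where the quarter in \<open>small\<close> comes from.\<close>
  moreover have "- b u0 E D \<le> a D D + C\<^sup>2 * (nrm u0)\<^sup>2 / 4 * a E E"
  proof -
    have "- b u0 E D \<le> C * nrm u0 * nrm E * nrm D" using b_bound[OF mem(1) ED] by simp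
    also have "\<dots> \<le> (nrm D)\<^sup>2 + (C * nrm u0 * nrm E / 2)\<^sup>2"
      using zero_le_power2[of "nrm D - C * nrm u0 * nrm E / 2"] by (simp add: power2_eq_square algebra_simps)
    finally show ?thesis using ED by (simp add: nrm_power2 power_mult_distrib power_divide)
  qed
  moreover have "0 \<le> 8 / k\<^sup>2 * m E E" using mass.nonneg[OF ED(1)] by simp
  ultimately have "(2 - (C * (Q + nrm v0) + C\<^sup>2 * (nrm u0)\<^sup>2 / 4)) * a E E \<le> 0"
    using id by (simp add: algebra_simps)
  then have "a E E = 0"
    using small nonneg[OF ED(1)] by (simp add: mult_le_0_iff)
  then show uu: "nrm (\<lambda>x. u x - u' x) = 0" by (simp add: nrm_def E_def)
  show "nrm (\<lambda>x. v x - v' x) = 0"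
    by (rule quadratic_form_unique[of u u']) (use mem uu v in auto)
qed

end

section \<open>Smooth bump functions\<close>

text \<open>Differentiation stays in the family: it replaces P by X^2 (P - P'). For P = 1 this is
  the standard function exp(-1/t), extended by zero.\<close>

definition flat :: "real poly \<Rightarrow> real \<Rightarrow> real" where
  "flat P t = (if t > 0 then poly P (1 / t) * exp (- (1 / t)) else 0)"

lemma poly_times_exp_minus_tendsto_0: "((\<lambda>s. poly P s * exp (- s)) \<longlongrightarrow> 0) (at_top :: real filter)"
proof -
  have "((\<lambda>s. \<Sum>i\<le>Polynomial.degree P. Polynomial.coeff P i * (s ^ i / exp s)) \<longlongrightarrow> (\<Sum>i\<le>Polynomial.degree P. Polynomial.coeff P i * 0)) at_top"
    by (intro tendsto_intros tendsto_power_div_exp_0)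
  then show ?thesis by (simp add: poly_altdef exp_minus divide_inverse sum_distrib_right mult.assoc)
qed

lemma flat_tendsto_0: "(flat P \<longlongrightarrow> 0) (at_right 0)"
proof -
  have "((\<lambda>t. poly P (inverse t) * exp (- inverse t)) \<longlongrightarrow> 0) (at_right (0::real))"
    by (rule filterlim_compose[OF poly_times_exp_minus_tendsto_0 filterlim_inverse_at_top_right])
  then show ?thesis
    by (rule Lim_transform_eventually)
      (auto simp: flat_def inverse_eq_divide eventually_at_filter)
qed

lemma flat_has_derivative: "(flat P has_real_derivative flat ([:0, 0, 1:] * (P - pderiv P)) t) (at t)"
proof -
  consider "t > 0" | "t < 0" | "t = 0" by linarith
  then show ?thesis
  proof cases
    case 1
    have "((\<lambda>t. poly P (1 / t) * exp (- (1 / t))) has_real_derivative flat ([:0, 0, 1:] * (P - pderiv P)) t) (at t)"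
      using 1 by (auto intro!: derivative_eq_intros simp: flat_def field_simps power2_eq_square)
    then show ?thesis
      by (rule has_field_derivative_transform_within_open[of _ _ _ "{0<..}"]) (use 1 in \<open>auto simp: flat_def\<close>)
  next
    case 2
    have "((\<lambda>t. 0) has_real_derivative flat ([:0, 0, 1:] * (P - pderiv P)) t) (at t)"
      using 2 by (simp add: flat_def)
    then show ?thesis
      by (rule has_field_derivative_transform_within_open[of _ _ _ "{..<0}"]) (use 2 in \<open>auto simp: flat_def\<close>)
  next
    case 3
    \<comment> \<open>To the right of 0 the difference quotient is again in the family, with X P in
      place of P, so the limit at 0 applies to it.\<close>
    have "((\<lambda>h. flat P h / h) \<longlongrightarrow> 0) (at_right 0)"
    proof (rule Lim_transform_eventually[OF flat_tendsto_0[of "[:0, 1:] * P"]])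
      show "\<forall>\<^sub>F h in at_right 0. flat ([:0, 1:] * P) h = flat P h / h"
        by (auto simp: flat_def eventually_at_filter)
    qed
    moreover have "((\<lambda>h. flat P h / h) \<longlongrightarrow> 0) (at_left 0)"
      by (rule Lim_transform_eventually[OF tendsto_const]) (auto simp: flat_def eventually_at_filter)
    ultimately have "((\<lambda>h. flat P h / h) \<longlongrightarrow> 0) (at 0)"
      by (simp add: filterlim_split_at)
    then show ?thesis by (simp add: 3 DERIV_def flat_def)
  qed
qed

text \<open>An invariant class replaces formulas for iterated partial derivatives: induction over
  the list of directions never leaves it.\<close>

lemma smooth_coinduct:
  assumes "Q f" and "\<And>g. Q g \<Longrightarrow> (\<forall>x. g differentiable at x) \<and> (\<forall>i. Q (partial i g))"
  shows "smooth f"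
proof -
  have "Q (partials is f)" for "is"
    using assms by (induction "is") (auto simp: partials_def)
  then show ?thesis using assms(2) by (auto simp: smooth_def)
qed

lemma smooth_zero: "smooth (\<lambda>x. 0)"
  by (rule smooth_coinduct[of "\<lambda>f. f = (\<lambda>x. 0)"]) (auto simp: partial_def)

text \<open>The invariant class used for the bump functions. A generator depends on one coordinate
  affinely, so that the chain rule contributes only a constant factor; a negative \<open>c\<close>
  gives the cut-off at the upper end of an interval.\<close>

inductive flat_algebra :: "(real^2 \<Rightarrow> real) \<Rightarrow> bool" where
  flat: "flat_algebra (\<lambda>x. flat P (c * x $ i + d))"
| add: "\<lbrakk>flat_algebra f; flat_algebra g\<rbrakk> \<Longrightarrow> flat_algebra (\<lambda>x. f x + g x)"
| mult: "\<lbrakk>flat_algebra f; flat_algebra g\<rbrakk> \<Longrightarrow> flat_algebra (\<lambda>x. f x * g x)"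
| scale: "flat_algebra f \<Longrightarrow> flat_algebra (\<lambda>x. c * f x)"

lemma partialI:
  assumes "\<And>x. (f has_derivative G x) (at x)" shows "partial i f = (\<lambda>x. G x (axis i 1))"
  using frechet_derivative_at[OF assms] by (simp add: partial_def fun_eq_iff) 

lemma flat_algebra_partial:
  assumes "flat_algebra f"
  shows "(\<forall>x. f differentiable at x) \<and> (\<forall>i. flat_algebra (partial i f))"
  using assms
proof induction
  case (flat P c j d)
  let ?Q = "[:0, 0, 1:] * (P - pderiv P)"
  have "((\<lambda>x. flat P (c * x $ j + d)) has_derivative (\<lambda>h. c * h $ j * flat ?Q (c * x $ j + d))) (at x)" for x :: "real^2"
    by (rule has_derivative_eq_rhs, rule has_derivative_compose[where f = "\<lambda>x. c * x $ j + d", 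
        OF _ flat_has_derivative[unfolded has_field_derivative_def]])
      (auto intro!: derivative_eq_intros bounded_linear_imp_has_derivative bounded_linear_vec_nth simp: fun_eq_iff)
  from partialI[OF this] this show ?case
    by (auto simp: differentiable_def intro!: flat_algebra.intros)
next
  case (add f g)
  then have "((\<lambda>x. f x + g x) has_derivative (\<lambda>h. frechet_derivative f (at x) h + frechet_derivative g (at x) h)) (at x)" for x
    by (auto intro!: derivative_eq_intros simp: frechet_derivative_works)
  from partialI[OF this] this show ?case
    using add by (auto simp: differentiable_def partial_def intro!: flat_algebra.intros)
next
  case (mult f g)
  then have "((\<lambda>x. f x * g x) has_derivative (\<lambda>h. f x * frechet_derivative g (at x) h + frechet_derivative f (at x) h * g x)) (at x)" for x
    by (auto intro!: derivative_eq_intros simp: frechet_derivative_works)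
  from partialI[OF this] this show ?case
    using mult by (auto simp: differentiable_def partial_def intro!: flat_algebra.intros)
next
  case (scale f c)
  then have "((\<lambda>x. c * f x) has_derivative (\<lambda>h. c * frechet_derivative f (at x) h)) (at x)" for x
    by (auto intro!: derivative_eq_intros simp: frechet_derivative_works)
  from partialI[OF this] this show ?case
    using scale by (auto simp: differentiable_def partial_def intro!: flat_algebra.intros)
qed

lemma flat_algebra_smooth: "flat_algebra f \<Longrightarrow> smooth f"
  by (rule smooth_coinduct[of flat_algebra]) (auto dest: flat_algebra_partial)

text \<open>For \<open>n \<longrightarrow> \<infinity>\<close> these tend to the indicator function of \<open>box a b\<close>.\<close>

definition bump :: "real^2 \<Rightarrow> real^2 \<Rightarrow> nat \<Rightarrow> real^2 \<Rightarrow> real" where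
  "bump a b n x = (flat 1 (real (Suc n) * (x $ 1 - a $ 1)) * flat 1 (real (Suc n) * (b $ 1 - x $ 1)))
    * (flat 1 (real (Suc n) * (x $ 2 - a $ 2)) * flat 1 (real (Suc n) * (b $ 2 - x $ 2)))"

lemma bump_smooth: "smooth (bump a b n)"
proof (rule flat_algebra_smooth)
  have "flat_algebra (\<lambda>x. flat 1 (c * (x $ i - d)))" "flat_algebra (\<lambda>x. flat 1 (c * (d - x $ i)))" for c d i
    using flat_algebra.flat[of 1 c i "- c * d"] flat_algebra.flat[of 1 "- c" i "c * d"]
    by (simp_all add: right_diff_distrib)
  then show "flat_algebra (bump a b n)"
    unfolding bump_def[abs_def] by (intro flat_algebra.mult)
qed

lemma flat_1_bounds: "0 \<le> flat 1 t" "flat 1 t \<le> 1" 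
  by (simp_all add: flat_def)

lemma bump_bounds: "\<bar>bump a b n x\<bar> \<le> 1"
  unfolding bump_def abs_mult using flat_1_bounds by (intro mult_le_one) (simp_all add: abs_of_nonneg)

lemma mem_box_2: "x \<in> box a (b::real^2) \<longleftrightarrow> a $ 1 < x $ 1 \<and> x $ 1 < b $ 1 \<and> a $ 2 < x $ 2 \<and> x $ 2 < b $ 2"
  by (auto simp: mem_box_cart forall_2)

lemma bump_eq_0: "x \<notin> box a b \<Longrightarrow> bump a b n x = 0"
  unfolding mem_box_2 bump_def flat_def
  by (auto simp: zero_less_mult_iff not_less)

lemma bump_tendsto: "(\<lambda>n. bump a b n x) \<longlonglongrightarrow> indicator (box a b) x"
proof (cases "x \<in> box a b")
  case True
  have lim: "(\<lambda>n. flat 1 (real (Suc n) * t)) \<longlonglongrightarrow> 1" if "t > 0" for t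
  proof -
    have "(\<lambda>n. exp (- (inverse (real (Suc n)) / t))) \<longlonglongrightarrow> exp (- (0 / t))"
      by (intro tendsto_intros LIMSEQ_inverse_real_of_nat) (use that in auto)
    moreover have "flat 1 (real (Suc n) * t) = exp (- (inverse (real (Suc n)) / t))" for n
      using that by (simp add: flat_def divide_inverse)
    ultimately show ?thesis by simp
  qed
  have "(\<lambda>n. bump a b n x) \<longlonglongrightarrow> (1 * 1) * (1 * 1)"
    unfolding bump_def using True by (intro tendsto_mult lim) (auto simp: mem_box_2)
  then show ?thesis using True by simp
next
  case False
  then show ?thesis by (simp add: bump_eq_0)
qed

text \<open>The closed box has to lie in \<open>S\<close> because the support is a closure and may
  reach the sides of the box.\<close>

lemma bump_test_function:
  assumes "cbox a b \<subseteq> S" shows "bump a b n \<in> test_functions S"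
proof -
  have sub: "{x. bump a b n x \<noteq> 0} \<subseteq> cbox a b"
    using bump_eq_0[of _ a b n] box_subset_cbox by blast
  then have "closure {x. bump a b n x \<noteq> 0} \<subseteq> cbox a b"
    by (intro closure_minimal closed_cbox)
  moreover have "bounded {x. bump a b n x \<noteq> 0}"
    using sub bounded_cbox bounded_subset by blast
  ultimately show ?thesis
    using assms bump_smooth[of a b n] by (auto simp: test_functions_def)
qed

section \<open>The fundamental lemma of the calculus of variations\<close>

lemma indicator_box_measurable: "indicator (box a b) \<in> borel_measurable (lebesgue :: 'a::euclidean_space measure)"
  by (intro measurable_completion) simp

text \<open>Boxes form an intersection-stable generator of the Borel sets, and the sets over which
  the integral vanishes are closed under complements and countable disjoint unions. A density whose
  integral over every Borel set is zero vanishes almost everywhere.\<close>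

lemma AE_zero_of_box_integrals_zero:
  fixes f :: "'a::euclidean_space \<Rightarrow> real"
  assumes int: "integrable lebesgue f"
    and box: "\<And>a b. (\<integral>x. indicator (box a b) x * f x \<partial>lebesgue) = 0"
  shows "AE x in lebesgue. f x = 0"
proof -
  \<comment> \<open>The generator argument reaches Borel sets only, so \<open>f\<close> is replaced
    by a Borel function that differs from it on a null set.\<close>
  obtain g where g[measurable]: "g \<in> borel_measurable lborel" and fg: "AE x in lborel. f x = g x"
    using completion_ex_borel_measurable_real[of f lborel] int by auto
  have fg': "AE x in lebesgue. f x = g x" using fg by (rule AE_completion)
  have "integrable lebesgue g"
    by (rule Bochner_Integration.integrable_cong_AE_imp[OF int])
      (use g fg' in \<open>auto intro: measurable_completion elim: AE_mp\<close>)
  then have ig: "integrable lborel g" using g by (simp add: integrable_completion)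
  have gbox: "set_lebesgue_integral lborel (box a b) g = 0" for a b
  proof -
    have "set_lebesgue_integral lborel (box a b) g = (\<integral>x. indicator (box a b) x * g x \<partial>lebesgue)"
      unfolding set_lebesgue_integral_def by (simp add: integral_completion)
    also have "\<dots> = (\<integral>x. indicator (box a b) x * f x \<partial>lebesgue)"
      by (intro integral_cong_AE) (use int fg' g in \<open>auto intro: measurable_completion borel_measurable_times indicator_box_measurable\<close>)
    finally show ?thesis using box by simp
  qed
  have si: "set_integrable lborel A g" if "A \<in> sets borel" for A
    unfolding set_integrable_def using ig that by (intro integrable_mult_indicator) auto
  \<comment> \<open>Complements need the integral over the whole space, which is not a box; it is
    the limit along growing cubes.\<close>
  have "(\<lambda>n. set_lebesgue_integral lborel (box (- real n *\<^sub>R One) (real n *\<^sub>R One)) g)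
      \<longlonglongrightarrow> set_lebesgue_integral lborel (\<Union>n. box (- real n *\<^sub>R One) (real n *\<^sub>R One) :: 'a set) g"
  proof (rule set_integral_cont_up)
    show "incseq (\<lambda>n. box (- real n *\<^sub>R One) (real n *\<^sub>R One) :: 'a set)"
      by (intro monoI subset_box_imp) (auto simp: inner_sum_left_Basis)
  qed (auto intro: si)
  then have UNIV: "set_lebesgue_integral lborel UNIV g = 0"
    by (simp add: gbox UN_box_eq_UNIV LIMSEQ_const_iff)
  have zero: "set_lebesgue_integral lborel A g = 0" if "A \<in> sets borel" for A
  proof -
    have "Int_stable (range (\<lambda>(a, b). box a (b::'a)))"
      unfolding Int_stable_def by (auto simp: box_Int_box)
    moreover have "range (\<lambda>(a, b). box a (b::'a)) \<subseteq> Pow UNIV" by simp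
    moreover have "A \<in> sigma_sets UNIV (range (\<lambda>(a, b). box a b))"
      using that unfolding borel_eq_box by simp
    ultimately show ?thesis
    proof (induction rule: sigma_sets_induct_disjoint)
      case (basic A)
      then show ?case using gbox by auto
    next
      case empty
      show ?case by (simp add: set_lebesgue_integral_def)
    next
      case (compl A)
      have A: "A \<in> sets borel" using compl(1) unfolding borel_eq_box by simp
      have "set_lebesgue_integral lborel (A \<union> (UNIV - A)) g
          = set_lebesgue_integral lborel A g + set_lebesgue_integral lborel (UNIV - A) g"
        by (rule set_integral_Un) (use si A in auto)
      then show ?case using compl UNIV by (simp add: Un_UNIV_left)
    next
      case (union A)
      have A: "A i \<in> sets borel" for i using union(2) unfolding borel_eq_box by auto
      have "set_lebesgue_integral lborel (\<Union>i. A i) g = suminf (\<lambda>i. set_lebesgue_integral lborel (A i) g)"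
        by (rule lebesgue_integral_countable_add)
          (use union(1) A si in \<open>auto simp: disjoint_family_on_def\<close>)
      then show ?case using union by simp
    qed
  qed
  have "AE x in lborel. g x = 0"
    by (rule sigma_finite_measure.density_zero[OF sigma_finite_lborel ig]) (use zero in auto)
  with fg have "AE x in lborel. f x = 0" by eventually_elim simp
  then show ?thesis by (rule AE_completion)
qed

section \<open>Integrals, measurability and null sets relative to a subset\<close>

lemma integrable_lebesgue_on_iff:
  fixes f :: "'a::euclidean_space \<Rightarrow> real"
  assumes "S \<in> sets lebesgue"
  shows "integrable (lebesgue_on S) f \<longleftrightarrow> integrable lebesgue (\<lambda>x. indicator S x * f x)"
  using integrable_restrict_space[of S lebesgue f] assms by simp

lemma integral_lebesgue_on:
  fixes f :: "'a::euclidean_space \<Rightarrow> real"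
  assumes "S \<in> sets lebesgue"
  shows "integral\<^sup>L (lebesgue_on S) f = (\<integral>x. indicator S x * f x \<partial>lebesgue)"
  using integral_restrict_space[of S lebesgue f] assms by simp

lemma borel_measurable_lebesgue_on_iff:
  fixes f :: "'a::euclidean_space \<Rightarrow> real"
  assumes "S \<in> sets lebesgue"
  shows "f \<in> borel_measurable (lebesgue_on S) \<longleftrightarrow> (\<lambda>x. indicator S x * f x) \<in> borel_measurable lebesgue"
  using borel_measurable_restrict_space_iff[of S lebesgue f] assms by simp

lemma AE_lebesgue_on_iff:
  assumes "S \<in> sets lebesgue"
  shows "(AE x in lebesgue_on S. P x) \<longleftrightarrow> (AE x in lebesgue. x \<in> S \<longrightarrow> P x)"
  using AE_restrict_space_iff[of S lebesgue P] assms by simp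

text \<open>Local in nature: on a box with closure in \<open>S\<close>, integrals over smaller boxes
  are limits of integrals against bump functions by dominated convergence. Countably many such boxes
  exhaust \<open>S\<close>.\<close>

lemma fundamental_lemma_calculus_of_variations:
  assumes "open S" and g: "g \<in> L2 S" and zero: "\<And>\<eta>. \<eta> \<in> test_functions S \<Longrightarrow> l2_inner S g \<eta> = 0"
  shows "AE x in lebesgue_on S. g x = 0"
proof -
  have S[measurable]: "S \<in> sets lebesgue" using \<open>open S\<close> by (simp add: lebesgue_openin)
  have gm: "(\<lambda>x. indicator S x * g x) \<in> borel_measurable lebesgue"
    and gi: "integrable lebesgue (\<lambda>x. indicator S x * (g x)\<^sup>2)"
    using g by (simp_all add: L2_def borel_measurable_lebesgue_on_iff integrable_lebesgue_on_iff)
  have box: "AE x in lebesgue. indicator (box c d) x * g x = 0" if cd: "cbox c d \<subseteq> S" for c d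
  proof (rule AE_zero_of_box_integrals_zero)
    let ?f = "\<lambda>x. indicator (box c d) x * g x"
    have sub: "box c d \<subseteq> S" using cd box_subset_cbox by blast
    have eq: "?f = (\<lambda>x. indicator (box c d) x * (indicator S x * g x))"
      using sub by (auto simp: fun_eq_iff indicator_def)
    have fm: "?f \<in> borel_measurable lebesgue"
      unfolding eq by (intro borel_measurable_times[OF _ gm] indicator_box_measurable)
    show fi: "integrable lebesgue ?f"
    proof (rule Bochner_Integration.integrable_bound)
      show "integrable lebesgue (\<lambda>x. indicator (box c d) x + indicator S x * (g x)\<^sup>2)"
        using gi lmeasurable_box[of c d]
        by (intro Bochner_Integration.integrable_add integrable_real_indicator) (auto simp: fmeasurable_def)
      \<comment> \<open>On a set of finite measure this makes the square integrable function
        integrable, which provides the dominating function.\<close>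
      have "\<bar>y\<bar> \<le> 1 + y\<^sup>2" for y :: real
        using zero_le_power2[of "\<bar>y\<bar> - 1"] by (simp add: power2_eq_square algebra_simps)
      then show "AE x in lebesgue. norm (?f x) \<le> norm (indicator (box c d) x + indicator S x * (g x)\<^sup>2)"
        using sub by (auto simp: indicator_def abs_of_nonneg)
    qed (rule fm)
    fix a b
    obtain p q where pq: "box a b \<inter> box c d = box p q" using that[OF box_Int_box] .
    show "(\<integral>x. indicator (box a b) x * ?f x \<partial>lebesgue) = 0"
    \<comment> \<open>The corners \<open>p\<close> and \<open>q\<close> are tied to the outer box
      only if the intersection is nonempty, since only then is \<open>cbox p q\<close> the closure
      of \<open>box p q\<close>.\<close>
    proof (cases "box p q = {}")
      case True
      then have "(\<lambda>x. indicator (box a b) x * ?f x) = (\<lambda>x. 0)"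
        using pq by (auto simp: fun_eq_iff indicator_def)
      then show ?thesis by (simp only: Bochner_Integration.integral_zero)
    next
      case False
      have "cbox p q \<subseteq> cbox c d"
      proof -
        have "cbox p q = closure (box p q)" using False by (simp add: closure_box)
        also have "\<dots> \<subseteq> cbox c d"
          using pq box_subset_cbox[of c d] by (intro closure_minimal closed_cbox) blast
        finally show ?thesis .
      qed
      then have test: "bump p q n \<in> test_functions S" for n using cd by (intro bump_test_function) auto
      have "(\<lambda>n. \<integral>x. ?f x * bump p q n x \<partial>lebesgue) \<longlonglongrightarrow> (\<integral>x. ?f x * indicator (box p q) x \<partial>lebesgue)"
      proof (rule integral_dominated_convergence[where w = "\<lambda>x. \<bar>?f x\<bar>"])
        show "(\<lambda>x. ?f x * bump p q n x) \<in> borel_measurable lebesgue" for n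
        proof (rule borel_measurable_times[OF fm])
          have "continuous_on UNIV (bump p q n)"
            using bump_smooth[of p q n] unfolding smooth_def
            by (metis differentiable_imp_continuous_on differentiable_on_def differentiable_at_withinI foldr.simps(1) id_apply partials_def)
          then show "bump p q n \<in> borel_measurable lebesgue"
            by (intro measurable_completion) (simp add: borel_measurable_continuous_onI)
        qed
        show "(\<lambda>x. ?f x * indicator (box p q) x) \<in> borel_measurable lebesgue"
          by (rule borel_measurable_times[OF fm indicator_box_measurable])
        show "AE x in lebesgue. norm (?f x * bump p q n x) \<le> \<bar>?f x\<bar>" for n
          using bump_bounds[of p q n] by (auto simp: abs_mult intro!: mult_left_le)
        show "AE x in lebesgue. (\<lambda>n. ?f x * bump p q n x) \<longlonglongrightarrow> ?f x * indicator (box p q) x"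
          by (auto intro!: tendsto_intros bump_tendsto)
      qed (rule integrable_abs[OF fi])
      moreover have "(\<integral>x. ?f x * bump p q n x \<partial>lebesgue) = 0" for n
      proof -
        have "(\<lambda>x. ?f x * bump p q n x) = (\<lambda>x. indicator S x * (g x * bump p q n x))"
          using pq sub bump_eq_0[of _ p q n] by (auto simp: fun_eq_iff indicator_def)
        then have "(\<integral>x. ?f x * bump p q n x \<partial>lebesgue) = l2_inner S g (bump p q n)"
          by (simp only: l2_inner_def integral_lebesgue_on[OF S])
        then show ?thesis using zero[OF test[of n]] by simp
      qed
      ultimately have "(\<integral>x. ?f x * indicator (box p q) x \<partial>lebesgue) = 0"
        by (simp add: LIMSEQ_const_iff)
      moreover have "(\<lambda>x. ?f x * indicator (box p q) x) = (\<lambda>x. indicator (box a b) x * ?f x)"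
        using pq by (auto simp: fun_eq_iff indicator_def)
      ultimately show ?thesis by (simp only:)
    qed
  qed
  obtain D where D: "countable D" "D \<subseteq> Pow S" "\<And>X. X \<in> D \<Longrightarrow> \<exists>a b. X = cbox a b" "\<Union>D = S"
    using open_countable_Union_open_cbox[OF \<open>open S\<close>] by blast
  have "AE x in lebesgue. \<forall>X\<in>D. x \<in> X \<longrightarrow> g x = 0"
    unfolding AE_ball_countable[OF \<open>countable D\<close>]
  proof
    fix X assume "X \<in> D"
    then obtain c d where X: "X = cbox c d" "cbox c d \<subseteq> S" using D by blast
    \<comment> \<open>The covering uses closed boxes and the vanishing is known on open ones; the
      sides are null.\<close>
    have "AE x in lebesgue. x \<notin> cbox c d - box c d"
      using negligible_frontier_interval[of c d]
      by (intro AE_not_in) (simp add: negligible_iff_null_sets)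
    with box[OF X(2)] show "AE x in lebesgue. x \<in> X \<longrightarrow> g x = 0"
      by eventually_elim (auto simp: X indicator_def split: if_splits)
  qed
  then have "AE x in lebesgue. x \<in> S \<longrightarrow> g x = 0"
    by eventually_elim (use D(4) in blast)
  then show ?thesis by (simp add: AE_lebesgue_on_iff)
qed

section \<open>Integration by parts against test functions\<close>

lemma integrable_compact_support:
  fixes f :: "'a::euclidean_space \<Rightarrow> real"
  assumes "continuous_on UNIV f" "\<And>x. x \<notin> cball 0 R \<Longrightarrow> f x = 0"
  shows "integrable lborel f"
proof -
  have "integrable lborel (\<lambda>x. indicator (cball 0 R) x *\<^sub>R f x)"
    by (rule borel_integrable_compact) (auto intro: continuous_on_subset[OF assms(1)])
  moreover have "(\<lambda>x. indicator (cball 0 R) x *\<^sub>R f x) = f"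
    using assms(2) by (force simp: fun_eq_iff indicator_def)
  ultimately show ?thesis by simp
qed

text \<open>The integrals of difference quotients vanish by translation invariance.\<close>

lemma integral_directional_derivative_eq_0:
  fixes g :: "'a::euclidean_space \<Rightarrow> real"
  assumes der: "\<And>x. (g has_derivative G x) (at x)" and cont: "continuous_on UNIV (\<lambda>x. G x e)"
    and supp: "\<And>x. x \<notin> cball 0 R \<Longrightarrow> g x = 0"
  shows "(\<integral>x. G x e \<partial>lborel) = 0"
proof -
  \<comment> \<open>Step sizes at most 1 keep all translated supports in one ball, of radius
    \<open>R + norm e\<close>.\<close>
  define h where "h n = inverse (real (Suc n))" for n
  have h: "0 < h n" "h n \<le> 1" for n by (simp_all add: h_def field_simps)
  define q where "q n x = (g (x + h n *\<^sub>R e) - g x) / h n" for n x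
  have contg: "continuous_on UNIV g"
    using der by (meson continuous_at_imp_continuous_on has_derivative_continuous)
  have G0: "G x e = 0" if "x \<notin> cball 0 R" for x
  proof -
    have "((\<lambda>x. 0) has_derivative G x) (at x)"
      by (rule has_derivative_transform_within_open[OF der, of "- cball 0 R"]) (use that supp in auto)
    then show ?thesis using has_derivative_unique[OF _ has_derivative_const] by fastforce
  qed
  have line: "((\<lambda>t. g (x + t *\<^sub>R e)) has_real_derivative G (x + t *\<^sub>R e) e) (at t)" for x t
  proof -
    have "((\<lambda>t. x + t *\<^sub>R e) has_derivative (\<lambda>t. t *\<^sub>R e)) (at t)"
      by (auto intro!: derivative_eq_intros)
    from has_derivative_compose[OF this der] show ?thesis
      unfolding has_field_derivative_def
      by (rule has_derivative_eq_rhs)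
        (simp add: fun_eq_iff linear_scale[OF has_derivative_linear[OF der]] mult.commute)
  qed
  \<comment> \<open>Difference quotients are values of the directional derivative at intermediate
    points, so its maximum over the support bounds all of them.\<close>
  have mvt: "\<exists>z. 0 < z \<and> z < h n \<and> q n x = G (x + z *\<^sub>R e) e" for n x
    using MVT2[OF h(1)[of n], of "\<lambda>t. g (x + t *\<^sub>R e)" "\<lambda>t. G (x + t *\<^sub>R e) e"] line h(1)[of n]
    by (auto simp: q_def)
  have "bounded ((\<lambda>x. G x e) ` cball 0 R)"
    by (intro compact_imp_bounded compact_continuous_image continuous_on_subset[OF cont]) auto
  then obtain M where M: "\<And>x. x \<in> cball 0 R \<Longrightarrow> \<bar>G x e\<bar> \<le> M"
    unfolding bounded_iff by fastforce
  have bound: "\<bar>q n x\<bar> \<le> indicator (cball 0 (R + norm e)) x * \<bar>M\<bar>" for n x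
  proof -
    obtain z where z: "0 < z" "z < h n" "q n x = G (x + z *\<^sub>R e) e" using mvt by blast
    show ?thesis
    proof (cases "x + z *\<^sub>R e \<in> cball 0 R")
      case True
      have "norm x \<le> norm (x + z *\<^sub>R e) + norm (z *\<^sub>R e)"
        using norm_triangle_ineq4[of "x + z *\<^sub>R e" "z *\<^sub>R e"] by simp
      also have "\<dots> \<le> R + norm e"
        using True z h(2)[of n] mult_right_mono[of z 1 "norm e"] by simp
      finally show ?thesis using M[OF True] z(3) by simp
    next
      case False
      then show ?thesis using G0 z(3) by (simp add: indicator_def)
    qed
  qed
  have "(\<lambda>n. \<integral>x. q n x \<partial>lborel) \<longlonglongrightarrow> (\<integral>x. G x e \<partial>lborel)"
  proof (rule integral_dominated_convergence[where w = "\<lambda>x. indicator (cball 0 (R + norm e)) x * \<bar>M\<bar>"])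
    show "(\<lambda>x. G x e) \<in> borel_measurable lborel"
      using cont by (simp add: borel_measurable_continuous_onI)
    show "q n \<in> borel_measurable lborel" for n
      unfolding q_def using contg h(1)[of n]
      by (auto intro!: borel_measurable_continuous_onI continuous_intros continuous_on_compose2[OF contg])
    show "integrable lborel (\<lambda>x. indicator (cball 0 (R + norm e)) x * \<bar>M\<bar> :: real)"
      by (intro integrable_mult_left integrable_real_indicator) (use emeasure_bounded_finite[OF bounded_cball] in \<open>auto simp: infinity_ennreal_def\<close>)
    have "filterlim h (at 0) sequentially"
      unfolding filterlim_at using LIMSEQ_inverse_real_of_nat h(1)
      by (auto simp: h_def[abs_def] less_imp_neq)
    then have "(\<lambda>n. q n x) \<longlonglongrightarrow> G x e" for x
      using line[of x 0] unfolding DERIV_def q_def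
      by (auto dest: filterlim_compose)
    then show "AE x in lborel. (\<lambda>n. q n x) \<longlonglongrightarrow> G x e" by simp
    show "AE x in lborel. norm (q n x) \<le> indicator (cball 0 (R + norm e)) x * \<bar>M\<bar>" for n
      using bound by simp
  qed
  moreover have "(\<integral>x. q n x \<partial>lborel) = 0" for n
  proof -
    have gi: "integrable lborel g" by (rule integrable_compact_support[OF contg supp])
    have gm: "g \<in> borel_measurable borel" using contg by (rule borel_measurable_continuous_onI)
    have "(\<integral>x. g (h n *\<^sub>R e + x) \<partial>lborel) = (\<integral>x. g x \<partial>distr lborel borel ((+) (h n *\<^sub>R e)))"
      using gm by (subst integral_distr) auto
    moreover have "integrable (distr lborel borel ((+) (h n *\<^sub>R e))) g"
      using gi by (simp add: lborel_distr_plus)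
    then have "integrable lborel (\<lambda>x. g (h n *\<^sub>R e + x))"
      using gm by (subst (asm) integrable_distr_eq) auto
    ultimately show ?thesis
      using gi h(1)[of n] by (simp add: q_def lborel_distr_plus add.commute)
  qed
  ultimately show ?thesis by (simp add: LIMSEQ_const_iff)
qed

lemma partials_Cons: "partials (i # is) f = partial i (partials is f)"
  by (simp add: partials_def)

lemma test_function_partials:
  assumes "\<eta> \<in> test_functions S"
  obtains R where "\<And>is x. (partials is \<eta> has_derivative frechet_derivative (partials is \<eta>) (at x)) (at x)"
    "\<And>is. continuous_on UNIV (partials is \<eta>)"
    "\<And>is x. x \<notin> S \<Longrightarrow> partials is \<eta> x = 0" "\<And>is x. x \<notin> cball 0 R \<Longrightarrow> partials is \<eta> x = 0"
proof -
  define F where "F = closure {x. \<eta> x \<noteq> 0}"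
  have F: "compact F" "F \<subseteq> S" and diff: "\<And>is x. partials is \<eta> differentiable at x"
    using assms by (auto simp: test_functions_def F_def smooth_def)
  have der: "(partials is \<eta> has_derivative frechet_derivative (partials is \<eta>) (at x)) (at x)" for "is" x
    using diff frechet_derivative_works by blast
  have zero: "partials is \<eta> x = 0" if "x \<notin> F" for "is" x
    using that
  proof (induction "is" arbitrary: x)
    case Nil
    then show ?case using closure_subset by (force simp: F_def partials_def)
  next
    case (Cons i "is")
    have "((\<lambda>x. 0) has_derivative frechet_derivative (partials is \<eta>) (at x)) (at x)"
      by (rule has_derivative_transform_within_open[OF der, of "- F"])
        (use F(1) Cons in \<open>auto simp: compact_imp_closed\<close>)
    then have "frechet_derivative (partials is \<eta>) (at x) = (\<lambda>h. 0)"
      using has_derivative_unique[OF _ has_derivative_const] by blast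
    then show ?case by (simp add: partials_Cons partial_def)
  qed
  obtain R where "\<forall>x\<in>F. norm x \<le> R"
    using compact_imp_bounded[OF F(1)] by (auto simp: bounded_iff)
  then have "F \<subseteq> cball 0 R" by auto
  moreover have "continuous_on UNIV (partials is \<eta>)" for "is"
    using der by (meson continuous_at_imp_continuous_on has_derivative_continuous)
  ultimately show thesis using that[of R] der zero F(2) by blast
qed

text \<open>\<open>partials [i, j]\<close> applies direction \<open>i\<close> last, so this one is
  moved onto \<open>p\<close> first, giving \<open>d\<close>, and then \<open>j\<close> onto
  \<open>d\<close>, giving the constant \<open>H\<close>. Each move says that the integral of a
  derivative of a compactly supported product is zero, and the two signs cancel.\<close>

lemma integration_by_parts_twice:
  assumes p: "\<And>x. (p has_derivative P x) (at x)" and d: "\<And>x. P x (axis i 1) = d x"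
    and d': "\<And>x. (d has_derivative D x) (at x)" and H: "\<And>x. D x (axis j 1) = H"
    and \<eta>: "\<eta> \<in> test_functions S"
  shows "(\<integral>x. p x * partials [i, j] \<eta> x \<partial>lborel) = H * (\<integral>x. \<eta> x \<partial>lborel)"
proof -
  obtain R where der: "\<And>is x. (partials is \<eta> has_derivative frechet_derivative (partials is \<eta>) (at x)) (at x)"
    and cont: "\<And>is. continuous_on UNIV (partials is \<eta>)"
    and supp: "\<And>is x. x \<notin> cball 0 R \<Longrightarrow> partials is \<eta> x = 0"
    using test_function_partials[OF \<eta>] by metis
  have cp: "continuous_on UNIV p" and cd: "continuous_on UNIV d"
    using p d' by (meson continuous_at_imp_continuous_on has_derivative_continuous)+
  have int: "integrable lborel (\<lambda>x. f x * partials is \<eta> x)" if "continuous_on UNIV f" for f "is"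
    by (rule integrable_compact_support[where R = R])
      (use that cont supp in \<open>auto intro!: continuous_intros\<close>)
  have D1: "((\<lambda>x. p x * partials [j] \<eta> x) has_derivative
      (\<lambda>h. p x * frechet_derivative (partials [j] \<eta>) (at x) h + P x h * partials [j] \<eta> x)) (at x)" for x
    using p der by (auto intro!: derivative_eq_intros)
  have "(\<integral>x. p x * frechet_derivative (partials [j] \<eta>) (at x) (axis i 1) + P x (axis i 1) * partials [j] \<eta> x \<partial>lborel) = 0"
    by (rule integral_directional_derivative_eq_0[OF D1, where R = R])
      (use cp cd cont[of "[i, j]"] cont[of "[j]"] supp in \<open>auto simp: d partials_Cons[of i] partial_def[of i] intro!: continuous_intros\<close>)
  then have 1: "(\<integral>x. p x * partials [i, j] \<eta> x + d x * partials [j] \<eta> x \<partial>lborel) = 0"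
    by (simp add: d partials_Cons[of i] partial_def[of i])
  have D2: "((\<lambda>x. d x * partials [] \<eta> x) has_derivative
      (\<lambda>h. d x * frechet_derivative (partials [] \<eta>) (at x) h + D x h * partials [] \<eta> x)) (at x)" for x
    using d' der by (auto intro!: derivative_eq_intros)
  have "(\<integral>x. d x * frechet_derivative (partials [] \<eta>) (at x) (axis j 1) + D x (axis j 1) * partials [] \<eta> x \<partial>lborel) = 0"
    by (rule integral_directional_derivative_eq_0[OF D2, where R = R])
      (use cd cont[of "[j]"] cont[of "[]"] supp in \<open>auto simp: H partials_Cons[of j] partial_def[of j] intro!: continuous_intros\<close>)
  then have 2: "(\<integral>x. d x * partials [j] \<eta> x + H * partials [] \<eta> x \<partial>lborel) = 0"
    by (simp add: H partials_Cons[of j] partial_def[of j])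
  have "integrable lborel (\<lambda>x. H * partials [] \<eta> x)" by (rule int) simp
  then show ?thesis
    using 1 2 int[OF cp, of "[i, j]"] int[OF cd, of "[j]"] by (simp add: partials_def)
qed

section \<open>Square integrable functions and weak derivatives\<close>

lemma L2_times_integrable:
  assumes "f \<in> L2 S" "g \<in> L2 S"
  shows "integrable (lebesgue_on S) (\<lambda>x. f x * g x)"
proof (rule Bochner_Integration.integrable_bound)
  show "integrable (lebesgue_on S) (\<lambda>x. (f x)\<^sup>2 + (g x)\<^sup>2)"
    using assms by (auto simp: L2_def)
  have "\<bar>u * v\<bar> \<le> u\<^sup>2 + v\<^sup>2" for u v :: real
  proof -
    have "0 \<le> (\<bar>u\<bar> - \<bar>v\<bar>)\<^sup>2" "0 \<le> \<bar>u\<bar> * \<bar>v\<bar>" by simp_all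
    then show ?thesis unfolding abs_mult power2_diff by (simp only: power2_abs)
  qed
  then show "AE x in lebesgue_on S. norm (f x * g x) \<le> norm ((f x)\<^sup>2 + (g x)\<^sup>2)"
    by simp
qed (use assms in \<open>auto simp: L2_def\<close>)

interpretation L2: function_space "L2 S" for S
proof
  show "(\<lambda>x. 0) \<in> L2 S" by (simp add: L2_def)
  fix f g :: "real^2 \<Rightarrow> real" and \<alpha> \<beta>
  assume f: "f \<in> L2 S" and g: "g \<in> L2 S"
  have "integrable (lebesgue_on S) (\<lambda>x. \<alpha>\<^sup>2 * (f x)\<^sup>2 + \<beta>\<^sup>2 * (g x)\<^sup>2 + 2 * \<alpha> * \<beta> * (f x * g x))"
    using f g L2_times_integrable[OF f g] by (auto simp: L2_def)
  moreover have "(\<lambda>x. \<alpha>\<^sup>2 * (f x)\<^sup>2 + \<beta>\<^sup>2 * (g x)\<^sup>2 + 2 * \<alpha> * \<beta> * (f x * g x)) = (\<lambda>x. (\<alpha> * f x + \<beta> * g x)\<^sup>2)"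
    by (simp add: power2_eq_square algebra_simps)
  ultimately show "(\<lambda>x. \<alpha> * f x + \<beta> * g x) \<in> L2 S"
    using f g by (auto simp: L2_def)
qed

interpretation L2: semi_inner_space "L2 S" "l2_inner S" for S
proof
  show "linear_on (L2 S) (\<lambda>\<phi>. l2_inner S \<phi> \<xi>)" if "\<xi> \<in> L2 S" for \<xi>
    using L2_times_integrable[OF _ that]
    by (simp add: linear_on_def l2_inner_def distrib_right mult.assoc)
  show "l2_inner S \<phi> \<psi> = l2_inner S \<psi> \<phi>" for \<phi> \<psi>
    by (simp add: l2_inner_def mult.commute)
  show "0 \<le> l2_inner S \<phi> \<phi>" for \<phi>
    by (simp add: l2_inner_def)
qed

lemma l2_norm_eq_nrm: "l2_norm S = semi_inner_space.nrm (l2_inner S)"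
  by (simp add: fun_eq_iff l2_norm_def L2.nrm_def)

lemma L2_AE_cong:
  assumes "f \<in> L2 S" "AE x in lebesgue_on S. f x = g x" "g \<in> borel_measurable (lebesgue_on S)"
  shows "g \<in> L2 S"
proof -
  have "integrable (lebesgue_on S) (\<lambda>x. (g x)\<^sup>2)"
    by (rule Bochner_Integration.integrable_cong_AE_imp[of _ "\<lambda>x. (f x)\<^sup>2"])
      (use assms in \<open>auto simp: L2_def\<close>)
  then show ?thesis using assms(3) by (simp add: L2_def)
qed

lemma l2_inner_cong_AE:
  assumes "f \<in> L2 S" "f' \<in> L2 S" "g \<in> L2 S" "g' \<in> L2 S"
    and "AE x in lebesgue_on S. f x = f' x" "AE x in lebesgue_on S. g x = g' x"
  shows "l2_inner S f g = l2_inner S f' g'"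
  unfolding l2_inner_def using assms by (intro integral_cong_AE) (auto simp: L2_def)

lemma test_function_partials_L2:
  assumes \<eta>: "\<eta> \<in> test_functions S" and S: "S \<in> sets lebesgue"
  shows "partials is \<eta> \<in> L2 S"
proof -
  obtain R where "continuous_on UNIV (partials is \<eta>)" "\<And>x. x \<notin> cball 0 R \<Longrightarrow> partials is \<eta> x = 0"
    using test_function_partials[OF \<eta>] by metis
  then have "partials is \<eta> \<in> borel_measurable borel" "integrable lborel (\<lambda>x. (partials is \<eta> x)\<^sup>2)"
    by (auto intro!: borel_measurable_continuous_onI integrable_compact_support[where R = R] continuous_intros)
  then have *: "partials is \<eta> \<in> borel_measurable lebesgue" "integrable lebesgue (\<lambda>x. (partials is \<eta> x)\<^sup>2)"
    by (auto intro: measurable_completion simp: integrable_completion)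
  then have "integrable (lebesgue_on S) (\<lambda>x. (partials is \<eta> x)\<^sup>2)"
    using S integrable_mult_indicator[OF S *(2)] by (simp add: integrable_lebesgue_on_iff)
  with *(1) show ?thesis by (simp add: L2_def measurable_restrict_space1)
qed

lemma test_function_L2: "\<lbrakk>\<eta> \<in> test_functions S; S \<in> sets lebesgue\<rbrakk> \<Longrightarrow> \<eta> \<in> L2 S"
  using test_function_partials_L2[of \<eta> S "[]"] by (simp add: partials_def)

section \<open>Weak derivatives: uniqueness, linearity, choice of representatives\<close>

lemma has_weak_deriv_unique:
  assumes "open S" and g: "has_weak_deriv S is f g" "has_weak_deriv S is f g'"
  shows "AE x in lebesgue_on S. g x = g' x"
proof -
  have S: "S \<in> sets lebesgue" using \<open>open S\<close> by (simp add: lebesgue_openin)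
  have L2: "g \<in> L2 S" "g' \<in> L2 S" using g by (auto simp: has_weak_deriv_def)
  have "AE x in lebesgue_on S. g x - g' x = 0"
  proof (rule fundamental_lemma_calculus_of_variations[OF \<open>open S\<close>])
    fix \<eta> assume \<eta>: "\<eta> \<in> test_functions S"
    then have "(-1) ^ length is * l2_inner S g \<eta> = (-1) ^ length is * l2_inner S g' \<eta>"
      using g by (simp add: has_weak_deriv_def)
    then show "l2_inner S (\<lambda>x. g x - g' x) \<eta> = 0"
      using L2 test_function_L2[OF \<eta> S] by (simp add: L2.left_simps)
  qed (use L2 in simp)
  then show ?thesis by simp
qed

lemma has_weak_deriv_lin:
  assumes S: "S \<in> sets lebesgue" and f: "f \<in> L2 S" "f' \<in> L2 S"
    and g: "has_weak_deriv S is f g" "has_weak_deriv S is f' g'"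
  shows "has_weak_deriv S is (\<lambda>x. \<alpha> * f x + \<beta> * f' x) (\<lambda>x. \<alpha> * g x + \<beta> * g' x)"
  unfolding has_weak_deriv_def
proof
  have gL2: "g \<in> L2 S" "g' \<in> L2 S" using g by (auto simp: has_weak_deriv_def)
  then show "(\<lambda>x. \<alpha> * g x + \<beta> * g' x) \<in> L2 S" by (rule L2.lin_mem)
  show "\<forall>\<eta>\<in>test_functions S. l2_inner S (\<lambda>x. \<alpha> * f x + \<beta> * f' x) (partials is \<eta>)
      = (-1) ^ length is * l2_inner S (\<lambda>x. \<alpha> * g x + \<beta> * g' x) \<eta>"
  proof
    fix \<eta> assume \<eta>: "\<eta> \<in> test_functions S"
    show "l2_inner S (\<lambda>x. \<alpha> * f x + \<beta> * f' x) (partials is \<eta>)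
      = (-1) ^ length is * l2_inner S (\<lambda>x. \<alpha> * g x + \<beta> * g' x) \<eta>"
      using g gL2 f \<eta> test_function_L2[OF \<eta> S] test_function_partials_L2[OF \<eta> S]
      by (simp add: L2.left_simps has_weak_deriv_def algebra_simps)
  qed
qed

lemma has_weak_deriv_AE_cong:
  assumes S: "S \<in> sets lebesgue" and f: "f \<in> L2 S" "f' \<in> L2 S" "AE x in lebesgue_on S. f x = f' x"
    and g: "has_weak_deriv S is f g"
  shows "has_weak_deriv S is f' g"
proof -
  have "l2_inner S f (partials is \<eta>) = l2_inner S f' (partials is \<eta>)" if "\<eta> \<in> test_functions S" for \<eta>
    using f test_function_partials_L2[OF that S] by (intro l2_inner_cong_AE) auto
  with g show ?thesis by (simp add: has_weak_deriv_def)
qed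

lemma has_weak_deriv_zero: "has_weak_deriv S is (\<lambda>x. 0) (\<lambda>x. 0)"
  using L2.zero_mem by (simp add: has_weak_deriv_def l2_inner_def)

lemma weak_deriv_works: "has_weak_deriv S is f g \<Longrightarrow> has_weak_deriv S is f (weak_deriv S is f)"
  unfolding weak_deriv_def by (rule someI[of "has_weak_deriv S is f"])

lemma weak_deriv_eq_AE:
  assumes "open S" "has_weak_deriv S is f g" shows "AE x in lebesgue_on S. weak_deriv S is f x = g x"
  using has_weak_deriv_unique[OF assms(1) weak_deriv_works assms(2)] assms(2) by blast

lemma H2_weak_deriv:
  assumes "f \<in> H2 S" "length is \<le> 2" shows "has_weak_deriv S is f (weak_deriv S is f)"
  using assms weak_deriv_works by (auto simp: H2_def)

lemma H2_function_space: "open S \<Longrightarrow> function_space (H2 S)"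
proof
  assume "open S"
  then have S: "S \<in> sets lebesgue" by (simp add: lebesgue_openin)
  show "(\<lambda>x. 0) \<in> H2 S" using has_weak_deriv_zero L2.zero_mem by (auto simp: H2_def)
  show "(\<lambda>x. \<alpha> * f x + \<beta> * g x) \<in> H2 S" if "f \<in> H2 S" "g \<in> H2 S" for f g \<alpha> \<beta>
  proof -
    have L2: "f \<in> L2 S" "g \<in> L2 S" using that by (simp_all add: H2_def)
    have "has_weak_deriv S is (\<lambda>x. \<alpha> * f x + \<beta> * g x) (\<lambda>x. \<alpha> * weak_deriv S is f x + \<beta> * weak_deriv S is g x)"
      if "length is \<le> 2" for "is"
      by (rule has_weak_deriv_lin[OF S])
        (use \<open>f \<in> H2 S\<close> \<open>g \<in> H2 S\<close> L2 that in \<open>auto intro: H2_weak_deriv\<close>)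
    then show ?thesis using L2.lin_mem[OF L2] by (auto simp: H2_def)
  qed
qed

text \<open>Shared by \<open>a_form\<close> on \<open>H2\<close> and \<open>a_pw\<close> on the
  Morley space. \<open>D\<close> selects a representative for each function, so it can be linear
  only almost everywhere; integration makes the form exactly bilinear.\<close>

lemma semi_inner_space_of_second_derivatives:
  assumes "function_space V" and L2: "\<And>\<phi> i j. \<phi> \<in> V \<Longrightarrow> D \<phi> i j \<in> L2 S"
    and lin: "\<And>\<phi> \<psi> \<alpha> \<beta> i j. \<lbrakk>\<phi> \<in> V; \<psi> \<in> V\<rbrakk> \<Longrightarrow>
      AE x in lebesgue_on S. D (\<lambda>x. \<alpha> * \<phi> x + \<beta> * \<psi> x) i j x = \<alpha> * D \<phi> i j x + \<beta> * D \<psi> i j x"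
    and A: "\<And>\<phi> \<psi>. A \<phi> \<psi> = (\<integral>x. (\<Sum>i\<in>UNIV. \<Sum>j\<in>UNIV. D \<phi> i j x * D \<psi> i j x) \<partial>lebesgue_on S)"
  shows "semi_inner_space V A"
    and "\<lbrakk>\<phi> \<in> V; \<psi> \<in> V\<rbrakk> \<Longrightarrow> A \<phi> \<psi> = (\<Sum>i\<in>(UNIV::2 set). \<Sum>j\<in>(UNIV::2 set). l2_inner S (D \<phi> i j) (D \<psi> i j))"
proof -
  interpret function_space V by fact
  have A': "A \<phi> \<psi> = (\<Sum>i\<in>(UNIV::2 set). \<Sum>j\<in>(UNIV::2 set). l2_inner S (D \<phi> i j) (D \<psi> i j))"
    if "\<phi> \<in> V" "\<psi> \<in> V" for \<phi> \<psi>
    unfolding A l2_inner_def using L2_times_integrable[OF L2[OF that(1)] L2[OF that(2)]]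
    by (subst Bochner_Integration.integral_sum; (subst Bochner_Integration.integral_sum)?) auto
  then show "\<lbrakk>\<phi> \<in> V; \<psi> \<in> V\<rbrakk> \<Longrightarrow> A \<phi> \<psi> = (\<Sum>i\<in>UNIV. \<Sum>j\<in>UNIV. l2_inner S (D \<phi> i j) (D \<psi> i j))" .
  show "semi_inner_space V A"
  proof
    fix \<xi> assume \<xi>: "\<xi> \<in> V"
    have "l2_inner S (D (\<lambda>x. \<alpha> * \<phi> x + \<beta> * \<psi> x) i j) (D \<xi> i j)
        = \<alpha> * l2_inner S (D \<phi> i j) (D \<xi> i j) + \<beta> * l2_inner S (D \<psi> i j) (D \<xi> i j)"
      if "\<phi> \<in> V" "\<psi> \<in> V" for \<phi> \<psi> \<alpha> \<beta> i j
    proof -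
      have "l2_inner S (D (\<lambda>x. \<alpha> * \<phi> x + \<beta> * \<psi> x) i j) (D \<xi> i j)
          = l2_inner S (\<lambda>x. \<alpha> * D \<phi> i j x + \<beta> * D \<psi> i j x) (D \<xi> i j)"
        using that lin[OF that] lin_mem[OF that] L2 \<xi> by (intro l2_inner_cong_AE) (auto intro: L2.lin_mem)
      then show ?thesis using that L2 \<xi> by (simp add: L2.left_simps)
    qed
    then show "linear_on V (\<lambda>\<phi>. A \<phi> \<xi>)"
      using \<xi> by (simp add: linear_on_def A' lin_mem sum.distrib sum_distrib_left)
  next
    show "A \<phi> \<psi> = A \<psi> \<phi>" for \<phi> \<psi> by (simp add: A mult.commute)
    show "0 \<le> A \<phi> \<phi>" for \<phi> by (simp add: A sum_nonneg)
  qed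
qed

lemma H2_second_derivatives_lin:
  assumes "open S" "f \<in> H2 S" "g \<in> H2 S"
  shows "AE x in lebesgue_on S. weak_deriv S [i, j] (\<lambda>x. \<alpha> * f x + \<beta> * g x) x
    = \<alpha> * weak_deriv S [i, j] f x + \<beta> * weak_deriv S [i, j] g x"
proof (rule weak_deriv_eq_AE[OF \<open>open S\<close> has_weak_deriv_lin])
  show "S \<in> sets lebesgue" using \<open>open S\<close> by (simp add: lebesgue_openin)
  show "f \<in> L2 S" "g \<in> L2 S" using assms by (simp_all add: H2_def)
qed (use assms in \<open>auto intro: H2_weak_deriv\<close>)

lemma H2_second_derivatives_L2:
  assumes "f \<in> H2 S" shows "weak_deriv S [i, j] f \<in> L2 S"
  using H2_weak_deriv[OF assms, of "[i, j]"] by (simp add: has_weak_deriv_def)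

lemma a_form_semi_inner: "open S \<Longrightarrow> semi_inner_space (H2 S) (a_form S)"
  by (rule semi_inner_space_of_second_derivatives(1)
      [where D = "\<lambda>\<phi> i j. weak_deriv S [i, j] \<phi>" and S = S, OF H2_function_space _ _ a_form_def])
    (auto intro: H2_second_derivatives_L2 H2_second_derivatives_lin)

lemma H2_seminorm_eq_nrm:
  assumes "open S" "f \<in> H2 S" shows "H2_seminorm S f = semi_inner_space.nrm (a_form S) f"
proof -
  interpret semi_inner_space "H2 S" "a_form S" using assms by (intro a_form_semi_inner)
  have "a_form S f f = (\<Sum>i\<in>UNIV. \<Sum>j\<in>UNIV. l2_inner S (weak_deriv S [i, j] f) (weak_deriv S [i, j] f))"
    by (rule semi_inner_space_of_second_derivatives(2)
      [where D = "\<lambda>\<phi> i j. weak_deriv S [i, j] \<phi>" and S = S, OF H2_function_space _ _ a_form_def])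
      (use assms in \<open>auto intro: H2_second_derivatives_L2 H2_second_derivatives_lin\<close>)
  then show ?thesis
    using H2_second_derivatives_L2[OF assms(2)]
    by (simp add: H2_seminorm_def nrm_def l2_norm_eq_nrm L2.nrm_power2)
qed

text \<open>The operator \<open>J\<close> is linear only up to null sets, and this carries its
  linearity over to the load functional.\<close>

lemma a_form_AE_cong:
  assumes "open S" "f \<in> H2 S" "g \<in> H2 S" "h \<in> H2 S" "ae_eq S g h"
  shows "a_form S f g = a_form S f h"
proof -
  have S: "S \<in> sets lebesgue" using \<open>open S\<close> by (simp add: lebesgue_openin)
  have "AE x in lebesgue_on S. weak_deriv S [i, j] g x = weak_deriv S [i, j] h x" for i j
    by (rule weak_deriv_eq_AE[OF \<open>open S\<close>], rule has_weak_deriv_AE_cong[OF S, of h])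
      (use assms H2_weak_deriv[of h S] in \<open>auto simp: H2_def ae_eq_def\<close>)
  then have "AE x in lebesgue_on S. \<forall>i j. weak_deriv S [i, j] g x = weak_deriv S [i, j] h x"
    by (simp add: AE_all_countable)
  moreover have "weak_deriv S [i, j] \<phi> \<in> borel_measurable (lebesgue_on S)" if "\<phi> \<in> H2 S" for \<phi> i j
    using H2_second_derivatives_L2[OF that] by (simp add: L2_def)
  ultimately show ?thesis
    unfolding a_form_def
  proof (intro integral_cong_AE)
    assume "AE x in lebesgue_on S. \<forall>i j. weak_deriv S [i, j] g x = weak_deriv S [i, j] h x"
    then show "AE x in lebesgue_on S. (\<Sum>i\<in>UNIV. \<Sum>j\<in>UNIV. weak_deriv S [i, j] f x * weak_deriv S [i, j] g x)
        = (\<Sum>i\<in>UNIV. \<Sum>j\<in>UNIV. weak_deriv S [i, j] f x * weak_deriv S [i, j] h x)"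
      by eventually_elim simp
  qed (use assms in \<open>auto intro!: borel_measurable_sum borel_measurable_times\<close>)
qed

section \<open>Triangulations and quadratic polynomials\<close>

locale mesh =
  fixes \<Omega> :: "(real^2) set" and \<T> :: "(real^2) set set"
  assumes domain: "polygonal_lipschitz_domain \<Omega>" and triangulation: "triangulation_of \<Omega> \<T>"
begin

lemma open_domain: "open \<Omega>" and bounded_domain: "bounded \<Omega>"
  using domain by (auto simp: polygonal_lipschitz_domain_def lipschitz_domain_def)

lemma domain_lebesgue [simp]: "\<Omega> \<in> sets lebesgue"
  using open_domain by (simp add: lebesgue_openin)

lemma finite_mesh [simp]: "finite \<T>"
  using triangulation by (simp add: triangulation_of_def triangulation_def)

lemma Union_mesh: "\<Union>\<T> = closure \<Omega>"
  using triangulation by (simp add: triangulation_of_def)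

lemma triangle_compact_convex: "K \<in> \<T> \<Longrightarrow> compact K" "K \<in> \<T> \<Longrightarrow> convex K"
  using triangulation by (auto simp: triangulation_of_def simplex intro: finite_imp_compact_convex_hull)

lemma interior_lebesgue [simp]: "interior K \<in> sets lebesgue"
  by (simp add: lebesgue_openin)

text \<open>The common part is a face of either triangle, and a face that meets the interior is the
  whole triangle.\<close>

lemma interiors_disjoint:
  assumes "K \<in> \<T>" "K' \<in> \<T>" "x \<in> interior K" "x \<in> interior K'" shows "K = K'"
proof -
  have "(K \<inter> K') face_of K" "(K' \<inter> K) face_of K'"
    using triangulation assms by (auto simp: triangulation_of_def triangulation_def)
  moreover have "x \<in> K \<inter> K'" using assms interior_subset by blast
  ultimately have "K \<inter> K' = K" "K' \<inter> K = K'"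
    using face_of_disjoint_interior assms(3,4) by blast+
  then show ?thesis by blast
qed

text \<open>The exceptional null set: off it, lying in the domain means lying in the interior of
  exactly one triangle, and lying in a closed triangle means lying in its interior and in the
  domain.\<close>

definition skeleton :: "(real^2) set" where
  "skeleton = frontier \<Omega> \<union> (\<Union>K\<in>\<T>. frontier K)"

lemma skeleton_null: "AE x in lebesgue. x \<notin> skeleton"
proof -
  obtain S where S: "finite S" "frontier \<Omega> = (\<Union>(a,b)\<in>S. closed_segment a b)"
    using domain by (auto simp: polygonal_lipschitz_domain_def polygonal_boundary_def)
  have "negligible (closed_segment a (b::real^2))" for a b
    by (simp add: negligible_convex_interior interior_closed_segment_ge2)
  then have "negligible (frontier \<Omega>)"
    unfolding S(2) using S(1) by (intro negligible_Union) auto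
  moreover have "negligible (\<Union>K\<in>\<T>. frontier K)"
    by (intro negligible_Union) (auto intro: negligible_convex_frontier triangle_compact_convex)
  ultimately have "negligible skeleton" by (simp add: skeleton_def negligible_Un)
  then show ?thesis by (intro AE_not_in) (simp add: negligible_iff_null_sets)
qed

lemma off_skeleton:
  assumes "x \<notin> skeleton"
  shows "x \<in> \<Omega> \<Longrightarrow> \<exists>!K. K \<in> \<T> \<and> x \<in> interior K"
    and "\<lbrakk>K \<in> \<T>; x \<in> K\<rbrakk> \<Longrightarrow> x \<in> interior K \<and> x \<in> \<Omega>"
proof -
  show *: "x \<in> interior K \<and> x \<in> \<Omega>" if "K \<in> \<T>" "x \<in> K" for K
  proof
    have "x \<in> closure K" using that closure_subset by blast
    then show "x \<in> interior K" using assms that by (auto simp: skeleton_def frontier_def)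
    have "x \<in> closure \<Omega>" using Union_mesh that by blast
    then show "x \<in> \<Omega>" using assms open_domain by (auto simp: skeleton_def frontier_def interior_open)
  qed
  assume "x \<in> \<Omega>"
  then obtain K where "K \<in> \<T>" "x \<in> K" using Union_mesh closure_subset by blast
  with * interiors_disjoint show "\<exists>!K. K \<in> \<T> \<and> x \<in> interior K" by blast
qed

lemma sum_interior:
  assumes "K \<in> \<T>" "x \<in> interior K"
  shows "(\<Sum>K\<in>\<T>. if x \<in> interior K then F K else 0) = F K"
proof -
  have "(\<Sum>K'\<in>\<T>. if x \<in> interior K' then F K' else 0) = (\<Sum>K'\<in>\<T>. if K' = K then F K' else 0)"
    using assms interiors_disjoint by (intro sum.cong) auto
  then show ?thesis using assms by simp
qed

lemma D2pw_interior:
  "\<lbrakk>K \<in> \<T>; x \<in> interior K\<rbrakk> \<Longrightarrow> D2pw \<T> \<phi> i j x = weak_deriv (interior K) [i, j] \<phi> x"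
  unfolding D2pw_def by (rule sum_interior)

end

section \<open>Quadratic polynomials and their weak Hessians\<close>

lemma quadratic_polynomial_derivatives:
  assumes "quadratic_polynomial p"
  obtains d :: "2 \<Rightarrow> real^2 \<Rightarrow> real" and H :: "2 \<Rightarrow> 2 \<Rightarrow> real"
  where "\<And>x. (p has_derivative (\<lambda>h. \<Sum>i\<in>UNIV. d i x * h $ i)) (at x)"
    "\<And>i x. (d i has_derivative (\<lambda>h. \<Sum>j\<in>UNIV. H i j * h $ j)) (at x)" "\<And>i j. H i j = H j i"
proof -
  obtain c0 c1 c2 c3 c4 c5 where
    p: "\<And>x. p x = c0 + c1 * x$1 + c2 * x$2 + c3 * (x$1)\<^sup>2 + c4 * (x$1 * x$2) + c5 * (x$2)\<^sup>2"
    using assms unfolding quadratic_polynomial_def by blast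
  define d where "d i x = (if i = 1 then c1 + 2 * c3 * x$1 + c4 * x$2 else c2 + c4 * x$1 + 2 * c5 * x$2)"
    for i :: 2 and x :: "real^2"
  define H where "H i j = (if i \<noteq> j then c4 else if i = 1 then 2 * c3 else 2 * c5)" for i j :: 2
  have proj: "((\<lambda>x. x $ i) has_derivative (\<lambda>h. h $ i)) (at x)" for i and x :: "real^2"
    by (intro bounded_linear_imp_has_derivative bounded_linear_vec_nth)
  have dp: "(p has_derivative (\<lambda>h. \<Sum>i\<in>UNIV. d i x * h $ i)) (at x)" for x
    unfolding p[abs_def]
    by (auto intro!: derivative_eq_intros proj simp: fun_eq_iff d_def UNIV_2 algebra_simps)
  have dd: "(d i has_derivative (\<lambda>h. \<Sum>j\<in>UNIV. H i j * h $ j)) (at x)" for i x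
    using exhaust_2[of i]
    by (auto intro!: derivative_eq_intros proj simp: fun_eq_iff d_def[abs_def] H_def UNIV_2 algebra_simps)
  show thesis by (rule that[OF dp dd]) (simp add: H_def)
qed

lemma quadratic_polynomial_differentiable: "quadratic_polynomial p \<Longrightarrow> p differentiable at x"
  by (rule quadratic_polynomial_derivatives) (auto simp: differentiable_def)

lemma quadratic_polynomial_continuous: "quadratic_polynomial p \<Longrightarrow> continuous_on UNIV p"
  by (simp add: differentiable_imp_continuous_on differentiable_on_def quadratic_polynomial_differentiable)

lemma quadratic_polynomial_lin:
  assumes "quadratic_polynomial p" "quadratic_polynomial q"
  shows "quadratic_polynomial (\<lambda>x. \<alpha> * p x + \<beta> * q x)"
proof -
  obtain c0 c1 c2 c3 c4 c5 where
    p: "\<And>x. p x = c0 + c1 * x$1 + c2 * x$2 + c3 * (x$1)\<^sup>2 + c4 * (x$1 * x$2) + c5 * (x$2)\<^sup>2"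
    using assms(1) unfolding quadratic_polynomial_def by blast
  obtain d0 d1 d2 d3 d4 d5 where
    q: "\<And>x. q x = d0 + d1 * x$1 + d2 * x$2 + d3 * (x$1)\<^sup>2 + d4 * (x$1 * x$2) + d5 * (x$2)\<^sup>2"
    using assms(2) unfolding quadratic_polynomial_def by blast
  show ?thesis
    unfolding quadratic_polynomial_def
    by (rule exI[of _ "\<alpha> * c0 + \<beta> * d0"], rule exI[of _ "\<alpha> * c1 + \<beta> * d1"], rule exI[of _ "\<alpha> * c2 + \<beta> * d2"],
        rule exI[of _ "\<alpha> * c3 + \<beta> * d3"], rule exI[of _ "\<alpha> * c4 + \<beta> * d4"], rule exI[of _ "\<alpha> * c5 + \<beta> * d5"])
      (simp add: p q algebra_simps)
qed

lemma frechet_derivative_lin: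
  fixes p q :: "'a::real_normed_vector \<Rightarrow> real"
  assumes "p differentiable at x" "q differentiable at x"
  shows "frechet_derivative (\<lambda>x. \<alpha> * p x + \<beta> * q x) (at x) h
    = \<alpha> * frechet_derivative p (at x) h + \<beta> * frechet_derivative q (at x) h"
proof -
  have "((\<lambda>x. \<alpha> * p x + \<beta> * q x) has_derivative
      (\<lambda>h. \<alpha> * frechet_derivative p (at x) h + \<beta> * frechet_derivative q (at x) h)) (at x)"
    using assms by (auto intro!: derivative_eq_intros simp: frechet_derivative_works)
  from frechet_derivative_at[OF this] show ?thesis by metis
qed

text \<open>Nothing is known of \<phi> outside \<open>S\<close>, but test functions vanish there.
  The integral may therefore be taken over the whole plane with the polynomial in place of
  \<phi>.\<close>

lemma has_weak_deriv_quadratic: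
  assumes "open S" "bounded S" and p: "quadratic_polynomial p" and eq: "\<And>x. x \<in> S \<Longrightarrow> \<phi> x = p x"
  obtains H where "\<And>i j. has_weak_deriv S [i, j] \<phi> (\<lambda>x. H i j)" "\<And>i j. H i j = H j i"
proof -
  have S: "S \<in> sets lebesgue" using \<open>open S\<close> by (simp add: lebesgue_openin)
  have Sf: "S \<in> lmeasurable" using assms(1,2) by (simp add: lmeasurable_open)
  obtain d H where d: "\<And>x. (p has_derivative (\<lambda>h. \<Sum>i\<in>UNIV. d i x * h $ i)) (at x)"
    and dd: "\<And>i x. (d i has_derivative (\<lambda>h. \<Sum>j\<in>UNIV. H i j * h $ j)) (at x)"
    and sym: "\<And>i j. H i j = (H j i :: real)"
    by (rule quadratic_polynomial_derivatives[OF p]) blast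
  have "has_weak_deriv S [i, j] \<phi> (\<lambda>x. H i j)" for i j
    unfolding has_weak_deriv_def
  proof
    have "integrable (lebesgue_on S) (\<lambda>x. c)" for c :: real
      using Sf by (auto simp: integrable_lebesgue_on_iff[OF S] fmeasurable_def intro!: integrable_real_indicator)
    then show "(\<lambda>x. H i j) \<in> L2 S" by (simp add: L2_def)
    show "\<forall>\<eta>\<in>test_functions S. l2_inner S \<phi> (partials [i, j] \<eta>) = (-1) ^ length [i, j] * l2_inner S (\<lambda>x. H i j) \<eta>"
    proof
      fix \<eta> assume \<eta>: "\<eta> \<in> test_functions S"
      obtain R where cont: "\<And>is. continuous_on UNIV (partials is \<eta>)"
        and supp: "\<And>is x. x \<notin> S \<Longrightarrow> partials is \<eta> x = 0"
        by (rule test_function_partials[OF \<eta>]) blast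
      have \<eta>m: "\<eta> \<in> borel_measurable borel"
        using cont[of "[]"] by (simp add: partials_def borel_measurable_continuous_onI)
      have *: "(\<lambda>x. indicator S x * (\<phi> x * partials [i, j] \<eta> x)) = (\<lambda>x. p x * partials [i, j] \<eta> x)"
        "(\<lambda>x. indicator S x * (H i j * \<eta> x)) = (\<lambda>x. H i j * \<eta> x)"
        using eq supp[of _ "[i, j]"] supp[of _ "[]"] by (auto simp: fun_eq_iff indicator_def partials_def)
      have "l2_inner S \<phi> (partials [i, j] \<eta>) = (\<integral>x. p x * partials [i, j] \<eta> x \<partial>lebesgue)"
        by (simp only: l2_inner_def integral_lebesgue_on[OF S] *)
      also have "\<dots> = (\<integral>x. p x * partials [i, j] \<eta> x \<partial>lborel)"
        using cont quadratic_polynomial_continuous[OF p]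
        by (intro integral_completion) (auto intro!: borel_measurable_continuous_onI continuous_intros)
      also have "\<dots> = H i j * (\<integral>x. \<eta> x \<partial>lborel)"
        by (rule integration_by_parts_twice[OF d _ dd _ \<eta>])
          (simp_all add: axis_def if_distrib cong: if_cong)
      also have "\<dots> = (\<integral>x. H i j * \<eta> x \<partial>lebesgue)"
        using \<eta>m by (simp add: integral_completion)
      also have "\<dots> = l2_inner S (\<lambda>x. H i j) \<eta>"
        by (simp only: l2_inner_def integral_lebesgue_on[OF S] *)
      finally show "l2_inner S \<phi> (partials [i, j] \<eta>) = (-1) ^ length [i, j] * l2_inner S (\<lambda>x. H i j) \<eta>"
        by simp
    qed
  qed
  then show thesis using that sym by blast
qed

section \<open>Piecewise Hessians of Morley functions\<close>

text \<open>Closed under products, as L2 is not; the trilinear form integrates products of three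
  factors. The bound is essential, since chosen weak derivatives are controlled only almost
  everywhere.\<close>

definition bounded_measurable :: "(real^2) set \<Rightarrow> (real^2 \<Rightarrow> real) set" where
  "bounded_measurable S = {f \<in> borel_measurable (lebesgue_on S). \<exists>B. AE x in lebesgue_on S. \<bar>f x\<bar> \<le> B}"

lemma bounded_measurable_times:
  assumes "f \<in> bounded_measurable S" "g \<in> bounded_measurable S"
  shows "(\<lambda>x. f x * g x) \<in> bounded_measurable S"
proof -
  obtain A B where A: "AE x in lebesgue_on S. \<bar>f x\<bar> \<le> A" and B: "AE x in lebesgue_on S. \<bar>g x\<bar> \<le> B"
    using assms by (auto simp: bounded_measurable_def)
  have "AE x in lebesgue_on S. \<bar>f x * g x\<bar> \<le> A * B"
    using A B by eventually_elim (auto simp: abs_mult intro: mult_mono')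
  then show ?thesis using assms by (auto simp: bounded_measurable_def)
qed

lemma bounded_measurable_add:
  assumes "f \<in> bounded_measurable S" "g \<in> bounded_measurable S"
  shows "(\<lambda>x. f x + g x) \<in> bounded_measurable S"
proof -
  obtain A B where A: "AE x in lebesgue_on S. \<bar>f x\<bar> \<le> A" and B: "AE x in lebesgue_on S. \<bar>g x\<bar> \<le> B"
    using assms by (auto simp: bounded_measurable_def)
  have "AE x in lebesgue_on S. \<bar>f x + g x\<bar> \<le> A + B"
    using A B by eventually_elim linarith
  then show ?thesis using assms by (auto simp: bounded_measurable_def)
qed

lemma bounded_measurable_const: "(\<lambda>x. c) \<in> bounded_measurable S"
  by (auto simp: bounded_measurable_def)

lemma bounded_measurable_diff:
  assumes "f \<in> bounded_measurable S" "g \<in> bounded_measurable S"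
  shows "(\<lambda>x. f x - g x) \<in> bounded_measurable S"
  using bounded_measurable_add[OF assms(1) bounded_measurable_times[OF bounded_measurable_const[of "-1"] assms(2)]]
  by simp

lemma bounded_measurable_sum:
  assumes "\<And>i. i \<in> I \<Longrightarrow> f i \<in> bounded_measurable S"
  shows "(\<lambda>x. \<Sum>i\<in>I. f i x) \<in> bounded_measurable S"
  using assms by (induction I rule: infinite_finite_induct)
    (auto intro: bounded_measurable_add bounded_measurable_const)

lemmas bounded_measurable_intros =
  bounded_measurable_times bounded_measurable_add bounded_measurable_diff bounded_measurable_const
  bounded_measurable_sum

lemma bounded_measurable_integrable:
  assumes S: "S \<in> lmeasurable" and f: "f \<in> bounded_measurable S"
  shows "integrable (lebesgue_on S) f"
proof -
  obtain B where B: "AE x in lebesgue_on S. \<bar>f x\<bar> \<le> B" using f by (auto simp: bounded_measurable_def)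
  have Ssets: "S \<in> sets lebesgue" using S by (simp add: fmeasurableD)
  have "integrable (lebesgue_on S) (\<lambda>x. \<bar>B\<bar>)"
    using S by (auto simp: integrable_lebesgue_on_iff[OF Ssets] fmeasurable_def intro!: integrable_real_indicator)
  then show ?thesis
    by (rule Bochner_Integration.integrable_bound)
      (use f B in \<open>auto simp: bounded_measurable_def elim!: AE_mp\<close>)
qed

lemma bounded_measurable_L2:
  assumes "S \<in> lmeasurable" "f \<in> bounded_measurable S" shows "f \<in> L2 S"
  using bounded_measurable_integrable[OF assms(1) bounded_measurable_times[OF assms(2,2)]] assms(2)
  by (simp add: L2_def bounded_measurable_def power2_eq_square)

context mesh
begin

lemma domain_lmeasurable [simp]: "\<Omega> \<in> lmeasurable"
  using open_domain bounded_domain by (simp add: lmeasurable_open)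

lemma interior_lmeasurable: "K \<in> \<T> \<Longrightarrow> interior K \<in> lmeasurable"
  using triangle_compact_convex(1)[of K] by (simp add: lmeasurable_open compact_imp_bounded bounded_interior)

lemma triangle_lebesgue: "K \<in> \<T> \<Longrightarrow> K \<in> sets lebesgue"
  using triangle_compact_convex(1)[of K] by (auto intro: sets_completionI_sets dest: compact_imp_closed borel_closed)

text \<open>Each piece is continuous on the whole plane, hence bounded on its compact triangle.
  Measurability passes from the glued function \<open>?g\<close> to \<open>f\<close> because
  Lebesgue measure is complete.\<close>

lemma piecewise_continuous_bounded_measurable:
  assumes cont: "\<And>K. K \<in> \<T> \<Longrightarrow> continuous_on UNIV (p K)"
    and eq: "\<And>K. K \<in> \<T> \<Longrightarrow> AE x in lebesgue. x \<in> interior K \<longrightarrow> f x = (p K x :: real)"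
  shows "f \<in> bounded_measurable \<Omega>"
proof -
  let ?g = "\<lambda>x. \<Sum>K\<in>\<T>. indicator (interior K) x * p K x"
  have g: "?g x = p K x" if "K \<in> \<T>" "x \<in> interior K" for K x
  proof -
    have "?g x = (\<Sum>K\<in>\<T>. if x \<in> interior K then p K x else 0)"
      by (intro sum.cong) (auto simp: indicator_def)
    then show ?thesis using sum_interior[OF that, of "\<lambda>K. p K x"] by simp
  qed
  have "AE x in lebesgue. \<forall>K\<in>\<T>. x \<in> interior K \<longrightarrow> f x = p K x"
    using eq by (intro AE_finite_allI) auto
  with skeleton_null have fg: "AE x in lebesgue. x \<in> \<Omega> \<longrightarrow> ?g x = f x"
  proof eventually_elim
    case (elim x)
    show ?case
    proof
      assume "x \<in> \<Omega>"
      then obtain K where K: "K \<in> \<T>" "x \<in> interior K" using elim(1) off_skeleton(1) by blast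
      then show "?g x = f x" using g[OF K] elim(2) by simp
    qed
  qed
  have gm: "?g \<in> borel_measurable lebesgue"
  proof (intro borel_measurable_sum borel_measurable_times)
    show "p K \<in> borel_measurable lebesgue" if "K \<in> \<T>" for K
      using cont[OF that] by (intro measurable_completion) (simp add: borel_measurable_continuous_onI)
    show "indicator (interior K) \<in> borel_measurable lebesgue" for K
      by (intro measurable_completion) simp
  qed
  have "(\<lambda>x. indicator \<Omega> x * ?g x) \<in> borel_measurable lebesgue"
    using gm by (intro borel_measurable_times borel_measurable_indicator domain_lebesgue)
  then have "(\<lambda>x. indicator \<Omega> x * f x) \<in> borel_measurable lebesgue"
    by (rule borel_measurable_AE) (use fg in \<open>eventually_elim, simp add: indicator_def\<close>)
  then have "f \<in> borel_measurable (lebesgue_on \<Omega>)"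
    by (simp add: borel_measurable_lebesgue_on_iff)
  moreover have "\<exists>B. \<forall>K\<in>\<T>. \<forall>x\<in>K. \<bar>p K x\<bar> \<le> B"
  proof -
    have "bounded (\<Union>K\<in>\<T>. p K ` K)"
      using triangle_compact_convex(1) cont
      by (intro bounded_UN) (auto intro!: compact_imp_bounded compact_continuous_image intro: continuous_on_subset)
    then show ?thesis unfolding bounded_iff by fastforce
  qed
  then obtain B where B: "\<And>K x. \<lbrakk>K \<in> \<T>; x \<in> K\<rbrakk> \<Longrightarrow> \<bar>p K x\<bar> \<le> B" by blast
  have "AE x in lebesgue. x \<in> \<Omega> \<longrightarrow> \<bar>f x\<bar> \<le> B"
    using skeleton_null fg
  proof eventually_elim
    case (elim x)
    show ?case
    proof
      assume x: "x \<in> \<Omega>"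
      then obtain K where K: "K \<in> \<T>" "x \<in> interior K" using elim off_skeleton(1) by blast
      then have "x \<in> K" using interior_subset by blast
      then show "\<bar>f x\<bar> \<le> B" using B[of K x] K elim(2) x g[OF K] by simp
    qed
  qed
  then have "AE x in lebesgue_on \<Omega>. \<bar>f x\<bar> \<le> B" by (simp add: AE_lebesgue_on_iff)
  ultimately show ?thesis by (auto simp: bounded_measurable_def)
qed

lemma sum_integral_triangles:
  assumes F: "F \<in> bounded_measurable \<Omega>"
  shows "(\<Sum>K\<in>\<T>. \<integral>x. F x \<partial>lebesgue_on K) = (\<integral>x. F x \<partial>lebesgue_on \<Omega>)"
proof -
  \<comment> \<open>Closed triangles contain boundary points of the domain, where \<open>F\<close>
    is not controlled; cutting it off changes the integrals only on the skeleton.\<close>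
  let ?G = "\<lambda>x. indicator \<Omega> x * F x"
  have G: "integrable lebesgue ?G"
    using bounded_measurable_integrable[OF domain_lmeasurable F] by (simp add: integrable_lebesgue_on_iff)
  have int: "integrable lebesgue (\<lambda>x. indicator K x * ?G x)" if "K \<in> \<T>" for K
    using integrable_mult_indicator[OF triangle_lebesgue[OF that] G] by simp
  have "(\<integral>x. F x \<partial>lebesgue_on K) = (\<integral>x. indicator K x * ?G x \<partial>lebesgue)" if K: "K \<in> \<T>" for K
  proof -
    have ae: "AE x in lebesgue. indicator K x * ?G x = indicator K x * F x"
      using skeleton_null by eventually_elim (use K off_skeleton(2) in \<open>auto simp: indicator_def\<close>)
    have m: "(\<lambda>x. indicator K x * ?G x) \<in> borel_measurable lebesgue" using int[OF K] by simp
    have "(\<integral>x. indicator K x * ?G x \<partial>lebesgue) = (\<integral>x. indicator K x * F x \<partial>lebesgue)"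
      by (rule integral_cong_AE[OF m borel_measurable_AE[OF m ae] ae])
    then show ?thesis by (simp add: integral_lebesgue_on[OF triangle_lebesgue[OF K]])
  qed
  then have "(\<Sum>K\<in>\<T>. \<integral>x. F x \<partial>lebesgue_on K) = (\<Sum>K\<in>\<T>. \<integral>x. indicator K x * ?G x \<partial>lebesgue)" by simp
  also have "\<dots> = (\<integral>x. (\<Sum>K\<in>\<T>. indicator K x * ?G x) \<partial>lebesgue)"
    by (rule Bochner_Integration.integral_sum[symmetric]) (use int in auto)
  also have "\<dots> = (\<integral>x. ?G x \<partial>lebesgue)"
  proof (rule integral_cong_AE)
    show "AE x in lebesgue. (\<Sum>K\<in>\<T>. indicator K x * ?G x) = ?G x"
      using skeleton_null
    proof eventually_elim
      case (elim x)
      show ?case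
      proof (cases "x \<in> \<Omega>")
        case True
        then obtain K where K: "K \<in> \<T>" "x \<in> interior K" using elim off_skeleton(1) by blast
        have "(\<Sum>K\<in>\<T>. indicator K x * ?G x) = (\<Sum>K\<in>\<T>. if x \<in> interior K then ?G x else 0)"
          using off_skeleton(2)[OF elim] interior_subset by (intro sum.cong) (auto simp: indicator_def)
        then show ?thesis using sum_interior[OF K, of "\<lambda>K. ?G x"] by simp
      qed simp
    qed
    show "(\<lambda>x. \<Sum>K\<in>\<T>. indicator K x * ?G x) \<in> borel_measurable lebesgue"
      by (intro borel_measurable_sum borel_measurable_integrable int)
  qed (use G in auto)
  finally show ?thesis by (simp add: integral_lebesgue_on)
qed

text \<open>The body of \<open>morley\<close> with the pieces \<open>p\<close> made explicit, so
  that linear combinations can be formed of the pieces as well.\<close>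

definition represents :: "(real^2 \<Rightarrow> real) \<Rightarrow> ((real^2) set \<Rightarrow> real^2 \<Rightarrow> real) \<Rightarrow> bool" where
  "represents \<phi> p \<longleftrightarrow>
     (\<forall>K\<in>\<T>. quadratic_polynomial (p K) \<and> (\<forall>x\<in>interior K. \<phi> x = p K x)) \<and>
     (\<forall>K\<in>\<T>. \<forall>K'\<in>\<T>. \<forall>z\<in>\<Omega>. z extreme_point_of K \<and> z extreme_point_of K' \<longrightarrow> p K z = p K' z) \<and>
     (\<forall>K\<in>\<T>. \<forall>z\<in>frontier \<Omega>. z extreme_point_of K \<longrightarrow> p K z = 0) \<and>
     (\<forall>K\<in>\<T>. \<forall>K'\<in>\<T>. \<forall>a b \<nu>.
        closed_segment a b edge_of K \<and> closed_segment a b edge_of K' \<and>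
        norm \<nu> = 1 \<and> orthogonal \<nu> (b - a) \<longrightarrow>
        frechet_derivative (p K) (at (midpoint a b)) \<nu> =
        frechet_derivative (p K') (at (midpoint a b)) \<nu>) \<and>
     (\<forall>K\<in>\<T>. \<forall>a b \<nu>.
        closed_segment a b edge_of K \<and> closed_segment a b \<subseteq> frontier \<Omega> \<and>
        norm \<nu> = 1 \<and> orthogonal \<nu> (b - a) \<longrightarrow>
        frechet_derivative (p K) (at (midpoint a b)) \<nu> = 0)"

lemmas representsD = represents_def[THEN iffD1, THEN conjunct1, rule_format]
  represents_def[THEN iffD1, THEN conjunct2, THEN conjunct1, rule_format]
  represents_def[THEN iffD1, THEN conjunct2, THEN conjunct2, THEN conjunct1, rule_format]
  represents_def[THEN iffD1, THEN conjunct2, THEN conjunct2, THEN conjunct2, THEN conjunct1, rule_format]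
  represents_def[THEN iffD1, THEN conjunct2, THEN conjunct2, THEN conjunct2, THEN conjunct2, rule_format]

lemma morley_iff_represents: "\<phi> \<in> morley \<Omega> \<T> \<longleftrightarrow> (\<exists>p. represents \<phi> p)"
  by (simp add: morley_def represents_def)

lemma morley_function_space: "function_space (morley \<Omega> \<T>)"
proof
  have "quadratic_polynomial (\<lambda>x. 0)"
    unfolding quadratic_polynomial_def by (intro exI[of _ 0]) simp
  then have "represents (\<lambda>x. 0) (\<lambda>K x. 0)" by (simp add: represents_def)
  then show "(\<lambda>x. 0) \<in> morley \<Omega> \<T>" unfolding morley_iff_represents by blast
next
  fix \<phi> \<psi> \<alpha> \<beta> assume "\<phi> \<in> morley \<Omega> \<T>" "\<psi> \<in> morley \<Omega> \<T>"
  then obtain p q where p: "represents \<phi> p" and q: "represents \<psi> q"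
    by (auto simp: morley_iff_represents)
  have fd: "frechet_derivative (\<lambda>x. \<alpha> * p K x + \<beta> * q K x) (at x) h
      = \<alpha> * frechet_derivative (p K) (at x) h + \<beta> * frechet_derivative (q K) (at x) h" if "K \<in> \<T>" for K x h
    using p q that
    by (intro frechet_derivative_lin quadratic_polynomial_differentiable) (auto simp: represents_def)
  have "represents (\<lambda>x. \<alpha> * \<phi> x + \<beta> * \<psi> x) (\<lambda>K x. \<alpha> * p K x + \<beta> * q K x)"
    unfolding represents_def
  proof (intro conjI ballI allI impI)
    show "quadratic_polynomial (\<lambda>x. \<alpha> * p K x + \<beta> * q K x)" if "K \<in> \<T>" for K
      using p q that by (intro quadratic_polynomial_lin) (auto simp: represents_def)
  next
    fix K x assume "K \<in> \<T>" "x \<in> interior K"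
    then have "\<phi> x = p K x" "\<psi> x = q K x" using p q by (auto simp: represents_def)
    then show "\<alpha> * \<phi> x + \<beta> * \<psi> x = \<alpha> * p K x + \<beta> * q K x" by simp
  next
    fix K K' z assume K: "K \<in> \<T>" "K' \<in> \<T>" "z \<in> \<Omega>" "z extreme_point_of K \<and> z extreme_point_of K'"
    show "\<alpha> * p K z + \<beta> * q K z = \<alpha> * p K' z + \<beta> * q K' z"
      by (simp only: representsD(2)[OF p K] representsD(2)[OF q K])
  next
    fix K z assume K: "K \<in> \<T>" "z \<in> frontier \<Omega>" "z extreme_point_of K"
    show "\<alpha> * p K z + \<beta> * q K z = 0"
      using representsD(3)[OF p K] representsD(3)[OF q K] by simp
  next
    fix K K' a b \<nu>
    assume K: "K \<in> \<T>" "K' \<in> \<T>" and e: "closed_segment a b edge_of K \<and> closed_segment a b edge_of K' \<and>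
        norm \<nu> = 1 \<and> orthogonal \<nu> (b - a)"
    show "frechet_derivative (\<lambda>x. \<alpha> * p K x + \<beta> * q K x) (at (midpoint a b)) \<nu>
        = frechet_derivative (\<lambda>x. \<alpha> * p K' x + \<beta> * q K' x) (at (midpoint a b)) \<nu>"
      by (simp only: fd K representsD(4)[OF p K e] representsD(4)[OF q K e])
  next
    fix K a b \<nu>
    assume K: "K \<in> \<T>" and e: "closed_segment a b edge_of K \<and> closed_segment a b \<subseteq> frontier \<Omega> \<and>
        norm \<nu> = 1 \<and> orthogonal \<nu> (b - a)"
    show "frechet_derivative (\<lambda>x. \<alpha> * p K x + \<beta> * q K x) (at (midpoint a b)) \<nu> = 0"
      using representsD(5)[OF p K e] representsD(5)[OF q K e] by (simp add: fd K)
  qed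
  then show "(\<lambda>x. \<alpha> * \<phi> x + \<beta> * \<psi> x) \<in> morley \<Omega> \<T>"
    unfolding morley_iff_represents by blast
qed

sublocale M: function_space "morley \<Omega> \<T>" by (rule morley_function_space)

lemma morley_quadratic:
  assumes "\<phi> \<in> morley \<Omega> \<T>"
  obtains p where "\<And>K. K \<in> \<T> \<Longrightarrow> quadratic_polynomial (p K)"
    "\<And>K x. \<lbrakk>K \<in> \<T>; x \<in> interior K\<rbrakk> \<Longrightarrow> \<phi> x = p K x"
proof -
  obtain p where p: "represents \<phi> p" using assms morley_iff_represents by blast
  show thesis by (rule that[of p]) (use representsD(1)[OF p] in auto)
qed

lemma morley_bounded_measurable:
  assumes "\<phi> \<in> morley \<Omega> \<T>" shows "\<phi> \<in> bounded_measurable \<Omega>"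
proof -
  obtain p where "\<And>K. K \<in> \<T> \<Longrightarrow> quadratic_polynomial (p K)"
    "\<And>K x. \<lbrakk>K \<in> \<T>; x \<in> interior K\<rbrakk> \<Longrightarrow> \<phi> x = p K x"
    by (rule morley_quadratic[OF assms]) blast
  then show ?thesis
    by (intro piecewise_continuous_bounded_measurable[of p]) (auto intro: quadratic_polynomial_continuous)
qed

lemma morley_L2: "\<phi> \<in> morley \<Omega> \<T> \<Longrightarrow> \<phi> \<in> L2 \<Omega>"
  by (simp add: bounded_measurable_L2 morley_bounded_measurable)

text \<open>Besides the values of \<open>D2pw\<close>, the weak derivative statement is recorded:
  linearity is proved for it and carries over to the chosen representatives by uniqueness.\<close>

lemma D2pw_morley:
  assumes "\<phi> \<in> morley \<Omega> \<T>"
  obtains H where "\<And>K i j. K \<in> \<T> \<Longrightarrow> AE x in lebesgue. x \<in> interior K \<longrightarrow> D2pw \<T> \<phi> i j x = H K i j"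
    "\<And>K i j. K \<in> \<T> \<Longrightarrow> has_weak_deriv (interior K) [i, j] \<phi> (\<lambda>x. H K i j)"
    "\<And>K i j. K \<in> \<T> \<Longrightarrow> H K i j = H K j i"
proof -
  obtain p where p: "\<And>K. K \<in> \<T> \<Longrightarrow> quadratic_polynomial (p K)"
    "\<And>K x. \<lbrakk>K \<in> \<T>; x \<in> interior K\<rbrakk> \<Longrightarrow> \<phi> x = p K x"
    by (rule morley_quadratic[OF assms]) blast
  have "\<exists>H. (\<forall>i j. has_weak_deriv (interior K) [i, j] \<phi> (\<lambda>x. H i j)) \<and> (\<forall>i j. H i j = H j i)" if K: "K \<in> \<T>" for K
    by (rule has_weak_deriv_quadratic[OF open_interior _ p(1)[OF K] p(2)[OF K]])
      (use triangle_compact_convex(1)[OF K] in \<open>auto simp: compact_imp_bounded bounded_interior\<close>)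
  then obtain H where H: "\<And>K i j. K \<in> \<T> \<Longrightarrow> has_weak_deriv (interior K) [i, j] \<phi> (\<lambda>x. H K i j)"
    and sym: "\<And>K i j. K \<in> \<T> \<Longrightarrow> H K i j = H K j i"
    by metis
  have "AE x in lebesgue. x \<in> interior K \<longrightarrow> D2pw \<T> \<phi> i j x = H K i j" if K: "K \<in> \<T>" for K i j
    using weak_deriv_eq_AE[OF open_interior H[OF K, of i j]] K
    by (simp add: AE_lebesgue_on_iff D2pw_interior cong: conj_cong imp_cong)
  then show thesis using that H sym by blast
qed

lemma D2pw_bounded_measurable:
  assumes "\<phi> \<in> morley \<Omega> \<T>" shows "D2pw \<T> \<phi> i j \<in> bounded_measurable \<Omega>"
proof -
  obtain H where "\<And>K i j. K \<in> \<T> \<Longrightarrow> AE x in lebesgue. x \<in> interior K \<longrightarrow> D2pw \<T> \<phi> i j x = H K i j"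
    by (rule D2pw_morley[OF assms]) blast
  then show ?thesis
    by (intro piecewise_continuous_bounded_measurable[of "\<lambda>K x. H K i j"]) auto
qed

lemma AE_domain_piecewise:
  assumes "\<And>K. K \<in> \<T> \<Longrightarrow> AE x in lebesgue. x \<in> interior K \<longrightarrow> P x"
  shows "AE x in lebesgue_on \<Omega>. P x"
proof -
  have "AE x in lebesgue. \<forall>K\<in>\<T>. x \<in> interior K \<longrightarrow> P x"
    using assms by (intro AE_finite_allI) auto
  with skeleton_null have "AE x in lebesgue. x \<in> \<Omega> \<longrightarrow> P x"
    by eventually_elim (use off_skeleton(1) in blast)
  then show ?thesis by (simp add: AE_lebesgue_on_iff)
qed

lemma D2pw_sym:
  assumes "\<phi> \<in> morley \<Omega> \<T>" shows "AE x in lebesgue_on \<Omega>. D2pw \<T> \<phi> i j x = D2pw \<T> \<phi> j i x"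
proof (rule AE_domain_piecewise)
  obtain H where H: "\<And>K i j. K \<in> \<T> \<Longrightarrow> AE x in lebesgue. x \<in> interior K \<longrightarrow> D2pw \<T> \<phi> i j x = H K i j"
    and sym: "\<And>K i j. K \<in> \<T> \<Longrightarrow> H K i j = H K j i"
    by (rule D2pw_morley[OF assms]) blast
  show "AE x in lebesgue. x \<in> interior K \<longrightarrow> D2pw \<T> \<phi> i j x = D2pw \<T> \<phi> j i x" if K: "K \<in> \<T>" for K
    using H[OF K, of i j] H[OF K, of j i] by eventually_elim (use sym[OF K] in auto)
qed

lemma D2pw_lin:
  assumes \<phi>: "\<phi> \<in> morley \<Omega> \<T>" and \<psi>: "\<psi> \<in> morley \<Omega> \<T>"
  shows "AE x in lebesgue_on \<Omega>. D2pw \<T> (\<lambda>x. \<alpha> * \<phi> x + \<beta> * \<psi> x) i j x = \<alpha> * D2pw \<T> \<phi> i j x + \<beta> * D2pw \<T> \<psi> i j x"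
proof (rule AE_domain_piecewise)
  fix K assume K: "K \<in> \<T>"
  obtain H where H: "\<And>K i j. K \<in> \<T> \<Longrightarrow> AE x in lebesgue. x \<in> interior K \<longrightarrow> D2pw \<T> \<phi> i j x = H K i j"
    "\<And>K i j. K \<in> \<T> \<Longrightarrow> has_weak_deriv (interior K) [i, j] \<phi> (\<lambda>x. H K i j)"
    by (rule D2pw_morley[OF \<phi>]) blast
  obtain G where G: "\<And>K i j. K \<in> \<T> \<Longrightarrow> AE x in lebesgue. x \<in> interior K \<longrightarrow> D2pw \<T> \<psi> i j x = G K i j"
    "\<And>K i j. K \<in> \<T> \<Longrightarrow> has_weak_deriv (interior K) [i, j] \<psi> (\<lambda>x. G K i j)"
    by (rule D2pw_morley[OF \<psi>]) blast
  \<comment> \<open>Linearity of weak derivatives on one triangle presupposes square integrability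
    there, which the polynomial piece provides.\<close>
  have L2: "\<xi> \<in> L2 (interior K)" if \<xi>: "\<xi> \<in> morley \<Omega> \<T>" for \<xi>
  proof -
    obtain p where p: "quadratic_polynomial (p K)" "\<And>x. x \<in> interior K \<Longrightarrow> \<xi> x = p K x"
      by (rule morley_quadratic[OF \<xi>]) (use K in blast)
    have "p K \<in> borel_measurable lebesgue"
      using quadratic_polynomial_continuous[OF p(1)] by (intro measurable_completion) (simp add: borel_measurable_continuous_onI)
    then have pm: "p K \<in> borel_measurable (lebesgue_on (interior K))" by (rule measurable_restrict_space1)
    have "bounded (p K ` K)"
      using triangle_compact_convex(1)[OF K] quadratic_polynomial_continuous[OF p(1)]
      by (auto intro!: compact_imp_bounded compact_continuous_image intro: continuous_on_subset)
    then obtain B where "\<forall>x\<in>interior K. \<bar>p K x\<bar> \<le> B"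
      unfolding bounded_iff using interior_subset[of K] by fastforce
    then have "AE x in lebesgue_on (interior K). \<bar>p K x\<bar> \<le> B" by (simp add: AE_lebesgue_on_iff)
    then have "p K \<in> L2 (interior K)"
      using pm interior_lmeasurable[OF K] by (intro bounded_measurable_L2) (auto simp: bounded_measurable_def)
    then show ?thesis
    proof (rule L2_AE_cong)
      show "AE x in lebesgue_on (interior K). p K x = \<xi> x"
        by (simp add: AE_lebesgue_on_iff p(2))
      show "\<xi> \<in> borel_measurable (lebesgue_on (interior K))"
        by (subst measurable_lebesgue_cong[where g = "p K"]) (rule p(2), assumption, rule pm)
    qed
  qed
  have "has_weak_deriv (interior K) [i, j] (\<lambda>x. \<alpha> * \<phi> x + \<beta> * \<psi> x) (\<lambda>x. \<alpha> * H K i j + \<beta> * G K i j)"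
    by (rule has_weak_deriv_lin) (use L2 \<phi> \<psi> H G K in auto)
  then have "AE x in lebesgue. x \<in> interior K \<longrightarrow> D2pw \<T> (\<lambda>x. \<alpha> * \<phi> x + \<beta> * \<psi> x) i j x = \<alpha> * H K i j + \<beta> * G K i j"
    using weak_deriv_eq_AE[OF open_interior] K by (simp add: AE_lebesgue_on_iff D2pw_interior cong: conj_cong imp_cong)
  with H(1)[OF K, of i j] G(1)[OF K, of i j]
  show "AE x in lebesgue. x \<in> interior K \<longrightarrow>
      D2pw \<T> (\<lambda>x. \<alpha> * \<phi> x + \<beta> * \<psi> x) i j x = \<alpha> * D2pw \<T> \<phi> i j x + \<beta> * D2pw \<T> \<psi> i j x"
    by eventually_elim auto
qed

end

section \<open>The piecewise forms\<close>

context mesh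
begin

lemma D2pw_L2: "\<phi> \<in> morley \<Omega> \<T> \<Longrightarrow> D2pw \<T> \<phi> i j \<in> L2 \<Omega>"
  by (simp add: bounded_measurable_L2 D2pw_bounded_measurable)

lemma a_pw_semi_inner: "semi_inner_space (morley \<Omega> \<T>) (a_pw \<Omega> \<T>)"
  by (rule semi_inner_space_of_second_derivatives(1)
      [where D = "\<lambda>\<phi> i j. D2pw \<T> \<phi> i j" and S = \<Omega>, OF morley_function_space _ _ a_pw_def])
    (auto intro: D2pw_L2 D2pw_lin)

lemma a_pw_eq_sum:
  assumes "\<phi> \<in> morley \<Omega> \<T>" "\<psi> \<in> morley \<Omega> \<T>"
  shows "a_pw \<Omega> \<T> \<phi> \<psi> = (\<Sum>i\<in>UNIV. \<Sum>j\<in>UNIV. l2_inner \<Omega> (D2pw \<T> \<phi> i j) (D2pw \<T> \<psi> i j))"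
  by (rule semi_inner_space_of_second_derivatives(2)
      [where D = "\<lambda>\<phi> i j. D2pw \<T> \<phi> i j" and S = \<Omega>, OF morley_function_space _ _ a_pw_def])
    (use assms in \<open>auto intro: D2pw_L2 D2pw_lin\<close>)

sublocale M: semi_inner_space "morley \<Omega> \<T>" "a_pw \<Omega> \<T>" by (rule a_pw_semi_inner)

lemma norm_pw_eq_nrm: "norm_pw \<Omega> \<T> = M.nrm"
  by (simp add: fun_eq_iff norm_pw_def M.nrm_def)

text \<open>The L2 coordinate of a Hessian entry along the normalised indicator function of a
  triangle. As the entries are piecewise constant, these coordinates determine their norm.\<close>

definition triangle_coord :: "(real^2) set \<Rightarrow> 2 \<Rightarrow> 2 \<Rightarrow> (real^2 \<Rightarrow> real) \<Rightarrow> real" where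
  "triangle_coord K i j \<phi> =
    l2_inner \<Omega> (D2pw \<T> \<phi> i j) (indicator (interior K)) / sqrt (measure lebesgue (interior K))"

lemma indicator_interior_L2: "indicator (interior K) \<in> L2 \<Omega>"
proof (rule bounded_measurable_L2[OF domain_lmeasurable])
  have "indicator (interior K) \<in> borel_measurable (lebesgue :: (real^2) measure)"
    by (intro measurable_completion) simp
  then have "indicator (interior K) \<in> borel_measurable (lebesgue_on \<Omega>)" by (rule measurable_restrict_space1)
  moreover have "AE x in lebesgue_on \<Omega>. \<bar>indicator (interior K) x :: real\<bar> \<le> 1" by (simp add: indicator_def)
  ultimately show "indicator (interior K) \<in> bounded_measurable \<Omega>" by (auto simp: bounded_measurable_def)
qed

lemma triangle_coord_linear: "linear_on (morley \<Omega> \<T>) (triangle_coord K i j)"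
  unfolding linear_on_def
proof (intro ballI allI)
  fix \<phi> \<psi> \<alpha> \<beta> assume \<phi>: "\<phi> \<in> morley \<Omega> \<T>" and \<psi>: "\<psi> \<in> morley \<Omega> \<T>"
  have "l2_inner \<Omega> (D2pw \<T> (\<lambda>x. \<alpha> * \<phi> x + \<beta> * \<psi> x) i j) (indicator (interior K))
      = l2_inner \<Omega> (\<lambda>x. \<alpha> * D2pw \<T> \<phi> i j x + \<beta> * D2pw \<T> \<psi> i j x) (indicator (interior K))"
    using D2pw_lin[OF \<phi> \<psi>] D2pw_L2 M.lin_mem \<phi> \<psi>
    by (intro l2_inner_cong_AE) (auto intro: indicator_interior_L2 L2.lin_mem)
  then show "triangle_coord K i j (\<lambda>x. \<alpha> * \<phi> x + \<beta> * \<psi> x)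
      = \<alpha> * triangle_coord K i j \<phi> + \<beta> * triangle_coord K i j \<psi>"
    using D2pw_L2 \<phi> \<psi> indicator_interior_L2
    by (simp add: triangle_coord_def L2.left_simps add_divide_distrib)
qed

text \<open>Parseval's identity: on a triangle the entry is a constant, the coordinate is this
  constant times the root of the area, and both sides add up the squared constants weighted by
  areas.\<close>

lemma l2_inner_D2pw_eq_coord:
  assumes \<phi>: "\<phi> \<in> morley \<Omega> \<T>"
  shows "l2_inner \<Omega> (D2pw \<T> \<phi> i j) (D2pw \<T> \<phi> i j) = (\<Sum>K\<in>\<T>. (triangle_coord K i j \<phi>)\<^sup>2)"
proof -
  obtain H where H: "\<And>K i j. K \<in> \<T> \<Longrightarrow> AE x in lebesgue. x \<in> interior K \<longrightarrow> D2pw \<T> \<phi> i j x = H K i j"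
    by (rule D2pw_morley[OF \<phi>]) blast
  let ?\<mu> = "\<lambda>K. measure lebesgue (interior K)"
  have bm: "D2pw \<T> \<phi> i j \<in> bounded_measurable \<Omega>" by (rule D2pw_bounded_measurable[OF \<phi>])
  have const: "(\<integral>x. c * indicator (interior K) x \<partial>lebesgue) = c * ?\<mu> K" for c :: real and K
    by simp
  have cm: "(\<lambda>x. c * indicator (interior K) x :: real) \<in> borel_measurable lebesgue" for c K
    by (intro borel_measurable_times measurable_completion) auto
  have "triangle_coord K i j \<phi> = H K i j * sqrt (?\<mu> K)" if K: "K \<in> \<T>" for K
  proof -
    have ae: "AE x in lebesgue. H K i j * indicator (interior K) x
        = indicator \<Omega> x * (D2pw \<T> \<phi> i j x * indicator (interior K) x)"
      using skeleton_null H[OF K, of i j]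
    proof eventually_elim
      case (elim x)
      then show ?case using off_skeleton(2)[OF elim(1) K] interior_subset[of K] by (auto simp: indicator_def)
    qed
    have "l2_inner \<Omega> (D2pw \<T> \<phi> i j) (indicator (interior K))
        = (\<integral>x. indicator \<Omega> x * (D2pw \<T> \<phi> i j x * indicator (interior K) x) \<partial>lebesgue)"
      by (simp only: l2_inner_def integral_lebesgue_on[OF domain_lebesgue])
    also have "\<dots> = (\<integral>x. H K i j * indicator (interior K) x \<partial>lebesgue)"
      by (rule integral_cong_AE[OF cm borel_measurable_AE[OF cm ae] ae, symmetric])
    also have "\<dots> = H K i j * ?\<mu> K" by (rule const)
    finally have "l2_inner \<Omega> (D2pw \<T> \<phi> i j) (indicator (interior K)) = H K i j * ?\<mu> K" .
    moreover have "H K i j * m / sqrt m = H K i j * sqrt m" if "m \<ge> 0" for m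
      using that by (cases "m = 0") (simp_all add: field_simps)
    ultimately show ?thesis by (simp add: triangle_coord_def)
  qed
  then have coord: "(triangle_coord K i j \<phi>)\<^sup>2 = (H K i j)\<^sup>2 * ?\<mu> K" if "K \<in> \<T>" for K
    using that by (simp add: power_mult_distrib)
  have "l2_inner \<Omega> (D2pw \<T> \<phi> i j) (D2pw \<T> \<phi> i j) = (\<Sum>K\<in>\<T>. \<integral>x. D2pw \<T> \<phi> i j x * D2pw \<T> \<phi> i j x \<partial>lebesgue_on K)"
    unfolding l2_inner_def by (rule sum_integral_triangles[symmetric]) (intro bounded_measurable_intros bm)
  also have "\<dots> = (\<Sum>K\<in>\<T>. (H K i j)\<^sup>2 * ?\<mu> K)"
  proof (rule sum.cong[OF refl])
    fix K assume K: "K \<in> \<T>"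
    have ae: "AE x in lebesgue. (H K i j)\<^sup>2 * indicator (interior K) x
        = indicator K x * (D2pw \<T> \<phi> i j x * D2pw \<T> \<phi> i j x)"
      using skeleton_null H[OF K, of i j]
    proof eventually_elim
      case (elim x)
      then show ?case using off_skeleton(2)[OF elim(1) K] interior_subset[of K] by (auto simp: indicator_def power2_eq_square)
    qed
    have "(\<integral>x. D2pw \<T> \<phi> i j x * D2pw \<T> \<phi> i j x \<partial>lebesgue_on K)
        = (\<integral>x. indicator K x * (D2pw \<T> \<phi> i j x * D2pw \<T> \<phi> i j x) \<partial>lebesgue)"
      by (rule integral_lebesgue_on[OF triangle_lebesgue[OF K]])
    also have "\<dots> = (\<integral>x. (H K i j)\<^sup>2 * indicator (interior K) x \<partial>lebesgue)"
      by (rule integral_cong_AE[OF cm borel_measurable_AE[OF cm ae] ae, symmetric])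
    finally show "(\<integral>x. D2pw \<T> \<phi> i j x * D2pw \<T> \<phi> i j x \<partial>lebesgue_on K) = (H K i j)\<^sup>2 * ?\<mu> K"
      by (simp only: const)
  qed
  finally show ?thesis using coord by simp
qed

lemma a_pw_eq_coord:
  assumes "\<phi> \<in> morley \<Omega> \<T>"
  shows "a_pw \<Omega> \<T> \<phi> \<phi> = (\<Sum>i\<in>UNIV. \<Sum>j\<in>UNIV. \<Sum>K\<in>\<T>. (triangle_coord K i j \<phi>)\<^sup>2)"
  using assms by (simp add: a_pw_eq_sum l2_inner_D2pw_eq_coord)

text \<open>Summing Bessel's inequality for the \<open>4 |\<T>|\<close> entries of the piecewise Hessian bounds the size of
  an orthonormal family.\<close>

lemma morley_finite_rank: "finite_rank_space (morley \<Omega> \<T>) (a_pw \<Omega> \<T>)"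
proof
  have "n \<le> 4 * card \<T>" if e: "M.orthonormal n e" for n e
  proof -
    have eV: "e l \<in> morley \<Omega> \<T>" and ee: "a_pw \<Omega> \<T> (e l) (e l) = 1" if "l < n" for l
      using e that by (auto simp: M.orthonormal_def)
    have "(\<Sum>l<n. (triangle_coord K i j (e l))\<^sup>2) \<le> 1" if K: "K \<in> \<T>" for K i j
    proof (rule M.Bessel_functional[OF e triangle_coord_linear])
      fix \<phi> assume "\<phi> \<in> morley \<Omega> \<T>"
      then show "(triangle_coord K i j \<phi>)\<^sup>2 \<le> a_pw \<Omega> \<T> \<phi> \<phi>"
        unfolding a_pw_eq_coord[OF \<open>\<phi> \<in> morley \<Omega> \<T>\<close>]
        using K by (intro order_trans[OF _ member_le_sum[of i]] order_trans[OF _ member_le_sum[of j]]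
            order_trans[OF _ member_le_sum[of K]]) (auto intro!: sum_nonneg)
    qed
    then have le: "(\<Sum>K\<in>\<T>. \<Sum>l<n. (triangle_coord K i j (e l))\<^sup>2) \<le> real (card \<T>)" for i j
      using sum_bounded_above[of \<T> "\<lambda>K. \<Sum>l<n. (triangle_coord K i j (e l))\<^sup>2" 1] by simp
    have "real n = (\<Sum>l<n. a_pw \<Omega> \<T> (e l) (e l))" using ee by simp
    also have "\<dots> = (\<Sum>l<n. \<Sum>i\<in>UNIV. \<Sum>j\<in>UNIV. \<Sum>K\<in>\<T>. (triangle_coord K i j (e l))\<^sup>2)"
      using eV by (simp add: a_pw_eq_coord)
    also have "\<dots> = (\<Sum>i\<in>UNIV. \<Sum>j\<in>UNIV. \<Sum>K\<in>\<T>. \<Sum>l<n. (triangle_coord K i j (e l))\<^sup>2)"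
      by (subst sum.swap, intro sum.cong refl, subst sum.swap, intro sum.cong refl, subst sum.swap) (rule refl)
    also have "\<dots> \<le> (\<Sum>i\<in>(UNIV::2 set). \<Sum>j\<in>(UNIV::2 set). real (card \<T>))"
      by (intro sum_mono le)
    finally show ?thesis by simp
  qed
  then show "\<exists>D. \<forall>n e. M.orthonormal n e \<longrightarrow> n \<le> D" by blast
qed

section \<open>The bracket and the trilinear form\<close>

lemma bracket_bounded_measurable:
  "\<lbrakk>\<phi> \<in> morley \<Omega> \<T>; \<xi> \<in> morley \<Omega> \<T>\<rbrakk> \<Longrightarrow> bracket_pw \<T> \<phi> \<xi> \<in> bounded_measurable \<Omega>"
  unfolding bracket_pw_def[abs_def] by (intro bounded_measurable_intros D2pw_bounded_measurable)

lemma b_pw_eq: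
  assumes "\<phi> \<in> morley \<Omega> \<T>" "\<xi> \<in> morley \<Omega> \<T>" "\<psi> \<in> morley \<Omega> \<T>"
  shows "b_pw \<T> \<phi> \<xi> \<psi> = - l2_inner \<Omega> (bracket_pw \<T> \<phi> \<xi>) \<psi>"
  unfolding b_pw_def l2_inner_def
  by (subst sum_integral_triangles)
    (use assms in \<open>simp_all add: bounded_measurable_times bracket_bounded_measurable morley_bounded_measurable\<close>)

lemma bracket_L2: "\<lbrakk>\<phi> \<in> morley \<Omega> \<T>; \<xi> \<in> morley \<Omega> \<T>\<rbrakk> \<Longrightarrow> bracket_pw \<T> \<phi> \<xi> \<in> L2 \<Omega>"
  by (simp add: bounded_measurable_L2 bracket_bounded_measurable)

lemma b_pw_sym: "b_pw \<T> \<phi> \<xi> \<psi> = b_pw \<T> \<xi> \<phi> \<psi>"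
  by (simp add: b_pw_def bracket_pw_def algebra_simps)

lemma b_pw_linear_right:
  assumes "\<phi> \<in> morley \<Omega> \<T>" "\<xi> \<in> morley \<Omega> \<T>"
  shows "linear_on (morley \<Omega> \<T>) (b_pw \<T> \<phi> \<xi>)"
  using assms L2.lin_right[OF bracket_L2[OF assms]]
  by (simp add: linear_on_def b_pw_eq M.lin_mem morley_L2)

lemma b_pw_linear_left:
  assumes \<xi>: "\<xi> \<in> morley \<Omega> \<T>" and \<psi>: "\<psi> \<in> morley \<Omega> \<T>"
  shows "linear_on (morley \<Omega> \<T>) (\<lambda>\<phi>. b_pw \<T> \<phi> \<xi> \<psi>)"
  unfolding linear_on_def
proof (intro ballI allI)
  fix \<phi> \<phi>' \<alpha> \<beta> assume \<phi>: "\<phi> \<in> morley \<Omega> \<T>" and \<phi>': "\<phi>' \<in> morley \<Omega> \<T>"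
  let ?s = "\<lambda>x. \<alpha> * \<phi> x + \<beta> * \<phi>' x"
  have s: "?s \<in> morley \<Omega> \<T>" using \<phi> \<phi>' by (rule M.lin_mem)
  have "AE x in lebesgue_on \<Omega>. bracket_pw \<T> ?s \<xi> x = \<alpha> * bracket_pw \<T> \<phi> \<xi> x + \<beta> * bracket_pw \<T> \<phi>' \<xi> x"
    using D2pw_lin[OF \<phi> \<phi>', of \<alpha> \<beta> 1 1] D2pw_lin[OF \<phi> \<phi>', of \<alpha> \<beta> 1 2] D2pw_lin[OF \<phi> \<phi>', of \<alpha> \<beta> 2 2]
    by eventually_elim (simp add: bracket_pw_def algebra_simps)
  then have "l2_inner \<Omega> (bracket_pw \<T> ?s \<xi>) \<psi>
      = l2_inner \<Omega> (\<lambda>x. \<alpha> * bracket_pw \<T> \<phi> \<xi> x + \<beta> * bracket_pw \<T> \<phi>' \<xi> x) \<psi>"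
    using s \<phi> \<phi>' \<xi> \<psi> by (intro l2_inner_cong_AE) (auto intro: bracket_L2 morley_L2 L2.lin_mem)
  then show "b_pw \<T> ?s \<xi> \<psi> = \<alpha> * b_pw \<T> \<phi> \<xi> \<psi> + \<beta> * b_pw \<T> \<phi>' \<xi> \<psi>"
    using s \<phi> \<phi>' \<xi> \<psi> by (simp add: b_pw_eq L2.left_simps bracket_L2 morley_L2)
qed

text \<open>The pointwise Frobenius norm of the piecewise Hessian; its L2 norm is
  \<open>norm_pw\<close>.\<close>

definition hessian_norm :: "(real^2 \<Rightarrow> real) \<Rightarrow> real^2 \<Rightarrow> real" where
  "hessian_norm \<phi> x = sqrt (\<Sum>i\<in>UNIV. \<Sum>j\<in>UNIV. (D2pw \<T> \<phi> i j x)\<^sup>2)"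

lemma hessian_norm_L2:
  assumes "\<phi> \<in> morley \<Omega> \<T>"
  shows "hessian_norm \<phi> \<in> L2 \<Omega>" "l2_inner \<Omega> (hessian_norm \<phi>) (hessian_norm \<phi>) = a_pw \<Omega> \<T> \<phi> \<phi>"
proof -
  have sq: "hessian_norm \<phi> x * hessian_norm \<phi> x = (\<Sum>i\<in>UNIV. \<Sum>j\<in>UNIV. D2pw \<T> \<phi> i j x * D2pw \<T> \<phi> i j x)" for x
    by (simp add: hessian_norm_def sum_nonneg flip: power2_eq_square)
  have "(\<lambda>x. hessian_norm \<phi> x * hessian_norm \<phi> x) \<in> bounded_measurable \<Omega>"
    unfolding sq by (intro bounded_measurable_intros D2pw_bounded_measurable assms)
  then have "integrable (lebesgue_on \<Omega>) (\<lambda>x. (hessian_norm \<phi> x)\<^sup>2)"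
    using bounded_measurable_integrable[OF domain_lmeasurable] by (simp add: power2_eq_square)
  moreover have "hessian_norm \<phi> \<in> borel_measurable (lebesgue_on \<Omega>)"
  proof -
    have "D2pw \<T> \<phi> i j \<in> borel_measurable (lebesgue_on \<Omega>)" for i j
      using D2pw_L2[OF assms] by (simp add: L2_def)
    then show ?thesis
      unfolding hessian_norm_def[abs_def]
      by (intro borel_measurable_continuous_on[of sqrt] continuous_on_real_sqrt continuous_on_id
          borel_measurable_sum borel_measurable_power)
  qed
  ultimately show "hessian_norm \<phi> \<in> L2 \<Omega>" by (simp add: L2_def)
  show "l2_inner \<Omega> (hessian_norm \<phi>) (hessian_norm \<phi>) = a_pw \<Omega> \<T> \<phi> \<phi>"
    by (simp only: l2_inner_def a_pw_def sq)
qed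

text \<open>In the plane the bracket is the Frobenius product of one Hessian with the cofactor
  matrix of the other, and passing to cofactors preserves the Frobenius norm. This is why no factor
  besides \<open>C\<close> appears in the bound of \<open>b_pw\<close>. Symmetry of the Hessians
  lets the single mixed entry stand for both.\<close>

lemma bracket_le_hessian_norm:
  assumes "\<phi> \<in> morley \<Omega> \<T>" "\<xi> \<in> morley \<Omega> \<T>"
  shows "AE x in lebesgue_on \<Omega>. \<bar>bracket_pw \<T> \<phi> \<xi> x\<bar> \<le> hessian_norm \<phi> x * hessian_norm \<xi> x"
  using D2pw_sym[OF assms(1), of 2 1] D2pw_sym[OF assms(2), of 2 1]
proof eventually_elim
  case (elim x)
  have cs: "\<bar>a * c' + c * a' - 2 * (b * b')\<bar> \<le> sqrt (a\<^sup>2 + b\<^sup>2 + (b\<^sup>2 + c\<^sup>2)) * sqrt (a'\<^sup>2 + b'\<^sup>2 + (b'\<^sup>2 + c'\<^sup>2))"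
    for a b c a' b' c' :: real
  proof -
    \<comment> \<open>Lagrange's identity for the vectors (a, b, b, c) and (c', -b', -b',
      a').\<close>
    have "0 \<le> (a * a' - c * c')\<^sup>2 + 2 * (a * b' + b * c')\<^sup>2 + 2 * (c * b' + b * a')\<^sup>2" by simp
    also have "\<dots> = (a\<^sup>2 + b\<^sup>2 + (b\<^sup>2 + c\<^sup>2)) * (a'\<^sup>2 + b'\<^sup>2 + (b'\<^sup>2 + c'\<^sup>2)) - (a * c' + c * a' - 2 * (b * b'))\<^sup>2"
      by (simp add: power2_eq_square algebra_simps)
    finally have "sqrt ((a * c' + c * a' - 2 * (b * b'))\<^sup>2) \<le> sqrt ((a\<^sup>2 + b\<^sup>2 + (b\<^sup>2 + c\<^sup>2)) * (a'\<^sup>2 + b'\<^sup>2 + (b'\<^sup>2 + c'\<^sup>2)))"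
      by (intro real_sqrt_le_mono) simp
    then show ?thesis by (simp only: real_sqrt_abs real_sqrt_mult)
  qed
  show ?case
    unfolding bracket_pw_def hessian_norm_def UNIV_2 using elim cs
    by (simp add: sum.insert)
qed

end

section \<open>Consequences of the discrete Sobolev inequality\<close>

locale sobolev_mesh = mesh +
  fixes C :: real
  assumes sobolev: "discrete_sobolev_constant \<Omega> \<T> C"
begin

lemma C_pos: "C > 0"
  using sobolev by (simp add: discrete_sobolev_constant_def)

text \<open>Makes a Morley function \<phi> an element 0 + \<phi> of the sum space in which the
  Sobolev inequality is formulated.\<close>

lemma zero_H20: "(\<lambda>x. 0) \<in> H20 \<Omega>"
proof -
  have H2: "(\<lambda>x. 0) \<in> H2 \<Omega>" using has_weak_deriv_zero L2.zero_mem by (auto simp: H2_def)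
  have "(\<lambda>x. 0) \<in> test_functions \<Omega>" by (simp add: test_functions_def smooth_zero)
  moreover have "l2_norm \<Omega> (weak_deriv \<Omega> is (\<lambda>x. 0)) = 0" for "is"
  proof -
    have ae: "AE x in lebesgue_on \<Omega>. weak_deriv \<Omega> is (\<lambda>x. 0) x = 0"
      by (rule weak_deriv_eq_AE[OF open_domain has_weak_deriv_zero])
    have "weak_deriv \<Omega> is (\<lambda>x. 0) \<in> L2 \<Omega>"
      using weak_deriv_works[OF has_weak_deriv_zero] by (simp add: has_weak_deriv_def)
    then have "l2_inner \<Omega> (weak_deriv \<Omega> is (\<lambda>x. 0)) (weak_deriv \<Omega> is (\<lambda>x. 0)) = l2_inner \<Omega> (\<lambda>x. 0) (\<lambda>x. 0)"
      using ae L2.zero_mem by (intro l2_inner_cong_AE) auto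
    then show ?thesis by (simp add: l2_norm_def l2_inner_def)
  qed
  then have "H2_norm \<Omega> (\<lambda>x. 0) = 0"
    by (simp add: H2_norm_def l2_norm_def[of \<Omega> "\<lambda>x. 0"] l2_inner_def)
  ultimately show ?thesis using H2 by (auto simp: H20_def intro!: bexI[of _ "\<lambda>x. 0"])
qed

lemma morley_sobolev:
  assumes "\<phi> \<in> morley \<Omega> \<T>"
  shows "AE x in lebesgue_on \<Omega>. \<bar>\<phi> x\<bar> \<le> C * norm_pw \<Omega> \<T> \<phi>"
proof -
  have "(\<lambda>x. 0 + \<phi> x) \<in> H20_plus_morley \<Omega> \<T>"
    unfolding H20_plus_morley_def mem_Collect_eq
    by (rule exI[of _ "\<lambda>x. 0"], rule exI[of _ \<phi>]) (simp add: zero_H20 assms)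
  then have le: "linf_norm \<Omega> \<phi> \<le> ereal (C * norm_pw \<Omega> \<T> \<phi>)"
    using sobolev by (simp add: discrete_sobolev_constant_def)
  have "AE x in lebesgue_on \<Omega>. ereal \<bar>\<phi> x\<bar> \<le> linf_norm \<Omega> \<phi>"
    unfolding linf_norm_def by (rule esssup_AE)
  then have "AE x in lebesgue_on \<Omega>. ereal \<bar>\<phi> x\<bar> \<le> ereal (C * norm_pw \<Omega> \<T> \<phi>)"
    by eventually_elim (rule order_trans[OF _ le])
  then show ?thesis by simp
qed

text \<open>Hoelder's inequality with the sup norm on the third argument and L2 norms on the two
  Hessians.\<close>

lemma b_pw_bound:
  assumes \<phi>: "\<phi> \<in> morley \<Omega> \<T>" and \<xi>: "\<xi> \<in> morley \<Omega> \<T>" and \<psi>: "\<psi> \<in> morley \<Omega> \<T>"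
  shows "\<bar>b_pw \<T> \<phi> \<xi> \<psi>\<bar> \<le> C * norm_pw \<Omega> \<T> \<phi> * norm_pw \<Omega> \<T> \<xi> * norm_pw \<Omega> \<T> \<psi>"
proof -
  let ?M = "C * norm_pw \<Omega> \<T> \<psi>"
  have M: "0 \<le> ?M" using C_pos \<psi> by (simp add: norm_pw_eq_nrm)
  have "\<bar>b_pw \<T> \<phi> \<xi> \<psi>\<bar> = \<bar>\<integral>x. bracket_pw \<T> \<phi> \<xi> x * \<psi> x \<partial>lebesgue_on \<Omega>\<bar>"
    using assms by (simp add: b_pw_eq l2_inner_def)
  also have "\<dots> \<le> (\<integral>x. ?M * (hessian_norm \<phi> x * hessian_norm \<xi> x) \<partial>lebesgue_on \<Omega>)"
  proof (rule order_trans[OF integral_abs_bound integral_mono_AE])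
    show "integrable (lebesgue_on \<Omega>) (\<lambda>x. \<bar>bracket_pw \<T> \<phi> \<xi> x * \<psi> x\<bar>)"
      using assms by (intro integrable_abs L2_times_integrable bracket_L2 morley_L2)
    show "integrable (lebesgue_on \<Omega>) (\<lambda>x. ?M * (hessian_norm \<phi> x * hessian_norm \<xi> x))"
      using assms by (intro integrable_mult_right L2_times_integrable hessian_norm_L2)
    show "AE x in lebesgue_on \<Omega>. \<bar>bracket_pw \<T> \<phi> \<xi> x * \<psi> x\<bar> \<le> ?M * (hessian_norm \<phi> x * hessian_norm \<xi> x)"
      using bracket_le_hessian_norm[OF \<phi> \<xi>] morley_sobolev[OF \<psi>]
      by eventually_elim (auto simp: abs_mult mult.commute[of ?M] intro: mult_mono')
  qed
  also have "\<dots> = ?M * l2_inner \<Omega> (hessian_norm \<phi>) (hessian_norm \<xi>)"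
    by (simp add: l2_inner_def)
  also have "\<dots> \<le> ?M * (norm_pw \<Omega> \<T> \<phi> * norm_pw \<Omega> \<T> \<xi>)"
  proof (rule mult_left_mono[OF _ M])
    have "L2.nrm \<Omega> (hessian_norm \<zeta>) = norm_pw \<Omega> \<T> \<zeta>" if "\<zeta> \<in> morley \<Omega> \<T>" for \<zeta>
      using hessian_norm_L2(2)[OF that] by (simp add: L2.nrm_def norm_pw_def)
    then show "l2_inner \<Omega> (hessian_norm \<phi>) (hessian_norm \<xi>) \<le> norm_pw \<Omega> \<T> \<phi> * norm_pw \<Omega> \<T> \<xi>"
      using L2.Cauchy_Schwarz[OF hessian_norm_L2(1)[OF \<phi>] hessian_norm_L2(1)[OF \<xi>]] \<phi> \<xi> by simp
  qed
  finally show ?thesis by (simp add: mult_ac)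
qed

lemma norm_pw_zero_imp_ae_zero:
  assumes "\<phi> \<in> morley \<Omega> \<T>" "norm_pw \<Omega> \<T> \<phi> = 0" shows "AE x in lebesgue_on \<Omega>. \<phi> x = 0"
  using morley_sobolev[OF assms(1)] assms(2) by simp

lemma l2_inner_semi_inner_morley: "semi_inner_space (morley \<Omega> \<T>) (l2_inner \<Omega>)"
proof
  show "linear_on (morley \<Omega> \<T>) (\<lambda>\<phi>. l2_inner \<Omega> \<phi> \<xi>)" if "\<xi> \<in> morley \<Omega> \<T>" for \<xi>
    using L2.lin_left[OF morley_L2[OF that]] by (simp add: linear_on_def morley_L2)
qed (auto intro: L2.sym L2.nonneg morley_L2)

sublocale vK: von_Karman_step "morley \<Omega> \<T>" "a_pw \<Omega> \<T>" "b_pw \<T>" C "l2_inner \<Omega>"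
proof (intro von_Karman_step.intro von_Karman_step_axioms.intro morley_finite_rank)
    show "linear_on (morley \<Omega> \<T>) (\<lambda>\<phi>. b_pw \<T> \<phi> \<xi> \<psi>)" if "\<xi> \<in> morley \<Omega> \<T>" "\<psi> \<in> morley \<Omega> \<T>" for \<xi> \<psi>
      using that by (rule b_pw_linear_left)
    show "b_pw \<T> \<phi> \<xi> \<psi> = b_pw \<T> \<xi> \<phi> \<psi>" for \<phi> \<xi> \<psi> by (rule b_pw_sym)
    show "linear_on (morley \<Omega> \<T>) (b_pw \<T> \<phi> \<xi>)" if "\<phi> \<in> morley \<Omega> \<T>" "\<xi> \<in> morley \<Omega> \<T>" for \<phi> \<xi>
      using that by (rule b_pw_linear_right)
    show "\<bar>b_pw \<T> \<phi> \<xi> \<psi>\<bar> \<le> C * M.nrm \<phi> * M.nrm \<xi> * M.nrm \<psi>"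
      if "\<phi> \<in> morley \<Omega> \<T>" "\<xi> \<in> morley \<Omega> \<T>" "\<psi> \<in> morley \<Omega> \<T>" for \<phi> \<xi> \<psi>
      using b_pw_bound[OF that] by (simp add: norm_pw_eq_nrm)
    show "semi_inner_space (morley \<Omega> \<T>) (l2_inner \<Omega>)" by (rule l2_inner_semi_inner_morley)
    \<comment> \<open>The Sobolev inequality ties mass to energy: a function without energy vanishes
      almost everywhere.\<close>
    show "l2_inner \<Omega> \<phi> \<phi> = 0" if "\<phi> \<in> morley \<Omega> \<T>" "M.nrm \<phi> = 0" for \<phi>
    proof -
      have "l2_inner \<Omega> \<phi> \<phi> = l2_inner \<Omega> (\<lambda>x. 0) (\<lambda>x. 0)"
        using norm_pw_zero_imp_ae_zero[of \<phi>] that morley_L2 L2.zero_mem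
        by (intro l2_inner_cong_AE) (auto simp: norm_pw_eq_nrm)
      then show ?thesis by (simp add: l2_inner_def)
    qed
qed

end

section \<open>Well-posedness of the first two time levels\<close>

text \<open>A real supremum bounds its members only if the set is bounded above, which follows from
  continuity in time on a compact interval.\<close>

lemma l2_norm_le_C_L2_norm:
  assumes f: "f \<in> C_L2 \<Omega> \<tau>" and t: "t \<in> {0..\<tau>}"
  shows "l2_norm \<Omega> (f t) \<le> C_L2_norm \<Omega> \<tau> f"
proof -
  have L2: "f s \<in> L2 \<Omega>" if "s \<in> {0..\<tau>}" for s using f that by (simp add: C_L2_def)
  have "continuous_on {0..\<tau>} (\<lambda>s. l2_norm \<Omega> (f s))"
    unfolding continuous_on_def
  proof
    fix t assume t: "t \<in> {0..\<tau>}"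
    have le: "\<bar>l2_norm \<Omega> (f s) - l2_norm \<Omega> (f t)\<bar> \<le> l2_norm \<Omega> (\<lambda>x. f s x - f t x)" if s: "s \<in> {0..\<tau>}" for s
    proof -
      have "L2.nrm \<Omega> (\<lambda>x. -1 * (f s x - f t x)) = L2.nrm \<Omega> (\<lambda>x. f s x - f t x)"
        using L2[OF s] L2[OF t] by (subst L2.nrm_scale) simp_all
      then show ?thesis
        using L2.nrm_diff_ge[OF L2[OF s] L2[OF t]] L2.nrm_diff_ge[OF L2[OF t] L2[OF s]]
        by (simp add: l2_norm_eq_nrm)
    qed
    have "((\<lambda>s. l2_norm \<Omega> (f s) - l2_norm \<Omega> (f t)) \<longlongrightarrow> 0) (at t within {0..\<tau>})"
    proof (rule Lim_null_comparison)
      show "\<forall>\<^sub>F s in at t within {0..\<tau>}. norm (l2_norm \<Omega> (f s) - l2_norm \<Omega> (f t))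
          \<le> l2_norm \<Omega> (\<lambda>x. f s x - f t x)"
        unfolding eventually_at_filter using le by (intro always_eventually) simp
      show "((\<lambda>s. l2_norm \<Omega> (\<lambda>x. f s x - f t x)) \<longlongrightarrow> 0) (at t within {0..\<tau>})"
        using f t unfolding C_L2_def by blast
    qed
    then show "((\<lambda>s. l2_norm \<Omega> (f s)) \<longlongrightarrow> l2_norm \<Omega> (f t)) (at t within {0..\<tau>})"
      by (rule LIM_zero_cancel)
  qed
  then have "bdd_above ((\<lambda>s. l2_norm \<Omega> (f s)) ` {0..\<tau>})"
    by (intro bounded_imp_bdd_above compact_imp_bounded compact_continuous_image) simp_all
  then show ?thesis unfolding C_L2_norm_def using t by (intro cSUP_upper)
qed

lemma l2_norm_half_le:
  assumes f: "f \<in> C_L2 \<Omega> k" and "k > 0"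
  shows "half (f 0) (f k) \<in> L2 \<Omega>" "l2_norm \<Omega> (half (f 0) (f k)) \<le> C_L2_norm \<Omega> k f"
proof -
  have L2: "f 0 \<in> L2 \<Omega>" "f k \<in> L2 \<Omega>" using assms by (simp_all add: C_L2_def)
  then show "half (f 0) (f k) \<in> L2 \<Omega>" by (simp add: half_def)
  have "half (f 0) (f k) = (\<lambda>x. 1/2 * (f k x + f 0 x))" by (simp add: half_def)
  then have "L2.nrm \<Omega> (half (f 0) (f k)) = 1/2 * L2.nrm \<Omega> (\<lambda>x. f k x + f 0 x)"
    using L2 by (simp add: L2.nrm_scale[of _ _ "1/2", simplified])
  also have "\<dots> \<le> 1/2 * (L2.nrm \<Omega> (f k) + L2.nrm \<Omega> (f 0))"
    using L2.nrm_triangle[OF L2(2,1)] by simp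
  also have "\<dots> \<le> C_L2_norm \<Omega> k f"
    using l2_norm_le_C_L2_norm[OF f, of 0] l2_norm_le_C_L2_norm[OF f, of k] \<open>k > 0\<close>
    by (simp add: l2_norm_eq_nrm)
  finally show "l2_norm \<Omega> (half (f 0) (f k)) \<le> C_L2_norm \<Omega> k f" by (simp add: l2_norm_eq_nrm)
qed

section \<open>The load functional given by the initial displacement\<close>

context mesh
begin

text \<open>The supremum runs over functions of norm zero as well, where the quotient is 0 because
  division by zero yields 0. For these the estimate comes from the boundedness of \<open>J\<close>
  instead of the supremum.\<close>

lemma opnorm_J_bound:
  assumes J: "bounded_linear_J \<Omega> \<T> J"
  shows "0 \<le> opnorm_J \<Omega> \<T> J"
    and "\<phi> \<in> morley \<Omega> \<T> \<Longrightarrow> H2_seminorm \<Omega> (J \<phi>) \<le> opnorm_J \<Omega> \<T> J * norm_pw \<Omega> \<T> \<phi>"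
proof -
  have "\<exists>B. \<forall>\<phi>\<in>morley \<Omega> \<T>. H2_seminorm \<Omega> (J \<phi>) \<le> B * norm_pw \<Omega> \<T> \<phi>"
    using J unfolding bounded_linear_J_def by (elim conjE)
  then obtain B where B: "\<And>\<phi>. \<phi> \<in> morley \<Omega> \<T> \<Longrightarrow> H2_seminorm \<Omega> (J \<phi>) \<le> B * norm_pw \<Omega> \<T> \<phi>"
    by blast
  have pos: "0 \<le> H2_seminorm \<Omega> \<psi>" for \<psi> by (simp add: H2_seminorm_def sum_nonneg)
  have n: "0 \<le> norm_pw \<Omega> \<T> \<phi>" if "\<phi> \<in> morley \<Omega> \<T>" for \<phi> using that by (simp add: norm_pw_eq_nrm)
  have "H2_seminorm \<Omega> (J \<phi>) / norm_pw \<Omega> \<T> \<phi> \<le> \<bar>B\<bar>" if \<phi>: "\<phi> \<in> morley \<Omega> \<T>" for \<phi>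
  proof (cases "norm_pw \<Omega> \<T> \<phi> = 0")
    case False
    then have "0 < norm_pw \<Omega> \<T> \<phi>" using n[OF \<phi>] by simp
    then have "H2_seminorm \<Omega> (J \<phi>) / norm_pw \<Omega> \<T> \<phi> \<le> B" using B[OF \<phi>] by (simp add: pos_divide_le_eq)
    then show ?thesis by linarith
  qed simp
  then have bdd: "bdd_above ((\<lambda>\<phi>. H2_seminorm \<Omega> (J \<phi>) / norm_pw \<Omega> \<T> \<phi>) ` morley \<Omega> \<T>)"
    by (rule bdd_aboveI2)
  have up: "H2_seminorm \<Omega> (J \<phi>) / norm_pw \<Omega> \<T> \<phi> \<le> opnorm_J \<Omega> \<T> J" if "\<phi> \<in> morley \<Omega> \<T>" for \<phi>
    unfolding opnorm_J_def using that bdd by (intro cSUP_upper)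
  show "0 \<le> opnorm_J \<Omega> \<T> J"
    using up[OF M.zero_mem] pos n[OF M.zero_mem] by (meson divide_nonneg_nonneg order_trans)
  show "H2_seminorm \<Omega> (J \<phi>) \<le> opnorm_J \<Omega> \<T> J * norm_pw \<Omega> \<T> \<phi>" if \<phi>: "\<phi> \<in> morley \<Omega> \<T>"
  proof (cases "norm_pw \<Omega> \<T> \<phi> = 0")
    case True
    then show ?thesis using B[OF \<phi>] by simp
  next
    case False
    then have "0 < norm_pw \<Omega> \<T> \<phi>" using n[OF \<phi>] by simp
    then show ?thesis using up[OF \<phi>] by (simp add: pos_divide_le_eq)
  qed
qed

lemma load_linear:
  assumes J: "bounded_linear_J \<Omega> \<T> J" and u0: "u0 \<in> H2 \<Omega>"
  shows "linear_on (morley \<Omega> \<T>) (\<lambda>\<phi>. a_form \<Omega> u0 (J \<phi>))"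
  unfolding linear_on_def
proof (intro ballI allI)
  interpret H: semi_inner_space "H2 \<Omega>" "a_form \<Omega>" by (rule a_form_semi_inner[OF open_domain])
  fix \<phi> \<psi> \<alpha> \<beta> assume \<phi>: "\<phi> \<in> morley \<Omega> \<T>" and \<psi>: "\<psi> \<in> morley \<Omega> \<T>"
  have JH: "J \<xi> \<in> H2 \<Omega>" if "\<xi> \<in> morley \<Omega> \<T>" for \<xi>
    using J that by (simp add: bounded_linear_J_def H20_def)
  have "a_form \<Omega> u0 (J (\<lambda>x. \<alpha> * \<phi> x + \<beta> * \<psi> x)) = a_form \<Omega> u0 (\<lambda>x. \<alpha> * J \<phi> x + \<beta> * J \<psi> x)"
    using J \<phi> \<psi> u0 JH
    by (intro a_form_AE_cong[OF open_domain] H.lin_mem M.lin_mem) (auto simp: bounded_linear_J_def)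
  then show "a_form \<Omega> u0 (J (\<lambda>x. \<alpha> * \<phi> x + \<beta> * \<psi> x)) = \<alpha> * a_form \<Omega> u0 (J \<phi>) + \<beta> * a_form \<Omega> u0 (J \<psi>)"
    using H.lin_right[OF u0] JH[OF \<phi>] JH[OF \<psi>] by (simp add: linear_on_def)
qed

lemma load_bound:
  assumes J: "bounded_linear_J \<Omega> \<T> J" and u0: "u0 \<in> H2 \<Omega>" and \<phi>: "\<phi> \<in> morley \<Omega> \<T>"
  shows "\<bar>a_form \<Omega> u0 (J \<phi>)\<bar> \<le> opnorm_J \<Omega> \<T> J * H2_seminorm \<Omega> u0 * norm_pw \<Omega> \<T> \<phi>"
proof -
  interpret H: semi_inner_space "H2 \<Omega>" "a_form \<Omega>" by (rule a_form_semi_inner[OF open_domain])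
  have JH: "J \<phi> \<in> H2 \<Omega>" using J \<phi> by (simp add: bounded_linear_J_def H20_def)
  have "\<bar>a_form \<Omega> u0 (J \<phi>)\<bar> \<le> H2_seminorm \<Omega> u0 * H2_seminorm \<Omega> (J \<phi>)"
    using H.Cauchy_Schwarz[OF u0 JH] by (simp add: H2_seminorm_eq_nrm[OF open_domain] u0 JH)
  also have "\<dots> \<le> H2_seminorm \<Omega> u0 * (opnorm_J \<Omega> \<T> J * norm_pw \<Omega> \<T> \<phi>)"
    using opnorm_J_bound(2)[OF J \<phi>] by (intro mult_left_mono) (simp_all add: H2_seminorm_def sum_nonneg)
  finally show ?thesis by (simp add: mult_ac)
qed

end

lemma sqrt_add_le:
  fixes x y :: real assumes "0 \<le> x" "0 \<le> y" "x\<^sup>2 + y\<^sup>2 \<le> m"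
  shows "x + y \<le> sqrt 2 * sqrt m"
proof -
  have "(x + y)\<^sup>2 \<le> 2 * m"
    using zero_le_power2[of "x - y"] assms(3) by (simp add: power2_eq_square algebra_simps)
  then show ?thesis by (simp add: real_le_rsqrt flip: real_sqrt_mult)
qed

section \<open>Time level zero, and time level one in residual form\<close>

context sobolev_mesh
begin

lemma nrm_zero_imp_ae_eq:
  assumes "\<phi> \<in> morley \<Omega> \<T>" "\<psi> \<in> morley \<Omega> \<T>" "M.nrm (\<lambda>x. \<phi> x - \<psi> x) = 0"
  shows "ae_eq \<Omega> \<phi> \<psi>"
  using norm_pw_zero_imp_ae_zero[of "\<lambda>x. \<phi> x - \<psi> x"] assms by (simp add: ae_eq_def norm_pw_eq_nrm)

lemma I0_exists:
  assumes J: "bounded_linear_J \<Omega> \<T> J" and u0: "u0 \<in> H2 \<Omega>"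
  shows "\<exists>u v. solves_I0 \<Omega> \<T> J u0 u v"
proof -
  have "a_form \<Omega> u0 (J \<phi>) = 0" if "\<phi> \<in> morley \<Omega> \<T>" "M.nrm \<phi> = 0" for \<phi>
    using load_bound[OF J u0 that(1)] that(2) by (simp add: norm_pw_eq_nrm)
  then obtain u where u: "u \<in> morley \<Omega> \<T>" "\<And>\<phi>. \<phi> \<in> morley \<Omega> \<T> \<Longrightarrow> a_pw \<Omega> \<T> u \<phi> = a_form \<Omega> u0 (J \<phi>)"
    by (rule vK.Riesz[OF load_linear[OF J u0]]) blast+
  obtain v where "v \<in> morley \<Omega> \<T>" "\<And>\<psi>. \<psi> \<in> morley \<Omega> \<T> \<Longrightarrow> a_pw \<Omega> \<T> v \<psi> = 1/2 * b_pw \<T> u u \<psi>"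
    by (rule vK.quadratic_form_Riesz[OF u(1)]) blast
  with u have "solves_I0 \<Omega> \<T> J u0 u v" by (simp add: solves_I0_def)
  then show ?thesis by blast
qed

lemma I0_bounds:
  assumes J: "bounded_linear_J \<Omega> \<T> J" and u0: "u0 \<in> H2 \<Omega>" and sol: "solves_I0 \<Omega> \<T> J u0 u v"
  shows "norm_pw \<Omega> \<T> u \<le> opnorm_J \<Omega> \<T> J * H2_seminorm \<Omega> u0"
    and "norm_pw \<Omega> \<T> v \<le> 1/2 * C * (opnorm_J \<Omega> \<T> J)\<^sup>2 * (H2_seminorm \<Omega> u0)\<^sup>2"
proof -
  have u: "u \<in> morley \<Omega> \<T>" and v: "v \<in> morley \<Omega> \<T>"
    and eq: "a_pw \<Omega> \<T> u u = a_form \<Omega> u0 (J u)"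
    and eqv: "\<And>\<psi>. \<psi> \<in> morley \<Omega> \<T> \<Longrightarrow> a_pw \<Omega> \<T> v \<psi> = 1/2 * b_pw \<T> u u \<psi>"
    using sol by (auto simp: solves_I0_def)
  let ?c = "opnorm_J \<Omega> \<T> J * H2_seminorm \<Omega> u0"
  have c: "0 \<le> ?c" using opnorm_J_bound(1)[OF J] by (simp add: H2_seminorm_def sum_nonneg)
  have n: "0 \<le> norm_pw \<Omega> \<T> u" using u by (simp add: norm_pw_eq_nrm)
  have "norm_pw \<Omega> \<T> u * norm_pw \<Omega> \<T> u = a_form \<Omega> u0 (J u)"
    using M.nrm_power2[OF u] eq by (simp add: norm_pw_eq_nrm power2_eq_square)
  also have "\<dots> \<le> ?c * norm_pw \<Omega> \<T> u" using load_bound[OF J u0 u] by linarith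
  finally show nu: "norm_pw \<Omega> \<T> u \<le> ?c"
    using c n by (cases "norm_pw \<Omega> \<T> u = 0") (simp_all add: mult_le_cancel_right)
  have "norm_pw \<Omega> \<T> v \<le> 1/2 * C * (norm_pw \<Omega> \<T> u)\<^sup>2"
    using vK.quadratic_form_bound[OF u v eqv] by (simp add: norm_pw_eq_nrm)
  also have "\<dots> \<le> 1/2 * C * ?c\<^sup>2"
    using nu n C_pos by (intro mult_left_mono power_mono) auto
  finally show "norm_pw \<Omega> \<T> v \<le> 1/2 * C * (opnorm_J \<Omega> \<T> J)\<^sup>2 * (H2_seminorm \<Omega> u0)\<^sup>2"
    by (simp add: power_mult_distrib)
qed

text \<open>\<open>u\<close> and \<open>u'\<close> agree only up to a null function, so
  \<open>v\<close> and \<open>v'\<close> solve formally different equations;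
  \<open>quadratic_form_unique\<close> bridges the gap.\<close>

lemma I0_unique:
  assumes sol: "solves_I0 \<Omega> \<T> J u0 u v" "solves_I0 \<Omega> \<T> J u0 u' v'"
  shows "ae_eq \<Omega> u u'" "ae_eq \<Omega> v v'"
proof -
  have mem: "u \<in> morley \<Omega> \<T>" "v \<in> morley \<Omega> \<T>" "u' \<in> morley \<Omega> \<T>" "v' \<in> morley \<Omega> \<T>"
    using sol by (auto simp: solves_I0_def)
  define d where "d = (\<lambda>x. u x - u' x)"
  have d: "d \<in> morley \<Omega> \<T>" using mem by (simp add: d_def)
  have "a_pw \<Omega> \<T> d d = a_pw \<Omega> \<T> u d - a_pw \<Omega> \<T> u' d"
    using M.left_simps(4)[OF d mem(1,3)] by (simp add: d_def)
  also have "\<dots> = 0" using sol d by (simp add: solves_I0_def)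
  finally have 0: "M.nrm (\<lambda>x. u x - u' x) = 0" by (simp add: M.nrm_def d_def)
  then show "ae_eq \<Omega> u u'" using mem by (intro nrm_zero_imp_ae_eq)
  have "a_pw \<Omega> \<T> v \<psi> = 1/2 * b_pw \<T> u u \<psi>" "a_pw \<Omega> \<T> v' \<psi> = 1/2 * b_pw \<T> u' u' \<psi>"
    if "\<psi> \<in> morley \<Omega> \<T>" for \<psi>
    using sol that by (simp_all add: solves_I0_def)
  then have "M.nrm (\<lambda>x. v x - v' x) = 0"
    by (rule vK.quadratic_form_unique[OF mem(1,3) 0 mem(2,4)])
  then show "ae_eq \<Omega> v v'" using mem by (intro nrm_zero_imp_ae_eq)
qed

lemma solves_I1_iff:
  assumes u0: "u0 \<in> morley \<Omega> \<T>" and u1: "u1 \<in> L2 \<Omega>"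
  shows "solves_I1 \<Omega> \<T> k u1 f u0 v0 u v \<longleftrightarrow> u \<in> morley \<Omega> \<T> \<and> v \<in> morley \<Omega> \<T> \<and>
    (\<forall>\<phi>\<in>morley \<Omega> \<T>. vK.residual k (l2_inner \<Omega> u1) (l2_inner \<Omega> (half (f 0) (f k))) u0 v0 u v \<phi> = 0) \<and>
    (\<forall>\<psi>\<in>morley \<Omega> \<T>. a_pw \<Omega> \<T> v \<psi> = 1/2 * b_pw \<T> u u \<psi>)"
proof -
  have "l2_inner \<Omega> (\<lambda>x. dt_half k u0 u x - u1 x) \<phi> = l2_inner \<Omega> (\<lambda>x. (u x - u0 x) / k) \<phi> - l2_inner \<Omega> u1 \<phi>"
    if "u \<in> morley \<Omega> \<T>" "\<phi> \<in> morley \<Omega> \<T>" for \<phi>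
    unfolding dt_half_def using that u0 u1
    by (intro L2.left_simps(4)) (auto intro!: L2.mem morley_L2)
  then show ?thesis
    by (auto simp: solves_I1_def vK.residual_def half_def)
qed

end

theorem theorem2p1:
  fixes \<Omega> :: "(real^2) set" and \<T> :: "(real^2) set set" and \<kappa> :: real
    and Tend k C_dS :: real and N :: nat
    and J :: "(real^2 \<Rightarrow> real) \<Rightarrow> real^2 \<Rightarrow> real"
    and u0 u1 :: "real^2 \<Rightarrow> real" and f :: "real \<Rightarrow> real^2 \<Rightarrow> real"
  assumes "polygonal_lipschitz_domain \<Omega>"
    and "triangulation_of \<Omega> \<T>" and "shape_regular \<kappa> \<T>"
    and "N > 0" and "k = Tend / real N" and "k > 0"
    and "discrete_sobolev_constant \<Omega> \<T> C_dS"
    and "bounded_linear_J \<Omega> \<T> J"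
    and "u0 \<in> H20 \<Omega>" and "u1 \<in> L2 \<Omega>" and "f \<in> C_L2 \<Omega> k"
  shows "(\<exists>uM0 vM0. solves_I0 \<Omega> \<T> J u0 uM0 vM0)
    \<and> (\<forall>uM0 vM0 uM0' vM0'. solves_I0 \<Omega> \<T> J u0 uM0 vM0 \<and> solves_I0 \<Omega> \<T> J u0 uM0' vM0'
         \<longrightarrow> ae_eq \<Omega> uM0 uM0' \<and> ae_eq \<Omega> vM0 vM0')
    \<and> (\<forall>uM0 vM0. solves_I0 \<Omega> \<T> J u0 uM0 vM0 \<longrightarrow>
         norm_pw \<Omega> \<T> uM0 \<le> opnorm_J \<Omega> \<T> J * H2_seminorm \<Omega> u0
         \<and> norm_pw \<Omega> \<T> vM0 \<le> 1/2 * C_dS * (opnorm_J \<Omega> \<T> J)\<^sup>2 * (H2_seminorm \<Omega> u0)\<^sup>2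
         \<and> (\<exists>uM1 vM1. solves_I1 \<Omega> \<T> k u1 f uM0 vM0 uM1 vM1)
         \<and> (\<forall>uM1 vM1. solves_I1 \<Omega> \<T> k u1 f uM0 vM0 uM1 vM1 \<longrightarrow>
              norm_pw \<Omega> \<T> uM1 + norm_pw \<Omega> \<T> vM1
                \<le> sqrt 2 * sqrt (M2_check \<Omega> \<T> J C_dS k u0 u1 f))
         \<and> (M2 \<Omega> \<T> J C_dS k u0 u1 f \<le> 1 \<longrightarrow>
              (\<forall>uM1 vM1 uM1' vM1'.
                 solves_I1 \<Omega> \<T> k u1 f uM0 vM0 uM1 vM1 \<and> solves_I1 \<Omega> \<T> k u1 f uM0 vM0 uM1' vM1'
                 \<longrightarrow> ae_eq \<Omega> uM1 uM1' \<and> ae_eq \<Omega> vM1 vM1')))"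
proof -
  interpret sobolev_mesh \<Omega> \<T> C_dS
    using assms(1,2,7) by unfold_locales
  note J = assms(8) and k = \<open>k > 0\<close> and u1 = \<open>u1 \<in> L2 \<Omega>\<close>
  have u0: "u0 \<in> H2 \<Omega>" using assms(9) by (simp add: H20_def)
  let ?V = "morley \<Omega> \<T>" and ?g1 = "l2_inner \<Omega> u1" and ?g = "l2_inner \<Omega> (half (f 0) (f k))"
  let ?A = "(opnorm_J \<Omega> \<T> J)\<^sup>2 * (H2_seminorm \<Omega> u0)\<^sup>2" and ?F = "C_L2_norm \<Omega> k f"
  let ?m = "M2_check \<Omega> \<T> J C_dS k u0 u1 f"
  note f = l2_norm_half_le[OF \<open>f \<in> C_L2 \<Omega> k\<close> k]
  have g1: "linear_on ?V ?g1" and g: "linear_on ?V ?g"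
    using L2.lin_right[OF u1] L2.lin_right[OF f(1)] by (simp_all add: linear_on_def morley_L2)
  have U: "\<bar>?g1 \<phi>\<bar> \<le> l2_norm \<Omega> u1 * L2.nrm \<Omega> \<phi>" if "\<phi> \<in> ?V" for \<phi>
    using L2.Cauchy_Schwarz[OF u1 morley_L2[OF that]] by (simp add: l2_norm_eq_nrm)
  have G: "\<bar>?g \<phi>\<bar> \<le> ?F * L2.nrm \<Omega> \<phi>" if "\<phi> \<in> ?V" for \<phi>
    using L2.Cauchy_Schwarz[OF f(1) morley_L2[OF that]] mult_right_mono[OF f(2), of "L2.nrm \<Omega> \<phi>"] morley_L2[OF that]
    by (simp add: l2_norm_eq_nrm)
  have A: "0 \<le> ?A" by simp
  have step: "norm_pw \<Omega> \<T> uM0 \<le> opnorm_J \<Omega> \<T> J * H2_seminorm \<Omega> u0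
         \<and> norm_pw \<Omega> \<T> vM0 \<le> 1/2 * C_dS * (opnorm_J \<Omega> \<T> J)\<^sup>2 * (H2_seminorm \<Omega> u0)\<^sup>2
         \<and> (\<exists>uM1 vM1. solves_I1 \<Omega> \<T> k u1 f uM0 vM0 uM1 vM1)
         \<and> (\<forall>uM1 vM1. solves_I1 \<Omega> \<T> k u1 f uM0 vM0 uM1 vM1 \<longrightarrow>
              norm_pw \<Omega> \<T> uM1 + norm_pw \<Omega> \<T> vM1 \<le> sqrt 2 * sqrt ?m)
         \<and> (M2 \<Omega> \<T> J C_dS k u0 u1 f \<le> 1 \<longrightarrow>
              (\<forall>uM1 vM1 uM1' vM1'.
                 solves_I1 \<Omega> \<T> k u1 f uM0 vM0 uM1 vM1 \<and> solves_I1 \<Omega> \<T> k u1 f uM0 vM0 uM1' vM1'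
                 \<longrightarrow> ae_eq \<Omega> uM1 uM1' \<and> ae_eq \<Omega> vM1 vM1'))"
    if I0: "solves_I0 \<Omega> \<T> J u0 uM0 vM0" for uM0 vM0
  proof -
    have mem0: "uM0 \<in> ?V" "vM0 \<in> ?V"
      and eq0: "\<And>\<psi>. \<psi> \<in> ?V \<Longrightarrow> a_pw \<Omega> \<T> vM0 \<psi> = 1/2 * b_pw \<T> uM0 uM0 \<psi>"
      using I0 by (auto simp: solves_I0_def)
    note bounds = I0_bounds[OF J u0 I0]
    note I1 = solves_I1_iff[OF mem0(1) u1, of k f vM0]
    have n0: "0 \<le> norm_pw \<Omega> \<T> uM0" "0 \<le> norm_pw \<Omega> \<T> vM0"
      using mem0 by (simp_all add: norm_pw_eq_nrm)
    have nu0: "(norm_pw \<Omega> \<T> uM0)\<^sup>2 \<le> ?A"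
      using power_mono[OF bounds(1) n0(1), of 2] by (simp add: power_mult_distrib)
    have nv0: "norm_pw \<Omega> \<T> vM0 \<le> 1/2 * C_dS * ?A" using bounds(2) by (simp add: mult.assoc)
    have nv0': "(norm_pw \<Omega> \<T> vM0)\<^sup>2 \<le> 1/4 * C_dS\<^sup>2 * ?A\<^sup>2"
      using power_mono[OF nv0 n0(2), of 2] by (simp add: power_mult_distrib power_divide)
    have exist: "\<exists>uM1 vM1. solves_I1 \<Omega> \<T> k u1 f uM0 vM0 uM1 vM1"
    proof -
      have "\<exists>u\<in>?V. \<exists>v\<in>?V. (\<forall>\<psi>\<in>?V. a_pw \<Omega> \<T> v \<psi> = 1/2 * b_pw \<T> u u \<psi>) \<and>
          (\<forall>\<phi>\<in>?V. vK.residual k ?g1 ?g uM0 vM0 u v \<phi> = 0)"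
        by (rule vK.step_exists[OF k g1 g U G mem0 eq0])
      then show ?thesis unfolding I1 by blast
    qed
    \<comment> \<open>Kept in squared form for two purposes: the bound on the sum of the norms, and
      the bound of \<open>v\<close> by \<open>sqrt ?m\<close> in the uniqueness part.\<close>
    have le: "(norm_pw \<Omega> \<T> u)\<^sup>2 + (norm_pw \<Omega> \<T> v)\<^sup>2 \<le> ?m"
      if sol: "solves_I1 \<Omega> \<T> k u1 f uM0 vM0 u v" for u v
    proof -
      have "(M.nrm u)\<^sup>2 + (M.nrm v)\<^sup>2
          \<le> (M.nrm uM0)\<^sup>2 + (M.nrm vM0)\<^sup>2 + 2 * (l2_norm \<Omega> u1)\<^sup>2 + k\<^sup>2 * ?F\<^sup>2 / 2"
        by (rule vK.step_bound[OF k g1 g U G mem0]) (use sol[unfolded I1] eq0 in auto)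
      \<comment> \<open>The square of ?A stems from \<open>v\<close> at level zero. The loads enter
        with weights 2 and 1/2 from \<open>step_bound\<close>, below the weights 4 and 1
        here.\<close>
      moreover have "?m = ?A + 1/4 * C_dS\<^sup>2 * ?A\<^sup>2 + 4 * (l2_norm \<Omega> u1)\<^sup>2 + k\<^sup>2 * ?F\<^sup>2"
        by (simp add: M2_check_def algebra_simps power2_eq_square)
      moreover have "0 \<le> (l2_norm \<Omega> u1)\<^sup>2" "0 \<le> k\<^sup>2 * ?F\<^sup>2" by simp_all
      ultimately show ?thesis using nu0 nv0' unfolding norm_pw_eq_nrm by argo
    qed
    have bound: "norm_pw \<Omega> \<T> u + norm_pw \<Omega> \<T> v \<le> sqrt 2 * sqrt ?m"
      if sol: "solves_I1 \<Omega> \<T> k u1 f uM0 vM0 u v" for u v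
      using sol le[OF sol] by (intro sqrt_add_le) (auto simp: I1 norm_pw_eq_nrm)
    have uniq: "ae_eq \<Omega> u u' \<and> ae_eq \<Omega> v v'"
      if small: "M2 \<Omega> \<T> J C_dS k u0 u1 f \<le> 1" and sol: "solves_I1 \<Omega> \<T> k u1 f uM0 vM0 u v"
        and sol': "solves_I1 \<Omega> \<T> k u1 f uM0 vM0 u' v'" for u v u' v'
    proof -
      have mem: "u \<in> ?V" "v \<in> ?V" "u' \<in> ?V" "v' \<in> ?V" using sol sol' by (simp_all add: I1)
      have m: "0 \<le> ?m" using le[OF sol] zero_le_power2[of "norm_pw \<Omega> \<T> u"] zero_le_power2[of "norm_pw \<Omega> \<T> v"] by linarith
      \<comment> \<open>As both summands are nonnegative, smallness of \<open>M2\<close> bounds each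
        of them by 1.\<close>
      have CA: "C_dS\<^sup>2 * ?A + C_dS\<^sup>2 * ?m \<le> 1" using small by (simp add: M2_def distrib_left)
      have "0 \<le> C_dS\<^sup>2 * ?A" "0 \<le> C_dS\<^sup>2 * ?m" using m by simp_all
      with CA have CA1: "C_dS\<^sup>2 * ?A \<le> 1" "C_dS\<^sup>2 * ?m \<le> 1" by linarith+
      have "(M.nrm v)\<^sup>2 \<le> ?m" "(M.nrm v')\<^sup>2 \<le> ?m"
        using le[OF sol] le[OF sol'] zero_le_power2[of "M.nrm u"] zero_le_power2[of "M.nrm u'"]
        unfolding norm_pw_eq_nrm by linarith+
      then have Q: "M.nrm v \<le> sqrt ?m" "M.nrm v' \<le> sqrt ?m" by (simp_all add: real_le_rsqrt)
      have "(C_dS * sqrt ?m)\<^sup>2 \<le> 1" using CA1(2) m by (simp add: power_mult_distrib)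
      then have 1: "C_dS * sqrt ?m \<le> 1" by (simp add: abs_square_le_1 abs_le_iff)
      have 2: "C_dS * M.nrm vM0 \<le> 1/2"
      proof -
        have "C_dS * M.nrm vM0 \<le> C_dS * (1/2 * C_dS * ?A)"
          using nv0 C_pos unfolding norm_pw_eq_nrm by (intro mult_left_mono) simp_all
        also have "\<dots> = 1/2 * (C_dS\<^sup>2 * ?A)" by (simp add: power2_eq_square)
        finally show ?thesis using CA1(1) by linarith
      qed
      have 3: "C_dS\<^sup>2 * (M.nrm uM0)\<^sup>2 \<le> 1"
        using mult_left_mono[OF nu0, of "C_dS\<^sup>2"] CA1(1) by (simp add: norm_pw_eq_nrm)
      \<comment> \<open>The three contributions are at most 1, 1/2 and 1/4, which leaves a margin
        below 2.\<close>
      have "C_dS * (sqrt ?m + M.nrm vM0) + C_dS\<^sup>2 * (M.nrm uM0)\<^sup>2 / 4 < 2"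
        using 1 2 3 by (simp add: distrib_left)
      note u = vK.step_unique[OF k less_imp_le[OF C_pos] mem0 mem, of ?g1 ?g, OF _ _ _ _ Q this]
      have "M.nrm (\<lambda>x. u x - u' x) = 0" "M.nrm (\<lambda>x. v x - v' x) = 0"
        using sol sol' by (auto intro!: u simp: I1)
      then show ?thesis using mem by (simp add: nrm_zero_imp_ae_eq)
    qed
    show ?thesis using bounds exist bound uniq by blast
  qed
  show ?thesis
    using I0_exists[OF J u0] I0_unique step by blast
qed

end
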